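(* Suppose $\mathbb{P}(B>x)=L(x)x^{-\alpha}$ for some $\alpha>2$, $\alpha\neq 3$, and $L$ slowly varying. Let $\mu=\mathbb{E}[B^2]/(2\mathbb{E}[B])$ and, for any $k>1$, define $x_\rho:=k\,\mu\,(\alpha-1)\frac{1}{1-\rho}\log\frac{1}{1-\rho}$. Then $$\sup_{x\geq x_\rho}\left|\frac{\mathbb{P}(M_\tau>x)}{\frac{\rho}{1-\rho}\mathbb{P}(B>x)}-1\right|\rightarrow 0$$ holds as $\rho\uparrow 1$. Furthermore, this relation remains valid for $k=1$ provided that $L(x)/(\log x)^\alpha\rightarrow\infty$ as $x\to\infty$.
   Context: Let $B,B_0,B_1,B_2,\ldots$ be i.i.d. non-negative random variables with $\mathbb{P}(B\le 0)=0$, mean $\mathbb{E}[B]>0$ and finite variance. A function $L$ is slowly varying if $\lim_{x\to\infty}L(ax)/L(x)=1$ for all $a>0$. Let $N^1(t)$, $t\ge 0$, be a Poisson process with rate $1/\mathbb{E}[B]$, independent of the $B_i$; for $\rho\in(0,1)$ let $N^\rho(t):=N^1(\rho t)$, a Poisson process with rate $\rho/\mathbb{E}[B]$. Define $X(t)=X^\rho(t):=X_0+\sum_{i=1}^{N^\rho(t)}B_i-t$ for $t\ge 0$, with $X_0:=B_0$. Let $\tau=\tau^\rho:=\inf\{t\ge 0:X^\rho(t)=0\}$ be the first hitting time of zero and $M_\tau=M_\tau^\rho:=\sup\{X^\rho(t):0\le t\le\tau^\rho\}$. The distribution of $B$ does not depend on $\rho$. *)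

theory Defs
  imports "HOL-Probability.Probability"
begin

definition slowly_varying :: "(real \<Rightarrow> real) \<Rightarrow> bool" where
  "slowly_varying L \<longleftrightarrow> (\<forall>a>0. ((\<lambda>x. L (a * x) / L x) \<longlongrightarrow> 1) at_top)"

text \<open>
  The process is only constrained at times \<open>t \<ge> 0\<close>.  The truncated subtraction on \<^typ>\<open>nat\<close>
  is harmless because paths are nondecreasing.  Path regularity is required for every outcome,
  not just almost surely, so that path functionals such as hitting times and running suprema
  are measurable even if \<open>M\<close> is not complete.
\<close>

definition (in prob_space) poisson_process :: "real \<Rightarrow> (real \<Rightarrow> 'a \<Rightarrow> nat) \<Rightarrow> bool" where
  "poisson_process rate N \<longleftrightarrow>
     (\<forall>t\<ge>0. N t \<in> measurable M (count_space UNIV)) \<and>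
     (\<forall>\<omega>\<in>space M. N 0 \<omega> = 0 \<and> mono_on {0..} (\<lambda>t. N t \<omega>) \<and>
        (\<forall>t\<ge>0. continuous (at_right t) (\<lambda>s. N s \<omega>))) \<and>
     (\<forall>s t. 0 \<le> s \<and> s < t \<longrightarrow>
        distr M (count_space UNIV) (\<lambda>\<omega>. N t \<omega> - N s \<omega>)
          = measure_pmf (poisson_pmf (rate * (t - s)))) \<and>
     (\<forall>(n::nat) ts. 0 \<le> ts 0 \<and> (\<forall>i<n. ts i < ts (Suc i)) \<longrightarrow>
        indep_vars (\<lambda>_. count_space UNIV) (\<lambda>i \<omega>. N (ts (Suc i)) \<omega> - N (ts i) \<omega>) {..<n})"

text \<open>
  Independence of random elements with values in measurable spaces of possibly different types
  (\<open>indep_var\<close> requires a common value type): the generated sub-\<open>\<sigma>\<close>-algebras are independent.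
\<close>

definition (in prob_space) indep_elements ::
  "'b measure \<Rightarrow> ('a \<Rightarrow> 'b) \<Rightarrow> 'c measure \<Rightarrow> ('a \<Rightarrow> 'c) \<Rightarrow> bool" where
  "indep_elements S X T Y \<longleftrightarrow>
     X \<in> measurable M S \<and> Y \<in> measurable M T \<and>
     indep_set (sets (vimage_algebra (space M) X S)) (sets (vimage_algebra (space M) Y T))"

text \<open>
  In the next three definitions \<open>b i\<close> is the \<open>i\<close>-th jump size \<open>B\<^sub>i\<close>, with \<open>b 0\<close> the initial value,
  \<open>N\<close> is the unit-load arrival process \<open>N\<^sup>1\<close>, and the arrival process at load \<open>\<rho>\<close> is
  \<open>t \<mapsto> N (\<rho> * t)\<close>.
\<close>

definition workload ::
  "(nat \<Rightarrow> 'a \<Rightarrow> real) \<Rightarrow> (real \<Rightarrow> 'a \<Rightarrow> nat) \<Rightarrow> real \<Rightarrow> real \<Rightarrow> 'a \<Rightarrow> real" where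
  "workload b N \<rho> t \<omega> = b 0 \<omega> + (\<Sum>i=1..N (\<rho> * t) \<omega>. b i \<omega>) - t"

text \<open>Extended-real valued: the hitting time is \<open>\<infinity>\<close> if zero is never reached.\<close>

definition hitting_time_zero ::
  "(nat \<Rightarrow> 'a \<Rightarrow> real) \<Rightarrow> (real \<Rightarrow> 'a \<Rightarrow> nat) \<Rightarrow> real \<Rightarrow> 'a \<Rightarrow> ereal" where
  "hitting_time_zero b N \<rho> \<omega> = (INF t\<in>{t. 0 \<le> t \<and> workload b N \<rho> t \<omega> = 0}. ereal t)"

definition cycle_max ::
  "(nat \<Rightarrow> 'a \<Rightarrow> real) \<Rightarrow> (real \<Rightarrow> 'a \<Rightarrow> nat) \<Rightarrow> real \<Rightarrow> 'a \<Rightarrow> ereal" where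
  "cycle_max b N \<rho> \<omega> =
     (SUP t\<in>{t. 0 \<le> t \<and> ereal t \<le> hitting_time_zero b N \<rho> \<omega>}. ereal (workload b N \<rho> t \<omega>))"

definition x_threshold :: "real \<Rightarrow> real \<Rightarrow> real \<Rightarrow> real \<Rightarrow> real" where
  "x_threshold \<mu> \<alpha> k \<rho> = k * \<mu> * (\<alpha> - 1) * (1 / (1 - \<rho>)) * ln (1 / (1 - \<rho>))"

end

theory Submission
  imports Defs "HOL-Real_Asymp.Real_Asymp"
begin

text \<open>
  The proof combines an exact formula with a local version of the principle of one big jump.

  Let \<open>\<nu> = \<rho> / E[B]\<close> be the arrival rate and \<open>f\<close> the density of the integrated tail law, that is, the tail
  of \<open>B\<close> divided by \<open>E[B]\<close>; its mean is \<open>\<mu>\<close>. Let \<open>W\<close> be the distribution function of a geometric sum,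
  with parameter \<open>\<rho>\<close>, of variables with density \<open>f\<close>: it has an atom \<open>1 - \<rho>\<close> at zero and a density \<open>w\<close>
  otherwise. The renewal equation of the geometric sum says that \<open>w z = \<nu> (W z - E[W (z - B)])\<close>
  (\<open>drift_W\<close>), so \<open>W (x - X\<^sub>t)\<close> is a martingale, and the workload started from \<open>y\<close> reaches zero before
  exceeding \<open>x\<close> with probability \<open>W (x - y) / W x\<close>. Averaging over the initial value \<open>B\<^sub>0\<close> yields
  \<open>P(M\<^sub>\<tau> > x) = w x / (\<nu> W x)\<close> (\<open>cycle_prob_formula\<close>). By Markov's inequality \<open>W x\<close> tends to one
  uniformly in the range of the theorem. It remains to show that \<open>(1 - \<rho>) w x\<close> is asymptotically \<open>f x\<close>
  (\<open>w_asymptotic\<close>).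

  For the latter, \<open>w\<close> is the sum of the convolution powers of \<open>f\<close> with geometric weights. A sum of \<open>n\<close>
  variables is close to \<open>x\<close> with a density of about \<open>n f x\<close>, since one of the variables is close to \<open>x\<close>
  and the others are small (\<open>f_pow_lower\<close>, \<open>f_pow_upper\<close>); the mean number of variables is
  \<open>\<rho> / (1 - \<rho>)\<close>. What has to be excluded is that \<open>x\<close> is reached without a big jump. If \<open>n\<close> is well
  below \<open>x / \<mu>\<close>, Chernoff's bound does this (\<open>small_pow_le_few\<close>). If \<open>n\<close> is larger, the geometric weight is
  small: on the range \<open>x \<ge> \<mu> (\<alpha> - 1) (1 - \<rho>)\<^sup>-\<^sup>1 ln (1 / (1 - \<rho>))\<close> it is at most of order
  \<open>(1 - \<rho>)\<close> to the power \<open>\<alpha>\<close>, up to an arbitrarily small loss in the exponent, and the unweighted sum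
  of the convolution powers, the renewal density, is bounded (\<open>sum_f_pow_le\<close>). The target \<open>f x / (1 - \<rho>)\<close>
  is, at the lower end of the range, of order \<open>(1 - \<rho>)\<close> to the power \<open>\<alpha> - 1\<close> up to slowly varying
  factors, hence larger by almost a full power.

  The exact formula is derived from the definition of the process through its skeleton at the times
  \<open>k h\<close>. The skeleton is a random walk with independent compound Poisson steps, and for every outcome the
  event that it exceeds \<open>x\<close> before becoming nonpositive agrees, for all small \<open>h\<close>, with the event
  \<open>M\<^sub>\<tau> > x\<close>. The crossing probabilities of the walk are enclosed between functions that are
  superharmonic and subharmonic up to errors of order \<open>h\<^sup>2\<close> per step, which the negative drift of the walk
  absorbs (\<open>hit_prob_upper\<close>, \<open>hit_prob_lower\<close>). If \<open>B\<close> has atoms, \<open>w\<close> is discontinuous; its jumps go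
  downwards, so \<open>W\<close> serves for the upper bound, and local averages of \<open>W\<close> serve for the lower bound.
\<close>

section \<open>Convolution powers of densities on the half-line\<close>

text \<open>
  Values in \<^typ>\<open>ennreal\<close> make Tonelli available without integrability conditions, and
  functions, rather than measures, are convolved because the asymptotics below are pointwise
  statements about densities that may jump.
\<close>

definition fconv :: "(real \<Rightarrow> ennreal) \<Rightarrow> (real \<Rightarrow> ennreal) \<Rightarrow> real \<Rightarrow> ennreal" where
  "fconv f g x = (\<integral>\<^sup>+u. f (x - u) * g u \<partial>lborel)"

text \<open>
  The exponents are shifted: \<open>conv_pow f n\<close> is the \<open>(n + 1)\<close>-fold convolution power, since the
  unit of the convolution is not a function.
\<close>

primrec conv_pow :: "(real \<Rightarrow> ennreal) \<Rightarrow> nat \<Rightarrow> real \<Rightarrow> ennreal" where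
  "conv_pow f 0 = f"
| "conv_pow f (Suc n) = fconv f (conv_pow f n)"

lemma measurable_fconv [measurable]:
  assumes [measurable]: "f \<in> borel_measurable borel" "g \<in> borel_measurable borel"
  shows "fconv f g \<in> borel_measurable borel"
proof -
  have "(\<lambda>x. \<integral>\<^sup>+u. f (x - u) * g u \<partial>lborel) \<in> borel_measurable borel" by measurable
  then show ?thesis by (simp add: fconv_def[abs_def])
qed

lemma measurable_conv_pow [measurable]:
  "f \<in> borel_measurable borel \<Longrightarrow> conv_pow f n \<in> borel_measurable borel"
  by (induction n) auto

lemma nn_integral_reflect:
  assumes [measurable]: "f \<in> borel_measurable borel"
  shows "(\<integral>\<^sup>+u. f u \<partial>lborel) = (\<integral>\<^sup>+u. f (x - u :: real) \<partial>lborel)"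
  by (subst nn_integral_real_affine[where c = "-1" and t = x]) auto

lemma fconv_commute:
  assumes [measurable]: "f \<in> borel_measurable borel" "g \<in> borel_measurable borel"
  shows "fconv f g = fconv g f"
  unfolding fconv_def
proof
  fix x
  show "(\<integral>\<^sup>+u. f (x - u) * g u \<partial>lborel) = (\<integral>\<^sup>+u. g (x - u) * f u \<partial>lborel)"
    by (subst nn_integral_reflect[where x = x]) (auto simp: mult.commute)
qed

lemma fconv_left_commute:
  assumes [measurable]: "f \<in> borel_measurable borel" "g \<in> borel_measurable borel"
    "h \<in> borel_measurable borel"
  shows "fconv f (fconv g h) = fconv g (fconv f h)"
proof
  fix x
  have "fconv f (fconv g h) x
      = (\<integral>\<^sup>+u. \<integral>\<^sup>+v. f (x - u) * (g (u - v) * h v) \<partial>lborel \<partial>lborel)"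
    by (simp add: fconv_def nn_integral_cmult)
  also have "\<dots> = (\<integral>\<^sup>+v. \<integral>\<^sup>+u. f (x - u) * (g (u - v) * h v) \<partial>lborel \<partial>lborel)"
    by (rule lborel_pair.Fubini') measurable
  also have "\<dots> = (\<integral>\<^sup>+v. \<integral>\<^sup>+u. g (x - u) * (f (u - v) * h v) \<partial>lborel \<partial>lborel)"
  proof (rule nn_integral_cong)
    fix v :: real
    show "(\<integral>\<^sup>+u. f (x - u) * (g (u - v) * h v) \<partial>lborel)
        = (\<integral>\<^sup>+u. g (x - u) * (f (u - v) * h v) \<partial>lborel)"
      by (subst nn_integral_reflect[where x = "x + v"]) (auto simp: algebra_simps)
  qed
  also have "\<dots> = (\<integral>\<^sup>+u. \<integral>\<^sup>+v. g (x - u) * (f (u - v) * h v) \<partial>lborel \<partial>lborel)"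
    by (rule lborel_pair.Fubini') measurable
  also have "\<dots> = fconv g (fconv f h) x"
    by (simp add: fconv_def nn_integral_cmult)
  finally show "fconv f (fconv g h) x = fconv g (fconv f h) x" .
qed

lemma fconv_assoc:
  assumes [measurable]: "f \<in> borel_measurable borel" "g \<in> borel_measurable borel"
    "h \<in> borel_measurable borel"
  shows "fconv (fconv f g) h = fconv f (fconv g h)"
  by (metis assms fconv_commute fconv_left_commute measurable_fconv)

lemma fconv_add_left:
  assumes [measurable]: "f \<in> borel_measurable borel" "f' \<in> borel_measurable borel"
    "g \<in> borel_measurable borel"
  shows "fconv (\<lambda>x. f x + f' x) g x = fconv f g x + fconv f' g x"
  by (simp add: fconv_def distrib_right nn_integral_add)

lemma fconv_add_right:
  assumes [measurable]: "f \<in> borel_measurable borel" "f' \<in> borel_measurable borel"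
    "g \<in> borel_measurable borel"
  shows "fconv g (\<lambda>x. f x + f' x) x = fconv g f x + fconv g f' x"
  by (simp add: fconv_def distrib_left nn_integral_add)

lemma fconv_cmult_right:
  assumes [measurable]: "f \<in> borel_measurable borel" "g \<in> borel_measurable borel"
  shows "fconv g (\<lambda>x. c * f x) x = c * fconv g f x"
  by (simp add: fconv_def mult.left_commute[of _ c] nn_integral_cmult)

lemma fconv_mono: "(\<And>x. f x \<le> f' x) \<Longrightarrow> (\<And>x. g x \<le> g' x) \<Longrightarrow> fconv f g x \<le> fconv f' g' x"
  unfolding fconv_def by (intro nn_integral_mono mult_mono) auto

lemma fconv_eq_0_neg:
  assumes "\<And>x. x < 0 \<Longrightarrow> f x = 0" "\<And>x. x < 0 \<Longrightarrow> g x = 0" "x < 0"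
  shows "fconv f g x = 0"
proof -
  have "f (x - u) * g u = 0" for u
    using assms(1)[of "x - u"] assms(2)[of u] assms(3) by (cases "u < 0") auto
  then have "(\<lambda>u. f (x - u) * g u) = (\<lambda>_. 0)" by (rule ext)
  then show ?thesis unfolding fconv_def by simp
qed

lemma conv_pow_eq_0_neg: "(\<And>x. x < 0 \<Longrightarrow> f x = 0) \<Longrightarrow> x < 0 \<Longrightarrow> conv_pow f n x = 0"
  by (induction n arbitrary: x) (auto intro: fconv_eq_0_neg)

lemma nn_integral_fconv:
  assumes [measurable]: "f \<in> borel_measurable borel" "g \<in> borel_measurable borel"
  shows "(\<integral>\<^sup>+x. fconv f g x \<partial>lborel) = (\<integral>\<^sup>+x. f x \<partial>lborel) * (\<integral>\<^sup>+x. g x \<partial>lborel)"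
proof -
  have "(\<integral>\<^sup>+x. fconv f g x \<partial>lborel) = (\<integral>\<^sup>+u. \<integral>\<^sup>+x. f (x - u) * g u \<partial>lborel \<partial>lborel)"
    unfolding fconv_def by (rule lborel_pair.Fubini') measurable
  also have "\<dots> = (\<integral>\<^sup>+u. (\<integral>\<^sup>+x. f x \<partial>lborel) * g u \<partial>lborel)"
  proof (intro nn_integral_cong)
    fix u :: real
    have "(\<integral>\<^sup>+x. f x \<partial>lborel) = (\<integral>\<^sup>+x. f (x - u) \<partial>lborel)"
      by (subst nn_integral_real_affine[where c = 1 and t = "-u"]) auto
    then show "(\<integral>\<^sup>+x. f (x - u) * g u \<partial>lborel) = (\<integral>\<^sup>+x. f x \<partial>lborel) * g u"
      by (simp add: nn_integral_multc)
  qed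
  also have "\<dots> = (\<integral>\<^sup>+x. f x \<partial>lborel) * (\<integral>\<^sup>+x. g x \<partial>lborel)" by (simp add: nn_integral_cmult)
  finally show ?thesis .
qed

lemma nn_integral_conv_pow:
  assumes [measurable]: "f \<in> borel_measurable borel"
  shows "(\<integral>\<^sup>+x. conv_pow f n x \<partial>lborel) = (\<integral>\<^sup>+x. f x \<partial>lborel) ^ Suc n"
  by (induction n) (auto simp: nn_integral_fconv)

text \<open>
  This is the additivity \<open>x = (x - u) + u\<close> of the means of independent summands; it needs supports
  in the half-line because \<^const>\<open>ennreal\<close> sends negative numbers to zero.
\<close>

lemma first_moment_fconv:
  assumes [measurable]: "f \<in> borel_measurable borel" "g \<in> borel_measurable borel"
    and neg: "\<And>x. x < 0 \<Longrightarrow> f x = 0" "\<And>x. x < 0 \<Longrightarrow> g x = 0"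
  shows "(\<integral>\<^sup>+x. ennreal x * fconv f g x \<partial>lborel)
    = (\<integral>\<^sup>+x. ennreal x * f x \<partial>lborel) * (\<integral>\<^sup>+x. g x \<partial>lborel)
      + (\<integral>\<^sup>+x. f x \<partial>lborel) * (\<integral>\<^sup>+x. ennreal x * g x \<partial>lborel)"
proof -
  have "ennreal x * fconv f g x
      = fconv (\<lambda>u. ennreal u * f u) g x + fconv f (\<lambda>u. ennreal u * g u) x" for x
  proof -
    have "ennreal x * (f (x - u) * g u)
        = (ennreal (x - u) * f (x - u)) * g u + f (x - u) * (ennreal u * g u)" for u
    proof (cases "0 \<le> u \<and> u \<le> x")
      case True
      then have "ennreal x = ennreal (x - u) + ennreal u" by (simp flip: ennreal_plus)
      then show ?thesis by (simp add: algebra_simps)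
    next
      case False
      then show ?thesis using neg(1)[of "x - u"] neg(2)[of u] by (cases "u < 0") auto
    qed
    then show ?thesis
      by (simp add: fconv_def nn_integral_add flip: nn_integral_cmult)
  qed
  then show ?thesis by (simp add: nn_integral_add nn_integral_fconv)
qed

lemma first_moment_conv_pow:
  assumes [measurable]: "f \<in> borel_measurable borel"
    and neg: "\<And>x. x < 0 \<Longrightarrow> f x = 0"
    and mass: "(\<integral>\<^sup>+x. f x \<partial>lborel) = 1"
  shows "(\<integral>\<^sup>+x. ennreal x * conv_pow f n x \<partial>lborel)
    = of_nat (Suc n) * (\<integral>\<^sup>+x. ennreal x * f x \<partial>lborel)"
proof (induction n)
  case (Suc n)
  have "(\<integral>\<^sup>+x. conv_pow f n x \<partial>lborel) = 1" by (simp add: nn_integral_conv_pow mass)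
  then show ?case
    using Suc by (simp add: first_moment_fconv neg conv_pow_eq_0_neg mass algebra_simps)
qed simp

text \<open>Markov's inequality for the law with density \<open>conv_pow f n\<close>.\<close>

lemma conv_pow_tail_le:
  fixes \<mu> :: real
  assumes [measurable]: "f \<in> borel_measurable borel"
    and neg: "\<And>x. x < 0 \<Longrightarrow> f x = 0"
    and mass: "(\<integral>\<^sup>+x. f x \<partial>lborel) = 1"
    and mean: "(\<integral>\<^sup>+x. ennreal x * f x \<partial>lborel) = ennreal \<mu>" "0 \<le> \<mu>"
    and y: "0 < y"
  shows "(\<integral>\<^sup>+x. conv_pow f n x * indicator {y..} x \<partial>lborel) \<le> ennreal (real (Suc n) * \<mu> / y)"
proof -
  have "(\<integral>\<^sup>+x. conv_pow f n x * indicator {y..} x \<partial>lborel)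
      \<le> (\<integral>\<^sup>+x. ennreal (1/y) * (ennreal x * conv_pow f n x) \<partial>lborel)"
  proof (intro nn_integral_mono)
    fix x
    show "conv_pow f n x * indicator {y..} x \<le> ennreal (1/y) * (ennreal x * conv_pow f n x)"
    proof (cases "y \<le> x")
      case True
      then have "1 \<le> ennreal (1/y) * ennreal x"
        using y by (subst ennreal_mult[symmetric]) (auto simp: field_simps)
      then have "1 * conv_pow f n x \<le> (ennreal (1/y) * ennreal x) * conv_pow f n x"
        by (intro mult_right_mono) auto
      then show ?thesis using True by (simp add: mult.assoc)
    qed simp
  qed
  also have "\<dots> = ennreal (1/y) * (of_nat (Suc n) * ennreal \<mu>)"
    using first_moment_conv_pow[OF assms(1) neg mass] by (simp add: nn_integral_cmult mean)
  also have "\<dots> = ennreal (1 / y * (real (Suc n) * \<mu>))"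
    using y mean(2)
    by (subst ennreal_mult, simp, simp, subst ennreal_mult)
      (auto simp: ennreal_of_nat_eq_real_of_nat)
  also have "\<dots> = ennreal (real (Suc n) * \<mu> / y)" by simp
  finally show ?thesis .
qed

lemma conv_pow_head_ge:
  fixes \<mu> :: real
  assumes [measurable]: "f \<in> borel_measurable borel"
    and neg: "\<And>x. x < 0 \<Longrightarrow> f x = 0"
    and mass: "(\<integral>\<^sup>+x. f x \<partial>lborel) = 1"
    and mean: "(\<integral>\<^sup>+x. ennreal x * f x \<partial>lborel) = ennreal \<mu>" "0 \<le> \<mu>"
    and y: "0 < y"
  shows "ennreal (1 - real (Suc n) * \<mu> / y) \<le> (\<integral>\<^sup>+x. conv_pow f n x * indicator {..<y} x \<partial>lborel)"
proof -
  have "1 = (\<integral>\<^sup>+x. conv_pow f n x \<partial>lborel)" by (simp add: nn_integral_conv_pow mass)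
  also have "\<dots> = (\<integral>\<^sup>+x. conv_pow f n x * indicator {..<y} x + conv_pow f n x * indicator {y..} x \<partial>lborel)"
    by (intro nn_integral_cong) (auto simp: indicator_def)
  also have "\<dots> = (\<integral>\<^sup>+x. conv_pow f n x * indicator {..<y} x \<partial>lborel)
      + (\<integral>\<^sup>+x. conv_pow f n x * indicator {y..} x \<partial>lborel)"
    by (intro nn_integral_add) auto
  also have "\<dots> \<le> (\<integral>\<^sup>+x. conv_pow f n x * indicator {..<y} x \<partial>lborel) + ennreal (real (Suc n) * \<mu> / y)"
    by (intro add_left_mono conv_pow_tail_le assms)
  finally have "ennreal 1 - ennreal (real (Suc n) * \<mu> / y) \<le> (\<integral>\<^sup>+x. conv_pow f n x * indicator {..<y} x \<partial>lborel)"
    by (simp add: ennreal_minus_le_iff ennreal_1 add.commute)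
  then show ?thesis using y mean(2)
    by (subst (asm) ennreal_minus) (auto simp del: of_nat_Suc)
qed

lemma of_nat_mult_ennreal: "of_nat k * ennreal a = ennreal (real k * a)"
  by (simp add: ennreal_of_nat_eq_real_of_nat ennreal_mult')

text \<open>
  The density of an integrated tail is of this kind. Monotonicity is what turns the principle of
  one big jump, usually a statement about distribution functions, into a local one: moving the big
  jump by an amount \<open>u\<close> changes the density in a known direction.
\<close>

locale decreasing_density =
  fixes f :: "real \<Rightarrow> real" and \<mu> :: real
  assumes f_measurable [measurable]: "f \<in> borel_measurable borel"
    and f_nonneg: "0 \<le> f x"
    and f_neg: "x < 0 \<Longrightarrow> f x = 0"
    and f_decreasing: "0 \<le> x \<Longrightarrow> x \<le> y \<Longrightarrow> f y \<le> f x"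
    and f_mass: "(\<integral>\<^sup>+x. ennreal (f x) \<partial>lborel) = 1"
    and f_mean: "(\<integral>\<^sup>+x. ennreal x * ennreal (f x) \<partial>lborel) = ennreal \<mu>"
    and \<mu>_nonneg: "0 \<le> \<mu>"
begin

abbreviation f_pow :: "nat \<Rightarrow> real \<Rightarrow> ennreal" where
  "f_pow \<equiv> conv_pow (\<lambda>x. ennreal (f x))"

definition small :: "real \<Rightarrow> real \<Rightarrow> ennreal" where
  "small c x = (if x < c then ennreal (f x) else 0)"

definition big :: "real \<Rightarrow> real \<Rightarrow> ennreal" where
  "big c x = (if c \<le> x then ennreal (f x) else 0)"

lemma small_measurable [measurable]: "small c \<in> borel_measurable borel"
  unfolding small_def[abs_def] by measurable

lemma big_measurable [measurable]: "big c \<in> borel_measurable borel"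
  unfolding big_def[abs_def] by measurable

lemma f_eq_small_plus_big: "(\<lambda>x. ennreal (f x)) = (\<lambda>x. small c x + big c x)"
  by (auto simp: small_def big_def)

lemma small_le: "small c x \<le> ennreal (f x)" and big_le: "big c x \<le> ennreal (f x)"
  by (auto simp: small_def big_def)

lemma small_pow_le: "conv_pow (small c) n x \<le> f_pow n x"
  by (induction n arbitrary: x) (auto intro!: fconv_mono small_le)

lemma f_le: "f x \<le> f 0"
  by (cases "x < 0") (use f_neg f_nonneg f_decreasing in auto)

lemma f_pow_neg: "x < 0 \<Longrightarrow> f_pow n x = 0"
  by (rule conv_pow_eq_0_neg) (auto simp: f_neg)

lemma f_pow_mass: "(\<integral>\<^sup>+x. f_pow n x \<partial>lborel) = 1"
  by (simp add: nn_integral_conv_pow f_mass)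

lemma f_pow_le: "f_pow n x \<le> ennreal (f 0)"
proof (cases n)
  case (Suc m)
  have "f_pow n x \<le> (\<integral>\<^sup>+u. ennreal (f 0) * f_pow m u \<partial>lborel)"
    unfolding Suc conv_pow.simps fconv_def
    by (intro nn_integral_mono mult_right_mono ennreal_leI f_le) auto
  then show ?thesis by (simp add: nn_integral_cmult f_pow_mass)
qed (auto intro: ennreal_leI f_le)

lemma fconv_f_split:
  assumes [measurable]: "g \<in> borel_measurable borel"
  shows "fconv (\<lambda>x. ennreal (f x)) g x = fconv (small c) g x + fconv (big c) g x"
  by (subst f_eq_small_plus_big[of c]) (simp add: fconv_add_left)

text \<open>
  The sum of \<open>n + 2\<close> variables contains exactly one big one in \<open>n + 2\<close> mutually exclusive ways.
  The induction conditions on whether the newly added variable is the big one.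
\<close>

lemma f_pow_ge_one_big:
  "of_nat (n + 2) * fconv (big c) (conv_pow (small c) n) x \<le> f_pow (Suc n) x"
proof (induction n arbitrary: x)
  case 0
  have "f_pow (Suc 0) x
      = fconv (small c) (\<lambda>x. ennreal (f x)) x + fconv (big c) (\<lambda>x. ennreal (f x)) x"
    by (simp add: fconv_f_split[of _ _ c])
  also have "\<dots> \<ge> fconv (small c) (big c) x + fconv (big c) (small c) x"
    by (intro add_mono fconv_mono small_le big_le) auto
  finally show ?case
    by (simp add: fconv_commute[of "small c" "big c"] mult_2)
next
  case (Suc n)
  have "of_nat (Suc n + 2) * fconv (big c) (conv_pow (small c) (Suc n)) x
      = fconv (small c) (\<lambda>x. of_nat (n + 2) * fconv (big c) (conv_pow (small c) n) x) x
        + fconv (big c) (conv_pow (small c) (Suc n)) x"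
    by (subst fconv_cmult_right)
       (auto simp: fconv_left_commute[of "big c" "small c"] algebra_simps)
  also have "\<dots> \<le> fconv (small c) (f_pow (Suc n)) x + fconv (big c) (f_pow (Suc n)) x"
    by (intro add_mono fconv_mono Suc.IH small_pow_le) auto
  also have "\<dots> = f_pow (Suc (Suc n)) x"
    by (subst fconv_f_split[of _ _ c, symmetric]) auto
  finally show ?case .
qed

text \<open>
  Either all variables are small, or at least one of \<open>n + 2\<close> is big and the others are arbitrary;
  the factor \<open>n + 2\<close> is the union bound.
\<close>

lemma f_pow_le_one_big:
  "f_pow (Suc n) x \<le> conv_pow (small c) (Suc n) x + of_nat (n + 2) * fconv (big c) (f_pow n) x"
proof (induction n arbitrary: x)
  case 0
  have "f_pow (Suc 0) x
      = fconv (small c) (\<lambda>x. small c x + big c x) x + fconv (big c) (\<lambda>x. ennreal (f x)) x"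
    by (simp add: fconv_f_split[of _ _ c] flip: f_eq_small_plus_big)
  also have "\<dots> = fconv (small c) (small c) x + fconv (big c) (small c) x
      + fconv (big c) (\<lambda>x. ennreal (f x)) x"
    by (simp add: fconv_add_right fconv_commute[of "small c" "big c"])
  also have "\<dots> \<le> fconv (small c) (small c) x + fconv (big c) (\<lambda>x. ennreal (f x)) x
      + fconv (big c) (\<lambda>x. ennreal (f x)) x"
    by (intro add_mono fconv_mono small_le) auto
  finally show ?case by (simp add: mult_2 add.assoc)
next
  case (Suc n)
  have "fconv (small c) (f_pow (Suc n)) x
      \<le> fconv (small c) (\<lambda>x. conv_pow (small c) (Suc n) x
            + of_nat (n + 2) * fconv (big c) (f_pow n) x) x"
    by (intro fconv_mono Suc.IH) auto
  also have "\<dots> = conv_pow (small c) (Suc (Suc n)) x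
      + of_nat (n + 2) * fconv (big c) (fconv (small c) (f_pow n)) x"
    by (simp add: fconv_add_right fconv_cmult_right fconv_left_commute[of "small c" "big c"]
        del: of_nat_add)
  also have "\<dots> \<le> conv_pow (small c) (Suc (Suc n)) x
      + of_nat (n + 2) * fconv (big c) (f_pow (Suc n)) x"
    by (intro add_left_mono mult_left_mono fconv_mono) (auto intro!: fconv_mono small_le)
  finally have "fconv (small c) (f_pow (Suc n)) x + fconv (big c) (f_pow (Suc n)) x
      \<le> conv_pow (small c) (Suc (Suc n)) x
        + of_nat (n + 2) * fconv (big c) (f_pow (Suc n)) x + fconv (big c) (f_pow (Suc n)) x"
    by (rule add_right_mono)
  moreover have "f_pow (Suc (Suc n)) x
      = fconv (small c) (f_pow (Suc n)) x + fconv (big c) (f_pow (Suc n)) x"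
    by (subst fconv_f_split[of _ _ c, symmetric]) auto
  ultimately show ?case by (simp add: algebra_simps)
qed

text \<open>
  A sum of nonnegative variables that stays below \<open>c\<close> has no big summand.
\<close>

lemma small_pow_eq: "u < c \<Longrightarrow> conv_pow (small c) n u = f_pow n u"
proof (induction n arbitrary: u)
  case (Suc n)
  have "small c (u - v) * conv_pow (small c) n v = ennreal (f (u - v)) * f_pow n v" for v
  proof -
    consider "v < 0" | "u < v" | "0 \<le> v" "v \<le> u" by linarith
    then show ?thesis
    proof cases
      case 1
      then show ?thesis using f_pow_neg[OF 1, of n] small_pow_le[of c n v] by simp
    next
      case 2
      then show ?thesis by (simp add: small_def f_neg)
    next
      case 3
      then have "small c (u - v) = ennreal (f (u - v))" "conv_pow (small c) n v = f_pow n v"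
        using Suc.IH[of v] Suc.prems by (simp_all add: small_def[of c "u - v"])
      then show ?thesis by simp
    qed
  qed
  then show ?case by (simp add: fconv_def)
qed (simp add: small_def)

text \<open>
  One variable makes the big jump, of size at least \<open>x / 2\<close>, while the other \<open>n\<close> sum to less than
  \<open>x / 2\<close>. By monotonicity the big jump contributes at least \<open>f x\<close>, and Markov's inequality bounds
  the probability that the others are too large.
\<close>

lemma f_pow_lower:
  assumes x: "0 < x"
  shows "ennreal (real (n + 1) * f x * (1 - 2 * real n * \<mu> / x)) \<le> f_pow n x"
proof (cases n)
  case (Suc m)
  have "ennreal (f x) * ennreal (1 - real (Suc m) * \<mu> / (x/2))
      \<le> ennreal (f x) * (\<integral>\<^sup>+u. f_pow m u * indicator {..<x/2} u \<partial>lborel)"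
    by (intro mult_left_mono conv_pow_head_ge) (use x f_neg f_mass f_mean \<mu>_nonneg in auto)
  also have "\<dots> = (\<integral>\<^sup>+u. ennreal (f x) * (f_pow m u * indicator {..<x/2} u) \<partial>lborel)"
    by (simp add: nn_integral_cmult)
  also have "\<dots> \<le> fconv (big (x/2)) (conv_pow (small (x/2)) m) x"
    unfolding fconv_def
  proof (rule nn_integral_mono)
    fix u
    consider "u < 0" | "0 \<le> u" "u < x/2" | "x/2 \<le> u" by linarith
    then show "ennreal (f x) * (f_pow m u * indicator {..<x/2} u)
        \<le> big (x/2) (x - u) * conv_pow (small (x/2)) m u"
    proof cases
      case 2
      then have "ennreal (f x) \<le> big (x/2) (x - u)"
        using f_decreasing[of "x - u" x] x by (auto simp: big_def intro: ennreal_leI)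
      with 2 show ?thesis by (auto simp: small_pow_eq intro!: mult_right_mono)
    qed (auto simp: f_pow_neg)
  qed
  finally have "of_nat (m + 2) * (ennreal (f x) * ennreal (1 - real (Suc m) * \<mu> / (x/2)))
      \<le> of_nat (m + 2) * fconv (big (x/2)) (conv_pow (small (x/2)) m) x"
    by (intro mult_left_mono) auto
  also have "\<dots> \<le> f_pow n x" unfolding Suc by (rule f_pow_ge_one_big)
  also have "of_nat (m + 2) * (ennreal (f x) * ennreal (1 - real (Suc m) * \<mu> / (x/2)))
      = ennreal (real (n + 1) * f x * (1 - 2 * real n * \<mu> / x))"
    unfolding of_nat_mult_ennreal ennreal_mult'[OF f_nonneg, symmetric] Suc
    by (simp add: algebra_simps)
  finally show ?thesis .
qed auto

text \<open>
  If the variables other than the big one sum to less than \<open>d\<close>, the big one contributes at most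
  \<open>f (x - d)\<close>; otherwise it still contributes at most \<open>f c\<close>, and Markov's inequality pays for the
  exception.
\<close>

lemma f_pow_upper:
  assumes "0 < d" "d \<le> x" "0 \<le> c"
  shows "f_pow n x \<le> conv_pow (small c) n x
    + ennreal (real (n + 1) * f (x - d) + real (n + 1) * (real n * f c * \<mu> / d))"
proof (cases n)
  case 0
  have "ennreal (f x) \<le> small c x + ennreal (f (x - d))"
    using f_decreasing[of "x - d" x] assms by (auto simp: small_def intro: ennreal_leI)
  then show ?thesis by (simp add: 0)
next
  case (Suc m)
  have "fconv (big c) (f_pow m) x
      \<le> (\<integral>\<^sup>+u. ennreal (f (x - d)) * f_pow m u + ennreal (f c) * (f_pow m u * indicator {d..} u) \<partial>lborel)"
    unfolding fconv_def
  proof (rule nn_integral_mono)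
    fix u
    consider "u < 0" | "0 \<le> u" "u < d" | "d \<le> u" by linarith
    then show "big c (x - u) * f_pow m u
        \<le> ennreal (f (x - d)) * f_pow m u + ennreal (f c) * (f_pow m u * indicator {d..} u)"
    proof cases
      case 1 then show ?thesis by (simp add: f_pow_neg)
    next
      case 2
      then have "big c (x - u) \<le> ennreal (f (x - d))"
        using assms f_decreasing[of "x - d" "x - u"] by (auto simp: big_def intro: ennreal_leI)
      then show ?thesis using 2 by (auto intro!: mult_right_mono)
    next
      case 3
      have "big c (x - u) \<le> ennreal (f c)"
        using assms f_decreasing[of c "x - u"] by (auto simp: big_def intro: ennreal_leI)
      then have "big c (x - u) * f_pow m u \<le> ennreal (f c) * (f_pow m u * indicator {d..} u)"
        using 3 by (auto intro!: mult_right_mono)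
      then show ?thesis by (rule order.trans) simp
    qed
  qed
  also have "\<dots> = ennreal (f (x - d))
      + ennreal (f c) * (\<integral>\<^sup>+u. f_pow m u * indicator {d..} u \<partial>lborel)"
    by (simp add: nn_integral_add nn_integral_cmult f_pow_mass)
  also have "\<dots> \<le> ennreal (f (x - d)) + ennreal (f c) * ennreal (real (Suc m) * \<mu> / d)"
    by (intro add_left_mono mult_left_mono conv_pow_tail_le)
       (use assms f_neg f_mass f_mean \<mu>_nonneg in auto)
  finally have "of_nat (m + 2) * fconv (big c) (f_pow m) x
      \<le> of_nat (m + 2) * (ennreal (f (x - d)) + ennreal (f c) * ennreal (real (Suc m) * \<mu> / d))"
    by (intro mult_left_mono) auto
  also have "\<dots> = ennreal (real (n + 1) * f (x - d) + real (n + 1) * (real n * f c * \<mu> / d))"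
  proof -
    have "0 \<le> f c * (real (Suc m) * \<mu> / d)" using assms f_nonneg \<mu>_nonneg by simp
    then have "ennreal (f (x - d)) + ennreal (f c) * ennreal (real (Suc m) * \<mu> / d)
        = ennreal (f (x - d) + f c * (real (Suc m) * \<mu> / d))"
      using f_nonneg by (simp only: ennreal_mult'[symmetric] ennreal_plus)
    moreover have "real (m + 2) * (f (x - d) + f c * (real (Suc m) * \<mu> / d))
        = real (n + 1) * f (x - d) + real (n + 1) * (real n * f c * \<mu> / d)"
      unfolding Suc distrib_left by (simp add: mult_ac)
    ultimately show ?thesis by (simp only: of_nat_mult_ennreal)
  qed
  finally have "conv_pow (small c) (Suc m) x + of_nat (m + 2) * fconv (big c) (f_pow m) x
      \<le> conv_pow (small c) n x
        + ennreal (real (n + 1) * f (x - d) + real (n + 1) * (real n * f c * \<mu> / d))"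
    unfolding Suc by (rule add_left_mono)
  with f_pow_le_one_big[of m x c] show ?thesis unfolding Suc by (rule order.trans)
qed

text \<open>
  Chernoff's bound for densities: after tilting by \<open>exp (s * u)\<close> one factor is bounded pointwise
  and the remaining ones by their mass \<open>\<theta>\<close>.
\<close>

lemma small_pow_le_exp:
  assumes "0 \<le> s" "0 \<le> \<theta>"
    and \<theta>: "(\<integral>\<^sup>+u. ennreal (exp (s * u)) * small c u \<partial>lborel) \<le> ennreal \<theta>"
  shows "conv_pow (small c) n x \<le> ennreal (f 0 * exp (s * c) * \<theta> ^ n * exp (- s * x))"
proof (induction n arbitrary: x)
  case 0
  show ?case
  proof (cases "x < c")
    case True
    have "f x * 1 \<le> f 0 * exp (s * c - s * x)"
      using True assms by (intro mult_mono f_le) (auto simp: mult_left_mono f_nonneg)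
    then show ?thesis using True by (auto simp: small_def exp_diff exp_minus field_simps intro!: ennreal_leI)
  qed (simp add: small_def f_nonneg)
next
  case (Suc n)
  have "conv_pow (small c) (Suc n) x
      \<le> (\<integral>\<^sup>+u. small c (x - u) * ennreal (f 0 * exp (s * c) * \<theta> ^ n * exp (- s * u)) \<partial>lborel)"
    unfolding conv_pow.simps fconv_def by (intro nn_integral_mono mult_left_mono Suc) auto
  also have "\<dots> = (\<integral>\<^sup>+u. small c u * ennreal (f 0 * exp (s * c) * \<theta> ^ n * exp (- s * (x - u))) \<partial>lborel)"
    by (subst nn_integral_reflect[where x = x]) auto
  also have "\<dots> = (\<integral>\<^sup>+u. ennreal (f 0 * exp (s * c) * \<theta> ^ n * exp (- s * x)) *
      (ennreal (exp (s * u)) * small c u) \<partial>lborel)"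
  proof (intro nn_integral_cong)
    fix u
    have "f 0 * exp (s * c) * \<theta> ^ n * exp (- s * (x - u))
      = f 0 * exp (s * c) * \<theta> ^ n * exp (- s * x) * exp (s * u)"
      by (simp add: algebra_simps flip: exp_add)
    then have "ennreal (f 0 * exp (s * c) * \<theta> ^ n * exp (- s * (x - u)))
      = ennreal (f 0 * exp (s * c) * \<theta> ^ n * exp (- s * x)) * ennreal (exp (s * u))"
      by (simp only: ennreal_mult''[OF exp_ge_zero])
    then show "small c u * ennreal (f 0 * exp (s * c) * \<theta> ^ n * exp (- s * (x - u)))
      = ennreal (f 0 * exp (s * c) * \<theta> ^ n * exp (- s * x)) * (ennreal (exp (s * u)) * small c u)"
      by (simp only: mult_ac)
  qed
  also have "\<dots> \<le> ennreal (f 0 * exp (s * c) * \<theta> ^ n * exp (- s * x)) * ennreal \<theta>"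
    by (subst nn_integral_cmult) (auto intro!: mult_left_mono \<theta>)
  also have "\<dots> = ennreal (f 0 * exp (s * c) * \<theta> ^ Suc n * exp (- s * x))"
    by (subst ennreal_mult''[OF \<open>0 \<le> \<theta>\<close>, symmetric]) (simp only: power_Suc mult_ac)
  finally show ?case .
qed

text \<open>
  The renewal density is bounded. Let \<open>G\<close> be the tail of \<open>f\<close> and \<open>S\<^sub>n\<close> the partial sums. The
  probabilities of the disjoint events \<open>S\<^sub>n \<le> x < S\<^sub>n\<^sub>+\<^sub>1\<close> sum to at most one, which says that the
  convolution of \<open>G\<close> with the renewal measure is at most one; the hypothesis trades \<open>G\<close> for \<open>f\<close>
  at the price of a constant.
\<close>

lemma sum_f_pow_le:
  assumes "0 \<le> C"
    and tail: "\<And>v. 0 \<le> v \<Longrightarrow> ennreal (f v) \<le> ennreal C * (\<integral>\<^sup>+u. ennreal (f u) * indicator {v<..} u \<partial>lborel)"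
  shows "(\<Sum>n<N. f_pow n x) \<le> ennreal (f 0 + C)"
proof -
  let ?f = "\<lambda>x. ennreal (f x)"
  define H :: "real \<Rightarrow> ennreal" where "H = indicator {0..}"
  define G where "G v = (if 0 \<le> v then (\<integral>\<^sup>+u. ?f u * indicator {v<..} u \<partial>lborel) else 0)" for v
  have [measurable]: "H \<in> borel_measurable borel" by (simp add: H_def)
  have [measurable]: "G \<in> borel_measurable borel"
    unfolding G_def[abs_def] greaterThan_def by measurable
  have H_split: "H = (\<lambda>v. G v + fconv H ?f v)"
  proof
    fix v
    show "H v = G v + fconv H ?f v"
    proof (cases "0 \<le> v")
      case True
      have "1 = (\<integral>\<^sup>+u. ?f u * indicator {v<..} u + H (v - u) * ?f u \<partial>lborel)"
        unfolding f_mass[symmetric] by (intro nn_integral_cong) (auto simp: H_def indicator_def)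
      also have "\<dots> = G v + fconv H ?f v"
        using True by (subst nn_integral_add) (auto simp: G_def fconv_def)
      finally show ?thesis using True by (simp add: H_def)
    next
      case False
      then show ?thesis by (auto simp: G_def H_def f_neg fconv_eq_0_neg)
    qed
  qed
  have step: "fconv H (f_pow n) x = fconv G (f_pow n) x + fconv H (f_pow (Suc n)) x" for n x
    by (subst H_split) (simp add: fconv_add_left fconv_assoc)
  \<comment> \<open>The probabilities of \<open>S\<^sub>n \<le> x < S\<^sub>n\<^sub>+\<^sub>1\<close> telescope.\<close>
  have "(\<Sum>n<m. fconv G (f_pow n) x) + fconv H (f_pow m) x = fconv H ?f x" for m
  proof (induction m)
    case (Suc m)
    then show ?case using step[of m x] by (simp add: add.assoc)
  qed simp
  moreover have "fconv H ?f x \<le> 1"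
  proof -
    have "fconv H ?f x \<le> (\<integral>\<^sup>+u. 1 * ?f u \<partial>lborel)"
      unfolding fconv_def by (intro nn_integral_mono mult_right_mono) (auto simp: H_def indicator_def)
    then show ?thesis by (simp add: f_mass)
  qed
  ultimately have G: "(\<Sum>n<m. fconv G (f_pow n) x) \<le> 1" for m
    by (metis add_increasing2 order.trans zero_le order_refl le_iff_add)
  have fG: "f_pow (Suc n) x \<le> ennreal C * fconv G (f_pow n) x" for n
  proof -
    have "?f v \<le> ennreal C * G v" for v
      using tail[of v] by (auto simp: G_def f_neg)
    then have "f_pow (Suc n) x \<le> fconv (\<lambda>v. ennreal C * G v) (f_pow n) x"
      unfolding conv_pow.simps by (intro fconv_mono) auto
    also have "\<dots> = ennreal C * fconv G (f_pow n) x"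
      by (simp add: fconv_def mult.assoc nn_integral_cmult)
    finally show ?thesis .
  qed
  have "(\<Sum>n<N. f_pow n x) \<le> (\<Sum>n<Suc N. f_pow n x)" by simp
  also have "\<dots> = f_pow 0 x + (\<Sum>n<N. f_pow (Suc n) x)" by (rule sum.lessThan_Suc_shift)
  also have "\<dots> \<le> ennreal (f 0) + (\<Sum>n<N. ennreal C * fconv G (f_pow n) x)"
    by (intro add_mono f_pow_le sum_mono fG)
  also have "\<dots> \<le> ennreal (f 0) + ennreal C * 1"
    unfolding sum_distrib_left[symmetric] by (intro add_left_mono mult_left_mono G) auto
  also have "\<dots> = ennreal (f 0 + C)" using assms f_nonneg by simp
  finally show ?thesis .
qed

end

section \<open>Regularly varying tails\<close>

text \<open>
  A function that does not decrease under doubling is controlled by its values on one dyadic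
  interval; this replaces uniform convergence theorems for regularly varying functions.
\<close>

lemma doubling_lower_bound:
  fixes g :: "real \<Rightarrow> real"
  assumes "0 < X" and double: "\<And>x. X \<le> x \<Longrightarrow> g x \<le> g (2 * x)"
    and start: "\<And>x. X \<le> x \<Longrightarrow> x \<le> 2 * X \<Longrightarrow> c \<le> g x" and "X \<le> y"
  shows "c \<le> g y"
proof -
  have bound: "X \<le> y \<Longrightarrow> y \<le> 2 ^ n * (2 * X) \<Longrightarrow> c \<le> g y" for n y
  proof (induction n arbitrary: y)
    case (Suc n)
    show ?case
    proof (cases "y \<le> 2 * X")
      case False
      then have "c \<le> g (y / 2)" using Suc by (intro Suc.IH) auto
      also have "\<dots> \<le> g y" using double[of "y / 2"] False by simp
      finally show ?thesis .
    qed (use Suc start in auto)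
  qed (use start in auto)
  obtain n :: nat where "y / (2 * X) < 2 ^ n"
    using real_arch_pow[of 2 "y / (2 * X)"] by auto
  then have "y \<le> 2 ^ n * (2 * X)" using \<open>0 < X\<close> by (simp add: field_simps)
  then show ?thesis using \<open>X \<le> y\<close> by (rule bound[rotated])
qed

locale regularly_varying_tail =
  fixes T :: "real \<Rightarrow> real" and \<alpha> :: real
  assumes T_decreasing: "0 \<le> x \<Longrightarrow> x \<le> y \<Longrightarrow> T y \<le> T x"
    and T_nonneg: "0 \<le> T x"
    and T_ratio: "0 < a \<Longrightarrow> ((\<lambda>x. T (a * x) / T x) \<longlongrightarrow> a powr (- \<alpha>)) at_top"
begin

text \<open>
  If \<open>T\<close> vanished, it would vanish from there on by monotonicity, and with division by zero giving
  zero the ratio at \<open>a = 1\<close> would tend to \<open>0\<close> instead of \<open>1\<close>.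
\<close>

lemma T_pos:
  assumes "0 \<le> x"
  shows "0 < T x"
proof (rule ccontr)
  assume "\<not> 0 < T x"
  then have zero: "T y = 0" if "x \<le> y" for y
    using T_decreasing[OF assms that] T_nonneg[of x] T_nonneg[of y] by simp
  have "((\<lambda>x. T (1 * x) / T x) \<longlongrightarrow> 0) at_top"
    by (rule tendsto_eventually) (auto intro: eventually_at_top_linorderI[of x] simp: zero)
  then have "1 powr (- \<alpha>) = (0::real)"
    using T_ratio[of 1] by (intro tendsto_unique[OF _ T_ratio]) auto
  then show False by simp
qed

lemma doubling_eventually_ge:
  assumes "p < 2 powr (- \<alpha>)"
  obtains X where "1 \<le> X" "\<And>x. X \<le> x \<Longrightarrow> p * T x \<le> T (2 * x)"
proof -
  have "\<forall>\<^sub>F x in at_top. p < T (2 * x) / T x \<and> 1 \<le> x"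
    using order_tendstoD(1)[OF T_ratio[of 2] assms] eventually_ge_at_top[of 1]
    by (auto simp: eventually_conj_iff)
  then obtain X where X: "\<And>x. X \<le> x \<Longrightarrow> p < T (2 * x) / T x \<and> 1 \<le> x"
    by (auto simp: eventually_at_top_linorder)
  show thesis
  proof (rule that[of X])
    show "p * T x \<le> T (2 * x)" if "X \<le> x" for x
      using X[OF that] T_pos[of x] by (simp add: pos_less_divide_eq)
  qed (use X in auto)
qed

lemma doubling_eventually_le:
  assumes "2 powr (- \<alpha>) < p"
  obtains X where "1 \<le> X" "\<And>x. X \<le> x \<Longrightarrow> T (2 * x) \<le> p * T x"
proof -
  have "\<forall>\<^sub>F x in at_top. T (2 * x) / T x < p \<and> 1 \<le> x"
    using order_tendstoD(2)[OF T_ratio[of 2] assms] eventually_ge_at_top[of 1]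
    by (auto simp: eventually_conj_iff)
  then obtain X where X: "\<And>x. X \<le> x \<Longrightarrow> T (2 * x) / T x < p \<and> 1 \<le> x"
    by (auto simp: eventually_at_top_linorder)
  show thesis
  proof (rule that[of X])
    show "T (2 * x) \<le> p * T x" if "X \<le> x" for x
      using X[OF that] T_pos[of x] by (simp add: pos_divide_less_eq)
  qed (use X in auto)
qed

text \<open>
  With the intermediate exponent \<open>q = \<alpha> + \<delta> / 2\<close> the function \<open>T y * y powr q\<close> eventually does not
  decrease under doubling, hence is bounded below by a constant \<open>c > 0\<close>; the other half of \<open>\<delta>\<close>
  absorbs \<open>c\<close>.
\<close>

lemma T_eventually_ge_powr:
  assumes "0 < \<delta>" "0 < \<alpha>"
  shows "\<forall>\<^sub>F x in at_top. x powr (- \<alpha> - \<delta>) \<le> T x"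
proof -
  define q where "q = \<alpha> + \<delta> / 2"
  have "2 powr (-q) < 2 powr (- \<alpha>)" using assms by (simp add: q_def)
  then obtain X where X: "1 \<le> X" "\<And>x. X \<le> x \<Longrightarrow> 2 powr (-q) * T x \<le> T (2 * x)"
    using doubling_eventually_ge by blast
  define c where "c = T (2 * X) * X powr q"
  have c: "0 < c" using X(1) T_pos[of "2 * X"] by (simp add: c_def)
  have g: "c \<le> T y * y powr q" if "X \<le> y" for y
  proof (rule doubling_lower_bound[where X = X and g = "\<lambda>y. T y * y powr q"])
    fix x assume x: "X \<le> x"
    have "T x * x powr q = (2 powr (-q) * T x) * (2 * x) powr q"
      using x X(1) by (simp add: powr_mult powr_minus)
    also have "\<dots> \<le> T (2 * x) * (2 * x) powr q"
      by (intro mult_right_mono X(2) x) auto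
    finally show "T x * x powr q \<le> T (2 * x) * (2 * x) powr q" .
  next
    fix x assume "X \<le> x" "x \<le> 2 * X"
    then show "c \<le> T x * x powr q"
      unfolding c_def using X(1) assms T_decreasing[of x "2 * X"] T_nonneg
      by (intro mult_mono powr_mono2) (auto simp: q_def)
  qed (use X that in auto)
  have "\<forall>\<^sub>F x in at_top. (1 / c) powr (2 / \<delta>) \<le> x \<and> X \<le> x"
    using eventually_ge_at_top by (auto simp: eventually_conj_iff)
  then show ?thesis
  proof eventually_elim
    case (elim x)
    then have x: "X \<le> x" "0 < x" using X(1) by auto
    have "1 / c = ((1 / c) powr (2 / \<delta>)) powr (\<delta> / 2)"
      using c assms by (simp add: powr_powr)
    also have "\<dots> \<le> x powr (\<delta> / 2)" using elim assms by (intro powr_mono2) auto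
    finally have "1 \<le> c * x powr (\<delta> / 2)" using c by (simp add: field_simps)
    then have "x powr (- \<alpha> - \<delta>) * 1 \<le> x powr (- \<alpha> - \<delta>) * (c * x powr (\<delta> / 2))"
      by (intro mult_left_mono) auto
    also have "\<dots> = c * x powr (- q)"
      by (simp add: q_def mult.left_commute algebra_simps flip: powr_add)
    also have "\<dots> \<le> (T x * x powr q) * x powr (- q)"
      by (intro mult_right_mono g x) auto
    also have "\<dots> = T x" using x by (simp add: mult.assoc flip: powr_add)
    finally show ?case by simp
  qed
qed

lemma T_le_powr:
  assumes "0 < \<delta>" "\<delta> < \<alpha>"
  obtains C where "0 < C" "\<And>x. 1 \<le> x \<Longrightarrow> T x \<le> C * x powr (- \<alpha> + \<delta>)"
proof -
  define q where "q = \<alpha> - \<delta>"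
  have "2 powr (- \<alpha>) < 2 powr (-q)" using assms by (simp add: q_def)
  then obtain X where X: "1 \<le> X" "\<And>x. X \<le> x \<Longrightarrow> T (2 * x) \<le> 2 powr (-q) * T x"
    using doubling_eventually_le by blast
  define C where "C = T 0 * (2 * X) powr q"
  have small: "T x * x powr q \<le> C" if "0 \<le> x" "x \<le> 2 * X" for x
    unfolding C_def using that assms T_decreasing[of 0 x] T_nonneg
    by (intro mult_mono powr_mono2) (auto simp: q_def)
  have large: "- C \<le> - (T y * y powr q)" if "X \<le> y" for y
  proof (rule doubling_lower_bound[where X = X and g = "\<lambda>y. - (T y * y powr q)"])
    fix x assume x: "X \<le> x"
    have "T (2 * x) * (2 * x) powr q \<le> (2 powr (-q) * T x) * (2 * x) powr q"
      by (intro mult_right_mono X(2) x) auto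
    also have "\<dots> = T x * x powr q" using x X(1) by (simp add: powr_mult powr_minus)
    finally show "- (T x * x powr q) \<le> - (T (2 * x) * (2 * x) powr q)" by simp
  qed (use X that small in auto)
  show thesis
  proof (rule that[of C])
    fix x :: real assume x: "1 \<le> x"
    have "T x * x powr q \<le> C" using small[of x] large[of x] x by (cases "x \<le> X") auto
    then have "(T x * x powr q) * x powr (-q) \<le> C * x powr (-q)" by (intro mult_right_mono) auto
    then show "T x \<le> C * x powr (- \<alpha> + \<delta>)"
      using x by (simp add: mult.assoc q_def flip: powr_add)
  qed (use X T_pos[of 0] in \<open>simp add: C_def\<close>)
qed

text \<open>
  Far out, \<open>v + 1 \<le> 2 * v\<close> and doubling costs a bounded factor; on the remaining compact interval
  positivity and monotonicity suffice.
\<close>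

lemma T_le_shift:
  obtains C where "0 < C" "\<And>v. 0 \<le> v \<Longrightarrow> T v \<le> C * T (v + 1)"
proof -
  obtain X where X: "1 \<le> X" "\<And>x. X \<le> x \<Longrightarrow> (2 powr (-\<alpha>) / 2) * T x \<le> T (2 * x)"
    using doubling_eventually_ge[of "2 powr (-\<alpha>) / 2"] by auto
  define C where "C = 2 * 2 powr \<alpha> + T 0 / T (X + 1)"
  have *: "0 \<le> T 0 / T (X + 1)" using T_nonneg by simp
  show thesis
  proof (rule that[of C])
    show "0 < C" unfolding C_def by (intro add_pos_nonneg *) auto
    fix v :: real assume v: "0 \<le> v"
    show "T v \<le> C * T (v + 1)"
    proof (cases "X \<le> v")
      case True
      have "T v = 2 * 2 powr \<alpha> * ((2 powr (-\<alpha>) / 2) * T v)" by (simp add: powr_minus)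
      also have "\<dots> \<le> 2 * 2 powr \<alpha> * T (v + 1)"
        using X(2)[OF True] T_decreasing[of "v + 1" "2 * v"] X(1) True by (intro mult_left_mono) auto
      also have "\<dots> \<le> C * T (v + 1)"
        using * T_nonneg by (intro mult_right_mono) (auto simp: C_def)
      finally show ?thesis .
    next
      case False
      have "T v \<le> T 0" using v T_decreasing[of 0 v] by simp
      also have "\<dots> = T 0 / T (X + 1) * T (X + 1)" using T_pos[of "X + 1"] X(1) by simp
      also have "\<dots> \<le> C * T (v + 1)"
        using False v X(1) T_nonneg * by (intro mult_mono T_decreasing) (auto simp: C_def)
      finally show ?thesis .
    qed
  qed
qed

end

section \<open>Compound geometric densities\<close>

text \<open>
  The Cauchy product of \<open>\<Sum>(n + 1) z\<^sup>n\<close> and \<open>\<Sum>z\<^sup>n\<close> gives the coefficients \<open>(n + 1) (n + 2) / 2\<close>.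
\<close>

lemma sums_geometric_second_moment:
  fixes z :: real
  assumes "0 \<le> z" "z < 1"
  shows "(\<lambda>n. real (Suc n) * real n * z ^ n) sums (2 * z / (1 - z) ^ 3)"
proof -
  let ?a = "\<lambda>n. real (Suc n) * z ^ n"
  have a: "?a sums (1 / (1 - z)\<^sup>2)" using geometric_deriv_sums[of z] assms by simp
  have b: "(\<lambda>n. z ^ n) sums (1 / (1 - z))" using assms geometric_sums[of z] by simp
  have "(\<lambda>k. \<Sum>i\<le>k. ?a i * z ^ (k - i)) sums ((\<Sum>k. ?a k) * (\<Sum>k. z ^ k))"
    using assms sums_summable[OF a] sums_summable[OF b]
    by (intro Cauchy_product_sums) (auto simp: abs_mult)
  moreover have "(\<Sum>i\<le>k. ?a i * z ^ (k - i)) = real (Suc k) * real (k + 2) / 2 * z ^ k" for k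
  proof -
    have "(\<Sum>i\<le>k. ?a i * z ^ (k - i)) = (\<Sum>i\<le>k. real (Suc i)) * z ^ k"
      unfolding sum_distrib_right by (intro sum.cong) (auto simp flip: power_add mult.assoc)
    also have "(\<Sum>i\<le>k. real (Suc i)) = real (Suc k) * real (k + 2) / 2"
      by (induction k) (auto simp: field_simps)
    finally show ?thesis .
  qed
  moreover have "(\<Sum>k. ?a k) * (\<Sum>k. z ^ k) = 1 / (1 - z) ^ 3"
    unfolding sums_unique[OF a, symmetric] sums_unique[OF b, symmetric]
    by (simp add: power2_eq_square power3_eq_cube)
  ultimately have c: "(\<lambda>k. real (Suc k) * real (k + 2) / 2 * z ^ k) sums (1 / (1 - z) ^ 3)"
    by (simp only:)
  have s: "(\<lambda>k. 2 * (real (Suc k) * real (k + 2) / 2 * z ^ k) - 2 * ?a k) sums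
      (2 * (1 / (1 - z) ^ 3) - 2 * (1 / (1 - z)\<^sup>2))"
    by (intro sums_diff sums_mult a c)
  have limit: "2 * (1 / (1 - z) ^ 3) - 2 * (1 / (1 - z)\<^sup>2) = 2 * z / (1 - z) ^ 3"
  proof -
    define y where "y = 1 - z"
    have "y \<noteq> 0" "z = 1 - y" using assms by (auto simp: y_def)
    then show ?thesis by (simp add: divide_simps power2_eq_square power3_eq_cube)
  qed
  have terms: "(\<lambda>k. 2 * (real (Suc k) * real (k + 2) / 2 * z ^ k) - 2 * ?a k)
      = (\<lambda>k. real (Suc k) * real k * z ^ k)"
    by (rule ext) (simp add: field_simps)
  show ?thesis using s unfolding limit terms .
qed

context decreasing_density
begin

text \<open>
  A geometric number, with success probability \<open>1 - \<rho>\<close>, of independent variables with density \<open>f\<close> has an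
  atom \<open>1 - \<rho>\<close> at zero and this density on the positive half-line. The index of summation is one less
  than the number of variables, in accordance with \<^const>\<open>conv_pow\<close>.
\<close>

definition geom_density :: "real \<Rightarrow> real \<Rightarrow> ennreal" where
  "geom_density \<rho> x = (\<Sum>n. ennreal ((1 - \<rho>) * \<rho> ^ Suc n) * f_pow n x)"

definition w :: "real \<Rightarrow> real \<Rightarrow> real" where "w \<rho> x = enn2real (geom_density \<rho> x)"

lemma geom_density_measurable [measurable]: "geom_density \<rho> \<in> borel_measurable borel"
  unfolding geom_density_def[abs_def] by measurable

lemma w_measurable [measurable]: "w \<rho> \<in> borel_measurable borel"
  unfolding w_def[abs_def] by measurable

lemma geom_weights_sums:
  fixes \<rho> :: real
  assumes "0 < \<rho>" "\<rho> < 1"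
  shows "(\<lambda>n. (1 - \<rho>) * \<rho> ^ Suc n) sums \<rho>"
    and "(\<lambda>n. (1 - \<rho>) * \<rho> ^ Suc n * real (n + 1)) sums (\<rho> / (1 - \<rho>))"
    and "(\<lambda>n. (1 - \<rho>) * \<rho> ^ Suc n * (real (n + 1) * real n)) sums (2 * \<rho>\<^sup>2 / (1 - \<rho>)\<^sup>2)"
proof -
  show "(\<lambda>n. (1 - \<rho>) * \<rho> ^ Suc n) sums \<rho>"
    using sums_mult[OF geometric_sums[of \<rho>], of "(1 - \<rho>) * \<rho>"] assms by (simp add: mult_ac)
  show "(\<lambda>n. (1 - \<rho>) * \<rho> ^ Suc n * real (n + 1)) sums (\<rho> / (1 - \<rho>))"
    using sums_mult[OF geometric_deriv_sums[of \<rho>], of "(1 - \<rho>) * \<rho>"] assms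
    by (simp add: mult_ac power2_eq_square)
  show "(\<lambda>n. (1 - \<rho>) * \<rho> ^ Suc n * (real (n + 1) * real n)) sums (2 * \<rho>\<^sup>2 / (1 - \<rho>)\<^sup>2)"
  proof -
    have "(\<lambda>n. (1 - \<rho>) * \<rho> * (real (Suc n) * real n * \<rho> ^ n)) sums ((1 - \<rho>) * \<rho> * (2 * \<rho> / (1 - \<rho>) ^ 3))"
      using assms by (intro sums_mult sums_geometric_second_moment) auto
    moreover have "(1 - \<rho>) * \<rho> * (2 * \<rho> / (1 - \<rho>) ^ 3) = 2 * \<rho>\<^sup>2 / (1 - \<rho>)\<^sup>2"
    proof -
      define y where "y = 1 - \<rho>"
      have "y \<noteq> 0" using assms by (auto simp: y_def)
      then have "y * \<rho> * (2 * \<rho> / y ^ 3) = 2 * \<rho>\<^sup>2 / y\<^sup>2"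
        by (simp add: power2_eq_square power3_eq_cube)
      then show ?thesis by (simp only: y_def)
    qed
    moreover have "(\<lambda>n. (1 - \<rho>) * \<rho> * (real (Suc n) * real n * \<rho> ^ n))
        = (\<lambda>n. (1 - \<rho>) * \<rho> ^ Suc n * (real (n + 1) * real n))"
      by (simp add: fun_eq_iff)
    ultimately show ?thesis by (simp only:)
  qed
qed

lemma suminf_ennreal_sums:
  assumes "a sums s" "\<And>n. 0 \<le> a n"
  shows "(\<Sum>n. ennreal (a n)) = ennreal s"
  unfolding sums_unique[OF assms(1)]
  by (rule suminf_ennreal2[OF assms(2) sums_summable[OF assms(1)]])

lemma suminf_weights:
  assumes "0 < \<rho>" "\<rho> < 1"
  shows "(\<Sum>n. ennreal ((1 - \<rho>) * \<rho> ^ Suc n)) = ennreal \<rho>"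
    and "(\<Sum>n. ennreal ((1 - \<rho>) * \<rho> ^ Suc n * real (n + 1))) = ennreal (\<rho> / (1 - \<rho>))"
    and "(\<Sum>n. ennreal ((1 - \<rho>) * \<rho> ^ Suc n * (real (n + 1) * real n)))
      = ennreal (2 * \<rho>\<^sup>2 / (1 - \<rho>)\<^sup>2)"
proof -
  have *: "0 \<le> (1 - \<rho>) * \<rho> ^ Suc n" for n using assms by simp
  show "(\<Sum>n. ennreal ((1 - \<rho>) * \<rho> ^ Suc n)) = ennreal \<rho>"
    by (rule suminf_ennreal_sums[OF geom_weights_sums(1)[OF assms] *])
  show "(\<Sum>n. ennreal ((1 - \<rho>) * \<rho> ^ Suc n * real (n + 1))) = ennreal (\<rho> / (1 - \<rho>))"
    by (rule suminf_ennreal_sums[OF geom_weights_sums(2)[OF assms]], rule mult_nonneg_nonneg[OF *]) simp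
  show "(\<Sum>n. ennreal ((1 - \<rho>) * \<rho> ^ Suc n * (real (n + 1) * real n)))
      = ennreal (2 * \<rho>\<^sup>2 / (1 - \<rho>)\<^sup>2)"
    by (rule suminf_ennreal_sums[OF geom_weights_sums(3)[OF assms]], rule mult_nonneg_nonneg[OF *]) simp
qed

lemma geom_density_le:
  assumes "0 < \<rho>" "\<rho> < 1"
  shows "geom_density \<rho> x \<le> ennreal (\<rho> * f 0)"
proof -
  have "geom_density \<rho> x \<le> (\<Sum>n. ennreal ((1 - \<rho>) * \<rho> ^ Suc n) * ennreal (f 0))"
    unfolding geom_density_def by (intro suminf_le mult_left_mono f_pow_le) auto
  then have "geom_density \<rho> x \<le> ennreal \<rho> * ennreal (f 0)"
    unfolding ennreal_suminf_multc suminf_weights[OF assms] .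
  then show ?thesis using assms f_nonneg by (simp add: ennreal_mult)
qed

lemma ennreal_w:
  assumes "0 < \<rho>" "\<rho> < 1"
  shows "ennreal (w \<rho> x) = geom_density \<rho> x"
  unfolding w_def using geom_density_le[OF assms, of x]
  by (intro ennreal_enn2real) (auto simp: less_top intro: le_less_trans)

lemma w_nonneg: "0 \<le> w \<rho> x" by (simp add: w_def)

lemma w_le:
  assumes "0 < \<rho>" "\<rho> < 1"
  shows "w \<rho> x \<le> \<rho> * f 0"
  using geom_density_le[OF assms, of x] assms f_nonneg[of 0]
  by (simp flip: ennreal_w[OF assms])

lemma w_neg: "x < 0 \<Longrightarrow> w \<rho> x = 0"
  by (simp add: w_def geom_density_def f_pow_neg)

lemma nn_integral_w:
  assumes "0 < \<rho>" "\<rho> < 1"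
  shows "(\<integral>\<^sup>+x. ennreal (w \<rho> x) \<partial>lborel) = ennreal \<rho>"
proof -
  have "(\<integral>\<^sup>+x. geom_density \<rho> x \<partial>lborel) = (\<Sum>n. ennreal ((1 - \<rho>) * \<rho> ^ Suc n))"
    unfolding geom_density_def
    by (subst nn_integral_suminf) (auto simp: nn_integral_cmult f_pow_mass)
  also have "\<dots> = ennreal \<rho>" by (rule suminf_weights[OF assms])
  finally show ?thesis by (simp add: ennreal_w assms)
qed

lemma first_moment_w:
  assumes "0 < \<rho>" "\<rho> < 1"
  shows "(\<integral>\<^sup>+x. ennreal x * ennreal (w \<rho> x) \<partial>lborel) = ennreal (\<rho> / (1 - \<rho>) * \<mu>)"
proof -
  have "(\<integral>\<^sup>+x. ennreal x * geom_density \<rho> x \<partial>lborel)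
      = (\<integral>\<^sup>+x. (\<Sum>n. ennreal ((1 - \<rho>) * \<rho> ^ Suc n) * (ennreal x * f_pow n x)) \<partial>lborel)"
    unfolding geom_density_def by (simp add: mult.left_commute flip: ennreal_suminf_cmult)
  also have "\<dots> = (\<Sum>n. ennreal ((1 - \<rho>) * \<rho> ^ Suc n) * (of_nat (Suc n) * ennreal \<mu>))"
    by (subst nn_integral_suminf)
       (auto simp: nn_integral_cmult first_moment_conv_pow f_neg f_mass f_mean simp del: of_nat_Suc)
  also have "\<dots> = (\<Sum>n. ennreal ((1 - \<rho>) * \<rho> ^ Suc n * real (n + 1)) * ennreal \<mu>)"
    using assms by (simp add: ennreal_of_nat_eq_real_of_nat ennreal_mult'' mult.assoc del: of_nat_Suc power_Suc)
  also have "\<dots> = ennreal (\<rho> / (1 - \<rho>)) * ennreal \<mu>"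
    unfolding ennreal_suminf_multc suminf_weights[OF assms] ..
  also have "\<dots> = ennreal (\<rho> / (1 - \<rho>) * \<mu>)" by (rule ennreal_mult''[OF \<mu>_nonneg, symmetric])
  finally show ?thesis by (simp only: ennreal_w[OF assms])
qed

text \<open>
  Split off the first summand of the geometric sum.
\<close>

lemma w_renewal:
  assumes "0 < \<rho>" "\<rho> < 1"
  shows "ennreal (w \<rho> x) = ennreal (\<rho> * (1 - \<rho>) * f x)
    + ennreal \<rho> * (\<integral>\<^sup>+u. ennreal (f (x - u)) * ennreal (w \<rho> u) \<partial>lborel)"
proof -
  let ?a = "\<lambda>n. ennreal ((1 - \<rho>) * \<rho> ^ Suc n)"
  have "ennreal \<rho> * (\<integral>\<^sup>+u. ennreal (f (x - u)) * geom_density \<rho> u \<partial>lborel)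
      = ennreal \<rho> * (\<integral>\<^sup>+u. (\<Sum>n. ennreal (f (x - u)) * (?a n * f_pow n u)) \<partial>lborel)"
    unfolding geom_density_def by (simp del: power_Suc)
  also have "\<dots> = (\<Sum>n. ennreal \<rho> * (\<integral>\<^sup>+u. ennreal (f (x - u)) * (?a n * f_pow n u) \<partial>lborel))"
    by (subst nn_integral_suminf) (auto simp del: power_Suc)
  also have "\<dots> = (\<Sum>n. ?a (Suc n) * f_pow (Suc n) x)"
  proof (intro suminf_cong)
    fix n
    have "?a (Suc n) = ennreal \<rho> * ?a n"
      using assms by (subst ennreal_mult[symmetric]) (auto simp: mult_ac)
    then show "ennreal \<rho> * (\<integral>\<^sup>+u. ennreal (f (x - u)) * (?a n * f_pow n u) \<partial>lborel)
        = ?a (Suc n) * f_pow (Suc n) x"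
      by (simp add: fconv_def mult.left_commute[of _ "?a n"] nn_integral_cmult mult.assoc del: power_Suc)
  qed
  finally have tail: "ennreal \<rho> * (\<integral>\<^sup>+u. ennreal (f (x - u)) * geom_density \<rho> u \<partial>lborel)
      = (\<Sum>n. ?a (Suc n) * f_pow (Suc n) x)" .
  have "geom_density \<rho> x = (\<Sum>n. ?a (Suc n) * f_pow (Suc n) x) + ?a 0 * f_pow 0 x"
    unfolding geom_density_def
    using suminf_offset[of "\<lambda>n. ?a n * f_pow n x" 1] by (simp add: add.commute)
  then show ?thesis
    unfolding ennreal_w[OF assms] tail using assms f_nonneg[of x]
    by (simp add: mult_ac add.commute flip: ennreal_mult)
qed

text \<open>
  Sum the bound of one big jump over the geometric number of summands: its mean gives the main term
  and its second factorial moment the error.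
\<close>

lemma w_lower:
  assumes \<rho>: "0 < \<rho>" "\<rho> < 1" and x: "0 < x"
  shows "f x * (\<rho> / (1 - \<rho>) - 2 * \<mu> / x * (2 * \<rho>\<^sup>2 / (1 - \<rho>)\<^sup>2)) \<le> w \<rho> x"
proof -
  let ?a = "\<lambda>n. (1 - \<rho>) * \<rho> ^ Suc n"
  have lower_sums: "(\<lambda>n. f x * (?a n * real (n + 1) - 2 * \<mu> / x * (?a n * (real (n + 1) * real n)))) sums
      (f x * (\<rho> / (1 - \<rho>) - 2 * \<mu> / x * (2 * \<rho>\<^sup>2 / (1 - \<rho>)\<^sup>2)))"
    by (intro sums_mult sums_diff geom_weights_sums \<rho>)
  have terms_le: "f x * (?a n * real (n + 1) - 2 * \<mu> / x * (?a n * (real (n + 1) * real n)))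
      \<le> ?a n * enn2real (f_pow n x)" for n
  proof -
    have "f_pow n x \<noteq> \<infinity>" using f_pow_le[of n x] by (auto simp: top_unique)
    then have "ennreal (real (n + 1) * f x * (1 - 2 * real n * \<mu> / x)) \<le> ennreal (enn2real (f_pow n x))"
      using f_pow_lower[OF x, of n] by (simp add: less_top)
    then have "real (n + 1) * f x * (1 - 2 * real n * \<mu> / x) \<le> enn2real (f_pow n x)"
      by (subst (asm) ennreal_le_iff) auto
    then have "?a n * (real (n + 1) * f x * (1 - 2 * real n * \<mu> / x)) \<le> ?a n * enn2real (f_pow n x)"
      using \<rho> by (intro mult_left_mono) auto
    moreover have "f x * (A * c - 2 * \<mu> / x * (A * (c * d))) = A * (c * f x * (1 - 2 * d * \<mu> / x))"
      for A c d by (simp add: algebra_simps)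
    ultimately show ?thesis by (simp only:)
  qed
  have "(\<lambda>n. ?a n * enn2real (f_pow n x)) sums w \<rho> x"
  proof -
    have eq: "(\<Sum>n. ennreal (?a n * enn2real (f_pow n x))) = ennreal (w \<rho> x)"
    proof -
      have "ennreal (enn2real (f_pow n x)) = f_pow n x" for n
        using f_pow_le[of n x] by (intro ennreal_enn2real) (auto simp: less_top intro: le_less_trans)
      then show ?thesis
        unfolding ennreal_w[OF \<rho>] geom_density_def using \<rho> by (simp add: ennreal_mult)
    qed
    have nonneg: "0 \<le> ?a n * enn2real (f_pow n x)" for n using \<rho> by simp
    have "summable (\<lambda>n. ?a n * enn2real (f_pow n x))"
      by (rule summable_suminf_not_top[OF nonneg]) (simp add: eq del: power_Suc)
    then show ?thesis
      using suminf_ennreal2[OF nonneg] eq nonneg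
      by (auto simp: sums_iff w_nonneg suminf_nonneg)
  qed
  then show ?thesis by (rule sums_le[OF terms_le lower_sums])
qed

end

section \<open>Uniform asymptotics of compound geometric densities\<close>

text \<open>
  A second-order Taylor bound that asks for a moment of order \<open>1 + \<gamma>\<close> only: \<open>f\<close> has no second
  moment when \<open>\<alpha> < 3\<close>.
\<close>

lemma exp_le_1_plus_powr:
  fixes t :: real
  assumes "0 \<le> t" "0 < \<gamma>" "\<gamma> \<le> 1"
  shows "exp t \<le> 1 + t + t powr (1 + \<gamma>) * exp t"
proof (cases "t \<le> 1")
  case True
  have *: "exp t - 1 \<le> t * exp t"
    using exp_ge_add_one_self[of "-t"] by (simp add: exp_minus field_simps)
  have "t * (exp t - 1) \<le> t * (t * exp t)" by (intro mult_left_mono * assms)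
  moreover have "t ^ 2 \<le> t powr (1 + \<gamma>)"
  proof (cases "t = 0")
    case False
    then have "t powr 2 \<le> t powr (1 + \<gamma>)" using assms True by (intro powr_mono') auto
    then show ?thesis using False assms by (simp add: powr_realpow[of t 2, simplified])
  qed auto
  then have "t * (t * exp t) \<le> t powr (1 + \<gamma>) * exp t"
    unfolding mult.assoc[symmetric] power2_eq_square by (intro mult_right_mono) auto
  ultimately show ?thesis using * by (simp only: right_diff_distrib)
next
  case False
  then have "1 * exp t \<le> t powr (1 + \<gamma>) * exp t"
    using assms by (intro mult_right_mono ge_one_powr_ge_zero) auto
  then show ?thesis using assms by linarith
qed

context decreasing_density
begin

text \<open>
  The terms of the geometric sum without a big jump are treated in two ways. If there are fewer than
  \<open>m\<close> summands, a pointwise bound \<open>K\<close> is assumed and used. Otherwise the geometric weight is at most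
  \<open>(1 - \<rho>) * exp (- (1 - \<rho>) * m)\<close>, and the convolution powers are summed without weights by the
  boundedness of the renewal density. This keeps the factor \<open>1 - \<rho>\<close>, which bounding every
  convolution power separately would lose.
\<close>

lemma w_upper:
  assumes \<rho>: "0 < \<rho>" "\<rho> < 1" and d: "0 < d" "d \<le> x" and c: "0 \<le> c" and "0 \<le> K" "0 \<le> C"
    and tail: "\<And>v. 0 \<le> v \<Longrightarrow> ennreal (f v) \<le> ennreal C * (\<integral>\<^sup>+u. ennreal (f u) * indicator {v<..} u \<partial>lborel)"
    and few: "\<And>n. real n < m \<Longrightarrow> conv_pow (small c) n x \<le> ennreal K"
  shows "w \<rho> x \<le> \<rho> / (1 - \<rho>) * f (x - d) + 2 * \<rho>\<^sup>2 / (1 - \<rho>)\<^sup>2 * (f c * \<mu> / d)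
    + K + (1 - \<rho>) * exp (- (1 - \<rho>) * m) * (f 0 + C)"
proof -
  let ?a = "\<lambda>n. (1 - \<rho>) * \<rho> ^ Suc n"
  let ?E = "(1 - \<rho>) * exp (- (1 - \<rho>) * m)"
  have a: "0 \<le> ?a n" for n using \<rho> by simp
  have E: "0 \<le> ?E" using \<rho> by simp
  have fc: "0 \<le> f c * \<mu> / d" using d f_nonneg \<mu>_nonneg by simp
  have small_part: "ennreal (?a n) * conv_pow (small c) n x
      \<le> ennreal (?a n) * ennreal K + ennreal ?E * f_pow n x" for n
  proof (cases "real n < m")
    case True
    then have "ennreal (?a n) * conv_pow (small c) n x \<le> ennreal (?a n) * ennreal K"
      by (intro mult_left_mono few) auto
    then show ?thesis by (rule order.trans) simp
  next
    case False
    have "\<rho> ^ Suc n \<le> \<rho> ^ n" using \<rho> by (intro power_decreasing) auto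
    also have "\<dots> \<le> exp (- (1 - \<rho>)) ^ n"
      using \<rho> exp_ge_add_one_self[of "- (1 - \<rho>)"] by (intro power_mono) auto
    also have "\<dots> = exp (- (1 - \<rho>) * real n)" by (simp add: mult.commute flip: exp_of_nat_mult)
    also have "\<dots> \<le> exp (- (1 - \<rho>) * m)" using False \<rho> by (simp add: mult_left_mono)
    finally have "\<rho> ^ Suc n \<le> exp (- (1 - \<rho>) * m)" .
    then have "?a n \<le> ?E" by (rule mult_left_mono) (use \<rho> in simp)
    then have "ennreal (?a n) * conv_pow (small c) n x \<le> ennreal ?E * f_pow n x"
      by (intro mult_mono[OF ennreal_leI small_pow_le]) auto
    then show ?thesis by (rule order.trans) simp
  qed
  have "ennreal (?a n) * f_pow n x
      \<le> ennreal (?a n) * ennreal K + ennreal ?E * f_pow n x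
        + (ennreal (?a n * real (n + 1)) * ennreal (f (x - d))
          + ennreal (?a n * (real (n + 1) * real n)) * ennreal (f c * \<mu> / d))" for n
  proof -
    have "ennreal (?a n) * f_pow n x \<le> ennreal (?a n) * (conv_pow (small c) n x
        + ennreal (real (n + 1) * f (x - d) + real (n + 1) * (real n * f c * \<mu> / d)))"
      by (intro mult_left_mono f_pow_upper d c) auto
    also have "\<dots> = ennreal (?a n) * conv_pow (small c) n x
        + ennreal (?a n * (real (n + 1) * f (x - d) + real (n + 1) * (real n * f c * \<mu> / d)))"
      by (simp only: distrib_left[of "ennreal (?a n)"] ennreal_mult'[OF a])
    also have "ennreal (?a n * (real (n + 1) * f (x - d) + real (n + 1) * (real n * f c * \<mu> / d)))
        = ennreal (?a n * real (n + 1)) * ennreal (f (x - d))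
        + ennreal (?a n * (real (n + 1) * real n)) * ennreal (f c * \<mu> / d)"
    proof -
      have "?a n * (real (n + 1) * f (x - d) + real (n + 1) * (real n * f c * \<mu> / d))
          = (?a n * real (n + 1)) * f (x - d) + (?a n * (real (n + 1) * real n)) * (f c * \<mu> / d)"
        by (simp only: distrib_left mult.assoc times_divide_eq_right)
      moreover have "0 \<le> ?a n * real (n + 1)" "0 \<le> ?a n * (real (n + 1) * real n)"
        by (rule mult_nonneg_nonneg[OF a]; simp)+
      ultimately show ?thesis
        using f_nonneg[of "x - d"] fc by (simp only: ennreal_plus mult_nonneg_nonneg ennreal_mult)
    qed
    finally show ?thesis by (rule order.trans) (intro add_right_mono small_part)
  qed
  then have "ennreal (w \<rho> x) \<le> (\<Sum>n. ennreal (?a n) * ennreal K + ennreal ?E * f_pow n x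
        + (ennreal (?a n * real (n + 1)) * ennreal (f (x - d))
          + ennreal (?a n * (real (n + 1) * real n)) * ennreal (f c * \<mu> / d)))"
    unfolding ennreal_w[OF \<rho>] geom_density_def by (intro suminf_le) auto
  also have "\<dots> = ((\<Sum>n. ennreal (?a n)) * ennreal K + ennreal ?E * (\<Sum>n. f_pow n x))
        + ((\<Sum>n. ennreal (?a n * real (n + 1))) * ennreal (f (x - d))
          + (\<Sum>n. ennreal (?a n * (real (n + 1) * real n))) * ennreal (f c * \<mu> / d))"
    by (simp only: suminf_add[symmetric, OF summableI summableI] ennreal_suminf_multc ennreal_suminf_cmult)
  also have "\<dots> \<le> (ennreal \<rho> * ennreal K + ennreal ?E * ennreal (f 0 + C))
        + (ennreal (\<rho> / (1 - \<rho>)) * ennreal (f (x - d))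
          + ennreal (2 * \<rho>\<^sup>2 / (1 - \<rho>)\<^sup>2) * ennreal (f c * \<mu> / d))"
    unfolding suminf_weights[OF \<rho>]
    by (intro add_mono mult_left_mono suminf_le_const[OF summableI] sum_f_pow_le tail order_refl) (use assms in auto)
  also have "\<dots> = ennreal (\<rho> * K + ?E * (f 0 + C) + (\<rho> / (1 - \<rho>) * f (x - d)
          + 2 * \<rho>\<^sup>2 / (1 - \<rho>)\<^sup>2 * (f c * \<mu> / d)))"
  proof -
    have nonneg: "0 \<le> \<rho>" "0 \<le> \<rho> / (1 - \<rho>)" "0 \<le> 2 * \<rho>\<^sup>2 / (1 - \<rho>)\<^sup>2" "0 \<le> f 0 + C"
      using \<rho> \<open>0 \<le> C\<close> f_nonneg[of 0] by auto
    show ?thesis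
      by (simp only: nonneg E fc \<open>0 \<le> K\<close> f_nonneg ennreal_plus ennreal_mult mult_nonneg_nonneg
          add_nonneg_nonneg)
  qed
  finally have "w \<rho> x \<le> \<rho> * K + ?E * (f 0 + C) + (\<rho> / (1 - \<rho>) * f (x - d)
          + 2 * \<rho>\<^sup>2 / (1 - \<rho>)\<^sup>2 * (f c * \<mu> / d))"
  proof (subst (asm) ennreal_le_iff)
    have "0 \<le> \<rho>" "0 \<le> \<rho> / (1 - \<rho>)" "0 \<le> 2 * \<rho>\<^sup>2 / (1 - \<rho>)\<^sup>2" "0 \<le> f 0 + C"
      using \<rho> \<open>0 \<le> C\<close> f_nonneg[of 0] by auto
    then show "0 \<le> \<rho> * K + ?E * (f 0 + C) + (\<rho> / (1 - \<rho>) * f (x - d)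
          + 2 * \<rho>\<^sup>2 / (1 - \<rho>)\<^sup>2 * (f c * \<mu> / d))"
      by (intro add_nonneg_nonneg mult_nonneg_nonneg[OF _ fc] mult_nonneg_nonneg[OF E]
          mult_nonneg_nonneg[OF _ f_nonneg] mult_nonneg_nonneg[OF _ \<open>0 \<le> K\<close>] f_nonneg \<open>0 \<le> C\<close>)
  qed
  moreover have "\<rho> * K \<le> K" using \<rho> \<open>0 \<le> K\<close> by (simp add: mult_left_le_one_le)
  ultimately show ?thesis by linarith
qed

lemma exponential_moment_small:
  assumes \<gamma>: "0 < \<gamma>" "\<gamma> \<le> 1" and s: "0 \<le> s" and "0 \<le> m"
    and m: "(\<integral>\<^sup>+u. ennreal (u powr (1 + \<gamma>)) * ennreal (f u) \<partial>lborel) \<le> ennreal m"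
  shows "(\<integral>\<^sup>+u. ennreal (exp (s * u)) * small c u \<partial>lborel)
    \<le> ennreal (1 + s * \<mu> + s powr (1 + \<gamma>) * exp (s * c) * m)"
proof -
  let ?q = "s powr (1 + \<gamma>) * exp (s * c)"
  have "(\<integral>\<^sup>+u. ennreal (exp (s * u)) * small c u \<partial>lborel)
    \<le> (\<integral>\<^sup>+u. (ennreal (f u) + ennreal s * (ennreal u * ennreal (f u)))
        + ennreal ?q * (ennreal (u powr (1 + \<gamma>)) * ennreal (f u)) \<partial>lborel)"
  proof (rule nn_integral_mono)
    fix u
    show "ennreal (exp (s * u)) * small c u
      \<le> (ennreal (f u) + ennreal s * (ennreal u * ennreal (f u)))
        + ennreal ?q * (ennreal (u powr (1 + \<gamma>)) * ennreal (f u))"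
    proof (cases "0 \<le> u \<and> u < c")
      case True
      have "exp (s * u) \<le> 1 + s * u + (s * u) powr (1 + \<gamma>) * exp (s * u)"
        using True s \<gamma> by (intro exp_le_1_plus_powr) auto
      also have "(s * u) powr (1 + \<gamma>) * exp (s * u) \<le> (s * u) powr (1 + \<gamma>) * exp (s * c)"
        using True s by (intro mult_left_mono) (auto intro: mult_left_mono)
      also have "\<dots> = ?q * u powr (1 + \<gamma>)" using True s by (simp add: powr_mult)
      finally have "exp (s * u) * f u \<le> (1 + s * u + ?q * u powr (1 + \<gamma>)) * f u"
        by (intro mult_right_mono f_nonneg) simp
      then have "ennreal (exp (s * u) * f u)
          \<le> ennreal ((f u + s * (u * f u)) + ?q * (u powr (1 + \<gamma>) * f u))"
        by (intro ennreal_leI) (simp add: algebra_simps)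
      also have "\<dots> = (ennreal (f u) + ennreal s * (ennreal u * ennreal (f u)))
        + ennreal ?q * (ennreal (u powr (1 + \<gamma>)) * ennreal (f u))"
        using True s f_nonneg[of u] by (simp add: ennreal_mult)
      finally show ?thesis using True f_nonneg[of u] by (simp add: small_def ennreal_mult)
    qed (auto simp: small_def f_neg)
  qed
  also have "\<dots> = (1 + ennreal s * ennreal \<mu>)
      + ennreal ?q * (\<integral>\<^sup>+u. ennreal (u powr (1 + \<gamma>)) * ennreal (f u) \<partial>lborel)"
    by (simp add: nn_integral_add nn_integral_cmult f_mass f_mean)
  also have "\<dots> \<le> (1 + ennreal s * ennreal \<mu>) + ennreal ?q * ennreal m"
    by (intro add_left_mono mult_left_mono m) auto
  also have "\<dots> = ennreal (1 + s * \<mu> + ?q * m)"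
    using s \<mu>_nonneg \<open>0 \<le> m\<close> by (simp add: ennreal_mult)
  finally show ?thesis .
qed

text \<open>
  Fewer than \<open>(1 - 2 * \<epsilon>) * x / \<mu>\<close> summands have a mean well below \<open>x\<close>, so that reaching \<open>x\<close>
  without a big jump is a large deviation: the tilted mass is at most \<open>1 + s * \<mu> * (1 + \<epsilon>)\<close>, and
  \<open>(1 + \<epsilon>) * (1 - 2 * \<epsilon>) \<le> 1 - \<epsilon>\<close>.
\<close>

lemma small_pow_le_few:
  assumes \<gamma>: "0 < \<gamma>" "\<gamma> \<le> 1" and s: "0 \<le> s" and "0 \<le> m"
    and m: "(\<integral>\<^sup>+u. ennreal (u powr (1 + \<gamma>)) * ennreal (f u) \<partial>lborel) \<le> ennreal m"
    and tilt: "s powr \<gamma> * exp (s * c) * m \<le> \<epsilon> * \<mu>"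
    and \<epsilon>: "0 < \<epsilon>" "\<epsilon> < 1 / 2" and "0 < \<mu>" "0 \<le> x" and n: "real n < (1 - 2 * \<epsilon>) * x / \<mu>"
  shows "conv_pow (small c) n x \<le> ennreal (f 0 * exp (s * c) * exp (- s * \<epsilon> * x))"
proof -
  define \<theta> where "\<theta> = 1 + s * \<mu> * (1 + \<epsilon>)"
  have \<theta>: "0 \<le> \<theta>" using s \<epsilon> \<open>0 < \<mu>\<close> by (simp add: \<theta>_def)
  have "1 + s * \<mu> + s powr (1 + \<gamma>) * exp (s * c) * m = 1 + s * \<mu> + s * (s powr \<gamma> * exp (s * c) * m)"
    by (simp only: powr_mult_base[OF s, symmetric] mult.assoc)
  also have "\<dots> \<le> 1 + s * \<mu> + s * (\<epsilon> * \<mu>)" by (intro add_left_mono mult_left_mono tilt s)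
  also have "\<dots> = \<theta>" by (simp add: \<theta>_def algebra_simps)
  finally have "(\<integral>\<^sup>+u. ennreal (exp (s * u)) * small c u \<partial>lborel) \<le> ennreal \<theta>"
    using exponential_moment_small[OF \<gamma> s \<open>0 \<le> m\<close> m] by (meson ennreal_leI order.trans)
  then have "conv_pow (small c) n x \<le> ennreal (f 0 * exp (s * c) * \<theta> ^ n * exp (- s * x))"
    by (intro small_pow_le_exp s \<theta>)
  also have "\<dots> \<le> ennreal (f 0 * exp (s * c) * exp (- s * \<epsilon> * x))"
  proof (rule ennreal_leI)
    have "\<theta> ^ n \<le> exp (s * \<mu> * (1 + \<epsilon>)) ^ n"
      using exp_ge_add_one_self[of "s * \<mu> * (1 + \<epsilon>)"] \<theta> by (intro power_mono) (auto simp: \<theta>_def)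
    also have "\<dots> = exp (s * ((1 + \<epsilon>) * (real n * \<mu>)))"
      by (simp add: mult_ac flip: exp_of_nat_mult)
    also have "\<dots> \<le> exp (s * ((1 - \<epsilon>) * x))"
    proof -
      have "(1 + \<epsilon>) * (real n * \<mu>) \<le> (1 + \<epsilon>) * ((1 - 2 * \<epsilon>) * x)"
        using n \<open>0 < \<mu>\<close> \<epsilon> by (intro mult_left_mono) (auto simp: field_simps)
      also have "(1 + \<epsilon>) * ((1 - 2 * \<epsilon>) * x) = (1 - \<epsilon>) * x - 2 * \<epsilon>\<^sup>2 * x"
        by (simp add: algebra_simps power2_eq_square)
      also have "\<dots> \<le> (1 - \<epsilon>) * x" using \<open>0 \<le> x\<close> by simp
      finally show ?thesis using s by (simp add: mult_left_mono)
    qed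
    finally have "f 0 * exp (s * c) * \<theta> ^ n * exp (- s * x)
        \<le> f 0 * exp (s * c) * exp (s * ((1 - \<epsilon>) * x)) * exp (- s * x)"
      using f_nonneg[of 0] by (intro mult_right_mono mult_left_mono) auto
    also have "\<dots> = f 0 * exp (s * c) * exp (- s * \<epsilon> * x)"
      by (simp add: mult.assoc algebra_simps flip: exp_add)
    finally show "f 0 * exp (s * c) * \<theta> ^ n * exp (- s * x) \<le> f 0 * exp (s * c) * exp (- s * \<epsilon> * x)" .
  qed
  finally show ?thesis .
qed

end

lemma nn_integral_powr_tail_finite:
  fixes p :: real
  assumes "1 < p"
  shows "(\<integral>\<^sup>+u. ennreal (u powr (- p)) * indicator {1..} u \<partial>lborel) < \<infinity>"
proof -
  have "(\<integral>\<^sup>+u. ennreal (u powr (- p)) * indicator {1..} u \<partial>lborel)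
      = ennreal (0 - (- (1 powr (1 - p)) / (p - 1)))"
  proof (rule nn_integral_FTC_atLeast[where F = "\<lambda>x. - (x powr (1 - p)) / (p - 1)"])
    fix x :: real assume x: "1 \<le> x"
    show "((\<lambda>x. - (x powr (1 - p)) / (p - 1)) has_real_derivative x powr (- p)) (at x)"
    proof -
      have "((\<lambda>x. - (x powr (1 - p)) / (p - 1)) has_real_derivative
          - ((1 - p) * x powr (1 - p - 1)) / (p - 1)) (at x)"
        using x by (intro DERIV_cdivide DERIV_minus has_real_derivative_powr) auto
      moreover have "- ((1 - p) * x powr (1 - p - 1)) / (p - 1) = x powr (- p)"
        using assms by (simp flip: mult_minus_left)
      ultimately show ?thesis by (simp only:)
    qed
  next
    have "((\<lambda>x::real. x powr (1 - p)) \<longlongrightarrow> 0) at_top"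
      using tendsto_neg_powr[of "1 - p" "\<lambda>x. x" at_top] assms by (simp add: filterlim_ident)
    then have "((\<lambda>x::real. - (x powr (1 - p)) / (p - 1)) \<longlongrightarrow> - 0 / (p - 1)) at_top"
      using assms by (intro tendsto_divide tendsto_minus tendsto_const) auto
    then show "((\<lambda>x::real. - (x powr (1 - p)) / (p - 1)) \<longlongrightarrow> 0) at_top" by simp
  qed auto
  then show ?thesis by simp
qed

text \<open>
  Apply \<open>y \<le> exp y\<close> at \<open>y = q * t / p\<close> and raise to the power \<open>p\<close>.
\<close>

lemma powr_le_exp:
  fixes p q t :: real
  assumes "0 < p" "0 < q" "0 < t"
  shows "t powr p \<le> (p / q) powr p * exp (q * t)"
proof -
  have "q * t / p \<le> exp (q * t / p)" using exp_ge_add_one_self[of "q * t / p"] by linarith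
  then have "(q * t / p) powr p \<le> exp (q * t / p) powr p" using assms by (intro powr_mono2) auto
  also have "\<dots> = exp (q * t)" using assms by (simp add: powr_def)
  finally have "(p / q) powr p * (q * t / p) powr p \<le> (p / q) powr p * exp (q * t)"
    by (intro mult_left_mono) auto
  then show ?thesis using assms by (simp flip: powr_mult)
qed

locale regularly_varying_density = decreasing_density f \<mu> + regularly_varying_tail f \<alpha>
  for f \<mu> \<alpha> +
  assumes \<alpha>_gt_2: "2 < \<alpha>" and \<mu>_pos: "0 < \<mu>"
begin

text \<open>
  With \<open>\<gamma>, \<delta> \<le> (\<alpha> - 2) / 4\<close> the integrand \<open>u powr (1 + \<gamma>) * f u\<close> is at most of order
  \<open>u powr (- \<alpha> / 2)\<close>, and \<open>\<alpha> / 2 > 1\<close>.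
\<close>

lemma finite_moment:
  obtains \<gamma> m where "0 < \<gamma>" "\<gamma> \<le> 1" "0 \<le> m"
    "(\<integral>\<^sup>+u. ennreal (u powr (1 + \<gamma>)) * ennreal (f u) \<partial>lborel) \<le> ennreal m"
proof -
  define \<gamma> where "\<gamma> = min 1 ((\<alpha> - 2) / 4)"
  define \<delta> where "\<delta> = (\<alpha> - 2) / 4"
  obtain C where C: "0 < C" "\<And>x. 1 \<le> x \<Longrightarrow> f x \<le> C * x powr (- \<alpha> + \<delta>)"
    using T_le_powr[of \<delta>] \<alpha>_gt_2 by (auto simp: \<delta>_def)
  have "(\<integral>\<^sup>+u. ennreal (u powr (1 + \<gamma>)) * ennreal (f u) \<partial>lborel)
      \<le> (\<integral>\<^sup>+u. ennreal (f u) + ennreal C * (ennreal (u powr (- (\<alpha> / 2))) * indicator {1..} u) \<partial>lborel)"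
  proof (rule nn_integral_mono)
    fix u :: real
    consider "u < 0" | "0 \<le> u" "u < 1" | "1 \<le> u" by linarith
    then show "ennreal (u powr (1 + \<gamma>)) * ennreal (f u)
      \<le> ennreal (f u) + ennreal C * (ennreal (u powr (- (\<alpha> / 2))) * indicator {1..} u)"
    proof cases
      case 2
      then have "u powr (1 + \<gamma>) \<le> 1" using \<alpha>_gt_2 by (intro powr_le1) (auto simp: \<gamma>_def)
      then have "ennreal (u powr (1 + \<gamma>)) * ennreal (f u) \<le> 1 * ennreal (f u)"
        by (intro mult_right_mono) (auto simp: ennreal_le_1)
      then show ?thesis using 2 by simp
    next
      case 3
      have "u powr (1 + \<gamma>) * f u \<le> u powr (1 + \<gamma>) * (C * u powr (- \<alpha> + \<delta>))"
        by (intro mult_left_mono C 3) auto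
      also have "\<dots> = C * u powr (1 + \<gamma> - \<alpha> + \<delta>)" by (simp add: algebra_simps flip: powr_add)
      also have "\<dots> \<le> C * u powr (- (\<alpha> / 2))"
      proof -
        have "\<gamma> \<le> (\<alpha> - 2) / 4" unfolding \<gamma>_def by (rule min.cobounded2)
        then have "1 + \<gamma> - \<alpha> + \<delta> \<le> 1 + (\<alpha> - 2) / 4 - \<alpha> + (\<alpha> - 2) / 4"
          unfolding \<delta>_def by linarith
        also have "\<dots> = - (\<alpha> / 2)" by (simp add: field_simps)
        finally show ?thesis using 3 C(1) by (intro mult_left_mono powr_mono) auto
      qed
      finally have "ennreal (u powr (1 + \<gamma>)) * ennreal (f u) \<le> ennreal C * ennreal (u powr (- (\<alpha> / 2)))"
        using C(1) f_nonneg[of u] by (simp flip: ennreal_mult)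
      then show ?thesis using 3 by (simp add: add_increasing)
    qed (simp add: f_neg)
  qed
  also have "\<dots> = 1 + ennreal C * (\<integral>\<^sup>+u. ennreal (u powr (- (\<alpha> / 2))) * indicator {1..} u \<partial>lborel)"
    by (simp add: nn_integral_add nn_integral_cmult f_mass)
  also have "\<dots> < \<infinity>"
    using nn_integral_powr_tail_finite[of "\<alpha> / 2"] \<alpha>_gt_2 by (simp add: ennreal_mult_less_top)
  finally obtain m where "0 \<le> m" "(\<integral>\<^sup>+u. ennreal (u powr (1 + \<gamma>)) * ennreal (f u) \<partial>lborel) = ennreal m"
    by (metis ennreal_cases infinity_ennreal_def less_irrefl)
  then show thesis using that[of \<gamma> m] \<alpha>_gt_2 by (auto simp: \<gamma>_def)
qed

lemma f_le_tail:
  obtains C where "0 \<le> C"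
    "\<And>v. 0 \<le> v \<Longrightarrow> ennreal (f v) \<le> ennreal C * (\<integral>\<^sup>+u. ennreal (f u) * indicator {v<..} u \<partial>lborel)"
proof -
  obtain C where C: "0 < C" "\<And>v. 0 \<le> v \<Longrightarrow> f v \<le> C * f (v + 1)" using T_le_shift by blast
  show thesis
  proof (rule that[of C])
    fix v :: real assume v: "0 \<le> v"
    have "ennreal (f (v + 1)) = (\<integral>\<^sup>+u. ennreal (f (v + 1)) * indicator {v<..v+1} u \<partial>lborel)"
      by (simp add: nn_integral_cmult)
    also have "\<dots> \<le> (\<integral>\<^sup>+u. ennreal (f u) * indicator {v<..} u \<partial>lborel)"
      using v by (intro nn_integral_mono) (auto simp: indicator_def intro!: ennreal_leI f_decreasing)
    finally have *: "ennreal (f (v + 1)) \<le> (\<integral>\<^sup>+u. ennreal (f u) * indicator {v<..} u \<partial>lborel)" .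
    have "ennreal (f v) \<le> ennreal C * ennreal (f (v + 1))"
      using C v f_nonneg by (simp add: ennreal_leI flip: ennreal_mult)
    also have "\<dots> \<le> ennreal C * (\<integral>\<^sup>+u. ennreal (f u) * indicator {v<..} u \<partial>lborel)"
      by (intro mult_left_mono *) auto
    finally show "ennreal (f v) \<le> ennreal C * (\<integral>\<^sup>+u. ennreal (f u) * indicator {v<..} u \<partial>lborel)" .
  qed (use C in auto)
qed

text \<open>
  The local principle of one big jump, uniformly over the heavy-traffic range. Write \<open>\<kappa> = 1 - \<rho>\<close>
  and \<open>\<Lambda> = ln (1 / \<kappa>)\<close>, so that the range is \<open>\<kappa> * x \<ge> \<mu> * (\<alpha> - 1) * \<Lambda>\<close>. The number of summands is of
  order \<open>1 / \<kappa>\<close> and their sum of order \<open>\<mu> / \<kappa>\<close>, smaller than \<open>x\<close> by the factor \<open>\<Lambda>\<close>; hence the jump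
  that reaches \<open>x\<close> is of size close to \<open>x\<close>. The decisive competitor is a sum without big jump but with
  about \<open>x / \<mu>\<close> summands. Its contribution to \<open>\<kappa> * w \<rho> x\<close> is of order
  \<open>\<kappa>\<^sup>2 * exp (- (1 - 2 * \<epsilon>) * \<kappa> * x / \<mu>)\<close>, to be compared with \<open>f x \<ge> x powr (- \<alpha> - \<epsilon>)\<close>. The quotient is
  largest at the lower end of the range, where it is a power of \<open>\<kappa>\<close> with exponent
  \<open>2 - (\<alpha> + \<epsilon>) + (1 - 3 * \<epsilon>) * (\<alpha> - 1) = 1 - \<epsilon> - 3 * \<epsilon> * (\<alpha> - 1)\<close>, positive for small \<open>\<epsilon>\<close>; one \<open>\<epsilon>\<close>
  pays for the power of \<open>\<Lambda>\<close>.
\<close>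

theorem w_asymptotic:
  assumes err: "0 < (err::real)"
  shows "\<forall>\<^sub>F \<rho> in at_left 1. 0 < \<rho> \<and> \<rho> < 1 \<and>
    (\<forall>x. \<mu> * (\<alpha> - 1) * (1 / (1 - \<rho>)) * ln (1 / (1 - \<rho>)) \<le> x \<longrightarrow>
      \<bar>(1 - \<rho>) * w \<rho> x / f x - 1\<bar> \<le> err)"
proof -
  obtain \<gamma> m where \<gamma>: "0 < \<gamma>" "\<gamma> \<le> 1" "0 \<le> m"
    and m: "(\<integral>\<^sup>+u. ennreal (u powr (1 + \<gamma>)) * ennreal (f u) \<partial>lborel) \<le> ennreal m"
    by (rule finite_moment)
  obtain C where C: "0 \<le> C"
    "\<And>v. 0 \<le> v \<Longrightarrow> ennreal (f v) \<le> ennreal C * (\<integral>\<^sup>+u. ennreal (f u) * indicator {v<..} u \<partial>lborel)"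
    by (rule f_le_tail) blast
  obtain \<epsilon> where \<epsilon>: "0 < \<epsilon>" "\<epsilon> < 1 / 4" "\<epsilon> < 1 / (6 * \<alpha>)" "(1 - \<epsilon>) powr (- \<alpha>) < 1 + err / 4"
  proof -
    have "((\<lambda>\<epsilon>. (1 - \<epsilon>) powr (- \<alpha>)) \<longlongrightarrow> (1 - 0) powr (- \<alpha>)) (at_right (0::real))"
      by (intro tendsto_intros) auto
    then have "\<forall>\<^sub>F \<epsilon> in at_right 0. (1 - \<epsilon>) powr (- \<alpha>) < 1 + err / 4"
      using err by (intro order_tendstoD(2)[where y = "1 :: real"]) auto
    moreover have "\<forall>\<^sub>F \<epsilon> in at_right (0::real). 0 < \<epsilon> \<and> \<epsilon> < min (1 / 4) (1 / (6 * \<alpha>))"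
      using \<alpha>_gt_2 by (subst eventually_at_right[of 0 1]) (auto intro!: exI[of _ "min (1 / 4) (1 / (6 * \<alpha>))"])
    ultimately have "\<forall>\<^sub>F \<epsilon> in at_right (0::real). 0 < \<epsilon> \<and> \<epsilon> < 1 / 4 \<and> \<epsilon> < 1 / (6 * \<alpha>)
        \<and> (1 - \<epsilon>) powr (- \<alpha>) < 1 + err / 4"
      by eventually_elim auto
    then show thesis using that eventually_happens[of _ "at_right (0::real)"] by auto
  qed
  \<comment> \<open>The tilt is \<open>A * ln x / x\<close> and jumps are big from size \<open>\<eta> * x\<close> on. A large \<open>A\<close> makes Chernoff's
    bound \<open>x powr (- A * \<epsilon>)\<close> negligible, a small \<open>\<eta>\<close> keeps the factor \<open>x powr (A * \<eta>)\<close> harmless.\<close>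
  define A where "A = (\<alpha> + 2) / \<epsilon>"
  define \<eta> where "\<eta> = min 1 (\<gamma> / (2 * A))"
  have A: "0 < A" "A * \<epsilon> = \<alpha> + 2" using \<epsilon> \<alpha>_gt_2 by (auto simp: A_def)
  have \<eta>: "0 < \<eta>" "A * \<eta> \<le> \<gamma> / 2"
  proof -
    show "0 < \<eta>" using A \<gamma> by (simp add: \<eta>_def)
    have "A * \<eta> \<le> A * (\<gamma> / (2 * A))" using A by (intro mult_left_mono) (auto simp: \<eta>_def)
    then show "A * \<eta> \<le> \<gamma> / 2" using A by simp
  qed
  define R where "R = \<eta> powr (- \<alpha>) + 1"
  have R: "0 < R" by (simp add: R_def add_nonneg_pos)

  have "\<forall>\<^sub>F x in at_top. 1 \<le> x \<and> f ((1 - \<epsilon>) * x) / f x < 1 + err / 4 \<and> f (\<eta> * x) / f x < R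
      \<and> x powr (- \<alpha> - \<epsilon>) \<le> f x \<and> x powr (- \<alpha> - 1) \<le> f x
      \<and> m * ((A * ln x / x) powr \<gamma> * x powr (\<gamma> / 2)) < \<epsilon> * \<mu> \<and> f 0 * x powr (- (1 / 2)) < err / 4"
  proof (intro eventually_conj)
    show "\<forall>\<^sub>F x in at_top. f ((1 - \<epsilon>) * x) / f x < 1 + err / 4"
      using \<epsilon> by (intro order_tendstoD(2)[OF T_ratio]) auto
    show "\<forall>\<^sub>F x in at_top. f (\<eta> * x) / f x < R"
      using \<eta> by (intro order_tendstoD(2)[OF T_ratio]) (auto simp: R_def)
    have "((\<lambda>x. (A * ln x / x) powr \<gamma> * x powr (\<gamma> / 2)) \<longlongrightarrow> 0) at_top"
      using A(1) \<gamma>(1) by real_asymp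
    then have "((\<lambda>x. m * ((A * ln x / x) powr \<gamma> * x powr (\<gamma> / 2))) \<longlongrightarrow> m * 0) at_top"
      by (intro tendsto_intros)
    then show "\<forall>\<^sub>F x in at_top. m * ((A * ln x / x) powr \<gamma> * x powr (\<gamma> / 2)) < \<epsilon> * \<mu>"
      using \<epsilon> \<mu>_pos by (intro order_tendstoD(2)) auto
    have "((\<lambda>x. f 0 * x powr (- (1 / 2))) \<longlongrightarrow> f 0 * 0) at_top"
      by (intro tendsto_intros) real_asymp
    then show "\<forall>\<^sub>F x in at_top. f 0 * x powr (- (1 / 2)) < err / 4"
      using err by (intro order_tendstoD(2)) auto
  qed (use \<epsilon> \<alpha>_gt_2 eventually_ge_at_top T_eventually_ge_powr in auto)
  then obtain X where X: "\<And>x. X \<le> x \<Longrightarrow> 1 \<le> x \<and> f ((1 - \<epsilon>) * x) / f x < 1 + err / 4 \<and> f (\<eta> * x) / f x < R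
      \<and> x powr (- \<alpha> - \<epsilon>) \<le> f x \<and> x powr (- \<alpha> - 1) \<le> f x
      \<and> m * ((A * ln x / x) powr \<gamma> * x powr (\<gamma> / 2)) < \<epsilon> * \<mu> \<and> f 0 * x powr (- (1 / 2)) < err / 4"
    by (auto simp: eventually_at_top_linorder)

  \<comment> \<open>\<open>K\<close> is the constant of \<open>powr_le_exp\<close>, and \<open>\<Lambda>0\<close> makes the two errors of order \<open>1 / \<Lambda>\<close> small.\<close>
  define K where "K = ((\<alpha> + \<epsilon>) / (\<epsilon> / \<mu>)) powr (\<alpha> + \<epsilon>)"
  define \<Lambda>0 where "\<Lambda>0 = 1 + 8 * R / (\<epsilon> * (\<alpha> - 1) * err) + 8 / ((\<alpha> - 1) * err)"
  have \<kappa>_lim: "filterlim (\<lambda>\<rho>. 1 - \<rho>) (at_right 0) (at_left (1::real))"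
    by real_asymp
  have "LIM \<kappa> at_right (0::real). ln (1 / \<kappa>) :> (at_top :: real filter)"
    by real_asymp
  from filterlim_compose[OF this \<kappa>_lim] have lim: "LIM \<rho> at_left (1::real). ln (1 / (1 - \<rho>)) :> at_top" .
  have "\<forall>\<^sub>F \<rho> in at_left (1::real). \<Lambda>0 \<le> ln (1 / (1 - \<rho>))"
    using lim by (auto simp: filterlim_at_top)
  moreover have "\<forall>\<^sub>F \<rho> in at_left (1::real). X \<le> \<mu> * (\<alpha> - 1) * (1 / (1 - \<rho>)) * ln (1 / (1 - \<rho>))"
  proof -
    have "0 < \<mu> * (\<alpha> - 1)" using \<mu>_pos \<alpha>_gt_2 by simp
    then have "LIM \<kappa> at_right (0::real). \<mu> * (\<alpha> - 1) * (1 / \<kappa>) * ln (1 / \<kappa>) :> at_top"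
      by real_asymp
    from filterlim_compose[OF this \<kappa>_lim] show ?thesis by (auto simp: filterlim_at_top)
  qed
  moreover have "\<forall>\<^sub>F \<rho> in at_left (1::real). (f 0 + C) * K * (1 - \<rho>) powr (1 / 2) < err / 4"
  proof -
    have "((\<lambda>\<rho>. (f 0 + C) * K * (1 - \<rho>) powr (1 / 2)) \<longlongrightarrow> (f 0 + C) * K * 0) (at_left (1::real))"
      by (intro tendsto_mult_left) real_asymp
    then show ?thesis using err by (intro order_tendstoD(2)) auto
  qed
  moreover have "\<forall>\<^sub>F \<rho> in at_left (1::real). max 0 (1 - err / 2) < \<rho> \<and> \<rho> < 1"
    using err by (subst eventually_at_left[of 0 1]) (auto intro!: exI[of _ "max 0 (1 - err / 2)"])
  ultimately show ?thesis
  proof eventually_elim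
    case (elim \<rho>)
    then have \<rho>: "0 < \<rho>" "\<rho> < 1" "1 - err / 2 < \<rho>" by auto
    define \<kappa> where "\<kappa> = 1 - \<rho>"
    define \<Lambda> where "\<Lambda> = ln (1 / \<kappa>)"
    have \<kappa>: "0 < \<kappa>" "\<kappa> < 1" using \<rho> by (auto simp: \<kappa>_def)
    have \<Lambda>: "\<Lambda>0 \<le> \<Lambda>" using elim by (simp add: \<Lambda>_def \<kappa>_def)
    have "1 \<le> \<Lambda>0" "8 * R / (\<epsilon> * (\<alpha> - 1) * err) \<le> \<Lambda>0" "8 / ((\<alpha> - 1) * err) \<le> \<Lambda>0"
      using err \<epsilon> \<alpha>_gt_2 R by (auto simp: \<Lambda>0_def)
    then have \<Lambda>': "1 \<le> \<Lambda>" "8 * R / (\<epsilon> * (\<alpha> - 1) * err) \<le> \<Lambda>" "8 / ((\<alpha> - 1) * err) \<le> \<Lambda>"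
      using \<Lambda> by auto
    have "\<bar>(1 - \<rho>) * w \<rho> x / f x - 1\<bar> \<le> err"
      if x: "\<mu> * (\<alpha> - 1) * (1 / (1 - \<rho>)) * ln (1 / (1 - \<rho>)) \<le> x" for x
    proof -
      have "X \<le> x" using x elim by linarith
      from X[OF this] have x1: "1 \<le> x"
        and ratio1: "f ((1 - \<epsilon>) * x) / f x < 1 + err / 4" and ratio2: "f (\<eta> * x) / f x < R"
        and f_ge: "x powr (- \<alpha> - \<epsilon>) \<le> f x" "x powr (- \<alpha> - 1) \<le> f x"
        and tilt: "m * ((A * ln x / x) powr \<gamma> * x powr (\<gamma> / 2)) < \<epsilon> * \<mu>"
        and x_small: "f 0 * x powr (- (1 / 2)) < err / 4"
        by auto
      have x0: "0 < x" using x1 by simp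
      have fx: "0 < f x" using T_pos[of x] x0 by simp
      define t where "t = \<kappa> * x"
      have t: "\<mu> * (\<alpha> - 1) * \<Lambda> \<le> t"
        using x \<kappa> by (simp add: t_def \<Lambda>_def \<kappa>_def field_simps)
      have t0: "0 < t" using \<kappa> x0 by (simp add: t_def)
      have \<mu>t: "\<mu> / t \<le> 1 / ((\<alpha> - 1) * \<Lambda>)"
        using t t0 \<mu>_pos \<alpha>_gt_2 \<Lambda>' by (simp add: field_simps)

      have lower: "1 - err \<le> \<kappa> * w \<rho> x / f x"
      proof -
        have "\<rho> - 4 * (\<mu> / t) \<le> \<kappa> * (\<rho> / \<kappa> - 2 * \<mu> / x * (2 * \<rho>\<^sup>2 / \<kappa>\<^sup>2))"
        proof -
          have "\<kappa> * (\<rho> / \<kappa> - 2 * \<mu> / x * (2 * \<rho>\<^sup>2 / \<kappa>\<^sup>2)) = \<rho> - 4 * (\<mu> / t) * \<rho>\<^sup>2"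
            using \<kappa> x0 by (simp add: t_def field_simps power2_eq_square)
          moreover have "\<rho>\<^sup>2 \<le> 1" using \<rho> by (simp add: power_le_one)
          then have "4 * (\<mu> / t) * \<rho>\<^sup>2 \<le> 4 * (\<mu> / t) * 1"
            using \<mu>_pos t0 by (intro mult_left_mono) auto
          ultimately show ?thesis by simp
        qed
        also have "\<dots> \<le> \<kappa> * w \<rho> x / f x"
        proof -
          have "\<kappa> * (f x * (\<rho> / \<kappa> - 2 * \<mu> / x * (2 * \<rho>\<^sup>2 / \<kappa>\<^sup>2))) \<le> \<kappa> * w \<rho> x"
            using w_lower[OF \<rho>(1,2) x0] \<kappa> unfolding \<kappa>_def[symmetric] by (intro mult_left_mono) auto
          then show ?thesis unfolding pos_le_divide_eq[OF fx] by (simp only: mult_ac)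
        qed
        finally have "\<rho> - 4 * (\<mu> / t) \<le> \<kappa> * w \<rho> x / f x" .
        moreover have "4 / ((\<alpha> - 1) * \<Lambda>) \<le> err / 2"
          using \<Lambda>' \<alpha>_gt_2 err by (simp add: field_simps)
        ultimately show ?thesis using \<mu>t \<rho>(3) by simp
      qed

      define s where "s = A * ln x / x"
      define c where "c = \<eta> * x"
      have s: "0 \<le> s" using A x1 by (simp add: s_def)
      have exp_sc: "exp (s * c) = x powr (A * \<eta>)"
        using x0 by (simp add: s_def c_def powr_def mult_ac)
      have "s powr \<gamma> * exp (s * c) * m \<le> s powr \<gamma> * x powr (\<gamma> / 2) * m"
        unfolding exp_sc using \<eta> x1 \<gamma> by (intro mult_right_mono mult_left_mono powr_mono) auto
      also have "\<dots> \<le> \<epsilon> * \<mu>" using tilt by (simp add: s_def mult_ac)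
      finally have few: "conv_pow (small c) n x \<le> ennreal (f 0 * exp (s * c) * exp (- s * \<epsilon> * x))"
        if "real n < (1 - 2 * \<epsilon>) * x / \<mu>" for n
        using that \<epsilon> \<mu>_pos x0 by (intro small_pow_le_few[OF \<gamma>(1,2) s \<gamma>(3) m]) auto
      define K1 where "K1 = f 0 * exp (s * c) * exp (- s * \<epsilon> * x)"
      have "w \<rho> x \<le> \<rho> / (1 - \<rho>) * f (x - \<epsilon> * x) + 2 * \<rho>\<^sup>2 / (1 - \<rho>)\<^sup>2 * (f c * \<mu> / (\<epsilon> * x))
          + K1 + (1 - \<rho>) * exp (- (1 - \<rho>) * ((1 - 2 * \<epsilon>) * x / \<mu>)) * (f 0 + C)"
        using \<epsilon> \<eta> x0 C f_nonneg few by (intro w_upper \<rho>) (auto simp: c_def K1_def)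
      then have "\<kappa> * w \<rho> x \<le> \<kappa> * (\<rho> / \<kappa> * f (x - \<epsilon> * x) + 2 * \<rho>\<^sup>2 / \<kappa>\<^sup>2 * (f c * \<mu> / (\<epsilon> * x))
          + K1 + \<kappa> * exp (- \<kappa> * ((1 - 2 * \<epsilon>) * x / \<mu>)) * (f 0 + C))"
        unfolding \<kappa>_def[symmetric] using \<kappa> by (intro mult_left_mono) auto
      also have "\<dots> = \<rho> * f ((1 - \<epsilon>) * x) + 2 * \<rho>\<^sup>2 * f c * (\<mu> / t) / \<epsilon>
          + \<kappa> * K1 + \<kappa>\<^sup>2 * exp (- ((1 - 2 * \<epsilon>) * t / \<mu>)) * (f 0 + C)"
      proof -
        have exponent: "- \<kappa> * ((1 - 2 * \<epsilon>) * x / \<mu>) = - ((1 - 2 * \<epsilon>) * t / \<mu>)"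
          by (simp add: t_def mult_ac)
        have collect: "\<kappa> * (\<rho> / \<kappa> * a + 2 * \<rho>\<^sup>2 / \<kappa>\<^sup>2 * (b * \<mu> / (\<epsilon> * x)) + K1 + \<kappa> * E * D)
          = \<rho> * a + 2 * \<rho>\<^sup>2 * b * (\<mu> / t) / \<epsilon> + \<kappa> * K1 + \<kappa>\<^sup>2 * E * D" for a b E D
          using \<kappa> x0 \<epsilon>(1) by (simp add: t_def field_simps power2_eq_square)
        have "x - \<epsilon> * x = (1 - \<epsilon>) * x" by (simp add: algebra_simps)
        then show ?thesis unfolding exponent by (simp only: collect)
      qed
      finally have "\<kappa> * w \<rho> x / f x \<le> (\<rho> * f ((1 - \<epsilon>) * x) + 2 * \<rho>\<^sup>2 * f c * (\<mu> / t) / \<epsilon>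
          + \<kappa> * K1 + \<kappa>\<^sup>2 * exp (- ((1 - 2 * \<epsilon>) * t / \<mu>)) * (f 0 + C)) / f x"
        using fx by (intro divide_right_mono) auto
      also have "\<dots> = \<rho> * (f ((1 - \<epsilon>) * x) / f x) + 2 * \<rho>\<^sup>2 * (f c / f x) * (\<mu> / t) / \<epsilon>
          + \<kappa> * K1 / f x + \<kappa>\<^sup>2 * exp (- ((1 - 2 * \<epsilon>) * t / \<mu>)) * (f 0 + C) / f x"
        by (simp add: add_divide_distrib)
      finally have upper: "\<kappa> * w \<rho> x / f x
        \<le> \<rho> * (f ((1 - \<epsilon>) * x) / f x) + 2 * \<rho>\<^sup>2 * (f c / f x) * (\<mu> / t) / \<epsilon>
          + \<kappa> * K1 / f x + \<kappa>\<^sup>2 * exp (- ((1 - 2 * \<epsilon>) * t / \<mu>)) * (f 0 + C) / f x" .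

      have term1: "\<rho> * (f ((1 - \<epsilon>) * x) / f x) \<le> 1 + err / 4"
      proof -
        have "\<rho> * (f ((1 - \<epsilon>) * x) / f x) \<le> 1 * (f ((1 - \<epsilon>) * x) / f x)"
          using \<rho> f_nonneg by (intro mult_right_mono) auto
        then show ?thesis using ratio1 by simp
      qed
      have term2: "2 * \<rho>\<^sup>2 * (f c / f x) * (\<mu> / t) / \<epsilon> \<le> err / 4"
      proof -
        have "2 * \<rho>\<^sup>2 * (f c / f x) * (\<mu> / t) \<le> 2 * 1 * R * (1 / ((\<alpha> - 1) * \<Lambda>))"
          using \<rho> ratio2 \<mu>t \<mu>_pos t0 f_nonneg R
          by (intro mult_mono) (auto simp: c_def power_le_one)
        also have "\<dots> \<le> \<epsilon> * (err / 4)"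
          using \<Lambda>' \<alpha>_gt_2 err \<epsilon> by (simp add: field_simps)
        finally show ?thesis unfolding pos_divide_le_eq[OF \<epsilon>(1)] by (simp only: mult.commute)
      qed
      have term3: "\<kappa> * K1 / f x \<le> err / 4"
      proof -
        have "exp (- s * \<epsilon> * x) = x powr (- (\<alpha> + 2))"
        proof -
          have "exp (- s * \<epsilon> * x) = exp (- (A * \<epsilon>) * ln x)" using x0 by (simp add: s_def mult_ac)
          then show ?thesis unfolding A(2) using x0 by (simp add: powr_def)
        qed
        then have "K1 = f 0 * x powr (A * \<eta> + - (\<alpha> + 2))"
          unfolding K1_def exp_sc by (simp only: mult.assoc powr_add)
        also have "\<dots> \<le> f 0 * x powr (- (1 / 2) + (- \<alpha> - 1))"
          using \<eta> \<gamma> x1 f_nonneg[of 0] by (intro mult_left_mono powr_mono) auto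
        also have "\<dots> = f 0 * x powr (- (1 / 2)) * x powr (- \<alpha> - 1)"
          by (simp only: powr_add mult.assoc)
        also have "\<dots> \<le> err / 4 * f x"
          using x_small f_ge err by (intro mult_mono) auto
        finally have "\<kappa> * K1 \<le> 1 * (err / 4 * f x)"
          using \<kappa> f_nonneg[of 0] by (intro mult_mono) (auto simp: K1_def)
        then show ?thesis using fx by (simp add: field_simps)
      qed
      have term4: "\<kappa>\<^sup>2 * exp (- ((1 - 2 * \<epsilon>) * t / \<mu>)) * (f 0 + C) / f x \<le> err / 4"
      proof -
        define p where "p = \<alpha> + \<epsilon>"
        have p: "0 < p" using \<alpha>_gt_2 \<epsilon> by (simp add: p_def)
        have "1 / f x \<le> 1 / x powr (- p)"
          using f_ge(1) fx x0 by (intro divide_left_mono) (auto simp: p_def)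
        also have "\<dots> = x powr p" by (simp add: powr_minus field_simps)
        also have "\<dots> = t powr p * \<kappa> powr (- p)"
          using \<kappa> x0 by (simp add: t_def powr_mult powr_minus)
        also have "\<dots> \<le> (K * exp (\<epsilon> / \<mu> * t)) * \<kappa> powr (- p)"
          unfolding K_def p_def[symmetric] using p t0 \<epsilon> \<mu>_pos
          by (intro mult_right_mono powr_le_exp) auto
        finally have "\<kappa>\<^sup>2 * exp (- ((1 - 2 * \<epsilon>) * t / \<mu>)) * (1 / f x)
            \<le> \<kappa>\<^sup>2 * exp (- ((1 - 2 * \<epsilon>) * t / \<mu>)) * ((K * exp (\<epsilon> / \<mu> * t)) * \<kappa> powr (- p))"
          by (intro mult_left_mono) auto
        also have "\<dots> = K * (\<kappa> powr 2 * \<kappa> powr (- p)) * (exp (- ((1 - 2 * \<epsilon>) * t / \<mu>)) * exp (\<epsilon> / \<mu> * t))"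
          using \<kappa> by (simp add: mult_ac)
        also have "\<dots> = K * \<kappa> powr (2 - p) * exp (- ((1 - 3 * \<epsilon>) * (t / \<mu>)))"
        proof -
          have "- ((1 - 2 * \<epsilon>) * t / \<mu>) + \<epsilon> / \<mu> * t = - ((1 - 3 * \<epsilon>) * (t / \<mu>))"
            by (simp add: algebra_simps diff_divide_distrib)
          then show ?thesis by (simp only: exp_add[symmetric] powr_add[symmetric]) simp
        qed
        also have "\<dots> \<le> K * \<kappa> powr (2 - p) * \<kappa> powr ((1 - 3 * \<epsilon>) * (\<alpha> - 1))"
        proof -
          have "(\<alpha> - 1) * \<Lambda> \<le> t / \<mu>" using t \<mu>_pos by (simp add: field_simps)
          then have "(1 - 3 * \<epsilon>) * ((\<alpha> - 1) * \<Lambda>) \<le> (1 - 3 * \<epsilon>) * (t / \<mu>)"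
            using \<epsilon> by (intro mult_left_mono) auto
          then have "exp (- ((1 - 3 * \<epsilon>) * (t / \<mu>))) \<le> exp (- ((1 - 3 * \<epsilon>) * ((\<alpha> - 1) * \<Lambda>)))" by simp
          also have "\<dots> = \<kappa> powr ((1 - 3 * \<epsilon>) * (\<alpha> - 1))"
            using \<kappa> by (simp add: powr_def \<Lambda>_def ln_div)
          finally show ?thesis by (intro mult_left_mono) (auto simp: K_def)
        qed
        also have "\<dots> = K * \<kappa> powr (2 - p + (1 - 3 * \<epsilon>) * (\<alpha> - 1))"
          by (simp only: powr_add mult.assoc)
        also have "\<dots> \<le> K * \<kappa> powr (1 / 2)"
        proof -
          have "6 * \<alpha> * \<epsilon> < 1" using \<epsilon>(3) \<alpha>_gt_2 by (simp add: field_simps)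
          then have "1 / 2 \<le> 2 - p + (1 - 3 * \<epsilon>) * (\<alpha> - 1)"
            using \<epsilon> by (simp add: p_def algebra_simps)
          then show ?thesis using \<kappa> by (intro mult_left_mono powr_mono') (auto simp: K_def)
        qed
        finally have "\<kappa>\<^sup>2 * exp (- ((1 - 2 * \<epsilon>) * t / \<mu>)) * (1 / f x) * (f 0 + C) \<le> K * \<kappa> powr (1 / 2) * (f 0 + C)"
          using C f_nonneg[of 0] by (intro mult_right_mono) auto
        also have "\<dots> \<le> err / 4" using elim by (simp add: \<kappa>_def mult_ac)
        finally show ?thesis by (simp add: mult_ac)
      qed
      show ?thesis
        unfolding \<kappa>_def[symmetric] abs_le_iff
        using lower upper term1 term2 term3 term4 err by (intro conjI; linarith)
    qed
    with \<rho> show ?case by blast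
  qed
qed

end

section \<open>Compound Poisson steps\<close>

text \<open>
  To first order in \<open>a\<close> a Poisson variable is zero or one; two or more has probability at most
  \<open>a\<^sup>2\<close>.
\<close>

lemma poisson_bounded_expansion:
  fixes \<phi> :: "nat \<Rightarrow> real"
  assumes a: "0 < a" and \<phi>: "\<And>k. \<bar>\<phi> k\<bar> \<le> 1"
  shows "\<bar>(\<integral>k. \<phi> k \<partial>measure_pmf (poisson_pmf a)) - ((1 - a) * \<phi> 0 + a * \<phi> 1)\<bar> \<le> 2 * a\<^sup>2"
proof -
  let ?P = "measure_pmf (poisson_pmf a)"
  let ?p = "pmf (poisson_pmf a)"
  have int: "integrable ?P g" if "\<And>k. \<bar>g k\<bar> \<le> 1" for g :: "nat \<Rightarrow> real"
    using that by (intro measure_pmf.integrable_const_bound[where B = 1]) auto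
  define r where "r k = (if 2 \<le> k then 1 else 0 :: real)" for k :: nat
  have r_int: "(\<integral>k. r k \<partial>?P) = 1 - ?p 0 - ?p 1"
  proof -
    have "(\<integral>k. r k \<partial>?P) = (\<integral>k. 1 - indicator {0} k - indicator {1} k \<partial>?P)"
    proof (intro Bochner_Integration.integral_cong refl)
      fix k :: nat
      consider "k = 0" | "k = 1" | "2 \<le> k" by linarith
      then show "r k = 1 - indicator {0} k - indicator {1} k" by cases (auto simp: r_def)
    qed
    also have "\<dots> = 1 - ?p 0 - ?p 1"
    proof -
      have i: "integrable ?P (indicator A :: nat \<Rightarrow> real)" for A
        by (rule int) (simp add: indicator_def)
      have j: "integrable ?P (\<lambda>k. 1 - indicator {0} k :: real)"
        by (rule int) (simp add: indicator_def)
      have "(\<integral>k. (1 - indicator {0} k :: real) \<partial>?P) = (\<integral>k. 1 \<partial>?P) - (\<integral>k. indicator {0} k \<partial>?P)"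
        by (rule Bochner_Integration.integral_diff[OF _ i]) simp
      then show ?thesis
        unfolding Bochner_Integration.integral_diff[OF j i]
        by (simp add: measure_pmf_single measure_pmf.prob_space)
    qed
    finally show ?thesis .
  qed
  have split: "(\<integral>k. \<phi> k \<partial>?P) = ?p 0 * \<phi> 0 + ?p 1 * \<phi> 1 + (\<integral>k. r k * \<phi> k \<partial>?P)"
  proof -
    have "(\<integral>k. \<phi> k \<partial>?P)
        = (\<integral>k. indicator {0} k * \<phi> 0 + indicator {1} k * \<phi> 1 + r k * \<phi> k \<partial>?P)"
    proof (intro Bochner_Integration.integral_cong refl)
      fix k :: nat
      consider "k = 0" | "k = 1" | "2 \<le> k" by linarith
      then show "\<phi> k = indicator {0} k * \<phi> 0 + indicator {1} k * \<phi> 1 + r k * \<phi> k"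
        by cases (auto simp: r_def)
    qed
    also have "\<dots> = ?p 0 * \<phi> 0 + ?p 1 * \<phi> 1 + (\<integral>k. r k * \<phi> k \<partial>?P)"
    proof -
      have i: "integrable ?P (\<lambda>k. indicator A k * \<phi> j)" for A j
        using \<phi>[of j] by (intro int) (simp add: indicator_def)
      have j: "integrable ?P (\<lambda>k. r k * \<phi> k)" using \<phi> by (intro int) (simp add: r_def)
      show ?thesis
        unfolding Bochner_Integration.integral_add[OF Bochner_Integration.integrable_add[OF i i] j]
          Bochner_Integration.integral_add[OF i i]
        by (simp add: measure_pmf_single)
    qed
    finally show ?thesis .
  qed
  have "\<bar>\<integral>k. r k * \<phi> k \<partial>?P\<bar> \<le> (\<integral>k. \<bar>r k * \<phi> k\<bar> \<partial>?P)"
    by (rule integral_abs_bound)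
  also have "\<dots> \<le> (\<integral>k. r k \<partial>?P)"
    using \<phi> by (intro integral_mono int) (auto simp: r_def abs_mult)
  finally have rest: "\<bar>\<integral>k. r k * \<phi> k \<partial>?P\<bar> \<le> 1 - ?p 0 - ?p 1" unfolding r_int .
  have p: "?p 0 = exp (-a)" "?p 1 = a * exp (-a)" using a by simp_all
  have e: "1 - a \<le> exp (-a)" using exp_ge_add_one_self[of "-a"] by simp
  have e1: "exp (-a) \<le> 1" using a by simp
  have d0: "\<bar>(?p 0 - (1 - a)) * \<phi> 0\<bar> \<le> (?p 0 - (1 - a)) * 1"
    unfolding abs_mult p using e \<phi> by (intro mult_mono) auto
  have d1: "\<bar>(?p 1 - a) * \<phi> 1\<bar> \<le> (a - ?p 1) * 1"
    unfolding abs_mult p using a e1 \<phi> by (intro mult_mono) (auto simp: abs_if mult_left_le)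
  have "\<bar>(\<integral>k. \<phi> k \<partial>?P) - ((1 - a) * \<phi> 0 + a * \<phi> 1)\<bar>
      = \<bar>(?p 0 - (1 - a)) * \<phi> 0 + (?p 1 - a) * \<phi> 1 + (\<integral>k. r k * \<phi> k \<partial>?P)\<bar>"
    unfolding split by (simp add: algebra_simps)
  also have "\<dots> \<le> (?p 0 - (1 - a)) + (a - ?p 1) + (1 - ?p 0 - ?p 1)"
    using order.trans[OF abs_triangle_ineq add_mono[OF order.trans[OF abs_triangle_ineq
        add_mono[OF d0 d1]] rest]] by simp
  also have "\<dots> = 2 * (a * (1 - exp (-a)))" by (simp only: p) (simp add: algebra_simps)
  also have "\<dots> \<le> 2 * (a * a)" using e a by (intro mult_left_mono) auto
  finally show ?thesis by (simp add: power2_eq_square)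
qed

lemma poisson_mean:
  assumes "0 < a"
  shows "(\<integral>\<^sup>+k. ennreal (real k) \<partial>measure_pmf (poisson_pmf a)) = ennreal a"
proof -
  have s: "(\<lambda>k. a * exp (-a) * (inverse (fact k) * a ^ k)) sums (a * exp (-a) * exp a)"
    using exp_converges[of a] by (intro sums_mult) simp
  have "(\<lambda>k. pmf (poisson_pmf a) (Suc k) * real (Suc k)) = (\<lambda>k. a * exp (-a) * (inverse (fact k) * a ^ k))"
    by (rule ext, simp only: pmf_poisson[OF assms]) (simp add: divide_simps del: of_nat_Suc)
  then have "(\<lambda>k. pmf (poisson_pmf a) (Suc k) * real (Suc k)) sums a"
    using s by (simp only: mult.assoc mult_exp_exp) simp
  then have t: "(\<lambda>k. pmf (poisson_pmf a) k * real k) sums a"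
    by (subst (asm) sums_Suc_iff) simp
  have "(\<integral>\<^sup>+k. ennreal (real k) \<partial>measure_pmf (poisson_pmf a))
      = (\<Sum>k. ennreal (pmf (poisson_pmf a) k * real k))"
    by (simp only: nn_integral_measure_pmf nn_integral_count_space_nat ennreal_mult[OF pmf_nonneg of_nat_0_le_iff])
  also have "\<dots> = ennreal (\<Sum>k. pmf (poisson_pmf a) k * real k)"
    by (rule suminf_ennreal2[OF _ sums_summable[OF t]]) simp
  finally show ?thesis unfolding sums_unique[OF t, symmetric] .
qed

locale jump_law = prob_space D for D :: "real measure" +
  fixes \<beta> :: real
  assumes sets_D [simp, measurable_cong]: "sets D = sets borel"
    and D_nonneg: "AE b in D. 0 \<le> b"
    and D_integrable: "integrable D (\<lambda>b. b)"
    and \<beta>_def: "\<beta> = (\<integral>b. b \<partial>D)"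
begin

sublocale seq: sequence_space D
  by unfold_locales

lemma measurable_D [simp]: "measurable D A = measurable borel A"
  by (intro measurable_cong_sets) auto

abbreviation "Jumps \<equiv> Pi\<^sub>M (UNIV :: nat set) (\<lambda>_. D)"

abbreviation "Counts a \<equiv> Pi\<^sub>M (UNIV :: nat set) (\<lambda>_. measure_pmf (poisson_pmf a))"

text \<open>
  The law of the total jump in a time interval with a mean number \<open>a\<close> of jumps.
\<close>

definition compound :: "real \<Rightarrow> real measure" where
  "compound a = distr (measure_pmf (poisson_pmf a) \<Otimes>\<^sub>M Jumps) borel (\<lambda>(k, b). \<Sum>i<k. b i)"

lemma space_D [simp]: "space D = UNIV"
  using sets_eq_imp_space_eq[OF sets_D] by simp

lemma measurable_coord [measurable]: "(\<lambda>b. b i) \<in> borel_measurable Jumps"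
proof -
  have "(\<lambda>b. b i) \<in> measurable Jumps D" by measurable
  then show ?thesis by (simp add: measurable_cong_sets[OF refl sets_D])
qed

lemma sets_pair_nat [measurable_cong]:
  "sets (measure_pmf p \<Otimes>\<^sub>M Jumps) = sets (count_space UNIV \<Otimes>\<^sub>M Jumps)"
  by (intro sets_pair_measure_cong) auto

lemma measurable_partial_sum [measurable]:
  "(\<lambda>(k, b). \<Sum>i<k. b i) \<in> borel_measurable (count_space (UNIV :: nat set) \<Otimes>\<^sub>M Jumps)"
  unfolding split_beta'
  by (rule measurable_compose_countable'[where f = "\<lambda>k w. \<Sum>i<k. snd w i" and g = fst and I = UNIV]) auto

lemma measurable_partial_sum' [measurable]:
  "(\<lambda>(k, b). \<Sum>i<k. b i) \<in> borel_measurable (measure_pmf p \<Otimes>\<^sub>M Jumps)"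
  using measurable_partial_sum unfolding measurable_cong_sets[OF sets_pair_nat refl] .

lemma sets_compound [simp, measurable_cong]: "sets (compound a) = sets borel"
  by (simp add: compound_def)

lemma measurable_compound [simp]: "measurable (compound a) A = measurable borel A"
  by (intro measurable_cong_sets) auto

lemma prob_space_compound: "prob_space (compound a)"
proof -
  interpret pair_prob_space "measure_pmf (poisson_pmf a)" Jumps by unfold_locales
  show ?thesis unfolding compound_def by (intro prob_space_distr) measurable
qed

lemma nn_integral_compound:
  assumes [measurable]: "u \<in> borel_measurable borel"
  shows "(\<integral>\<^sup>+s. u s \<partial>compound a)
    = (\<integral>\<^sup>+k. \<integral>\<^sup>+b. u (\<Sum>i<k. b i) \<partial>Jumps \<partial>measure_pmf (poisson_pmf a))"
proof -
  have "(\<integral>\<^sup>+s. u s \<partial>compound a)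
      = (\<integral>\<^sup>+z. u (case z of (k, b) \<Rightarrow> \<Sum>i<k. b i) \<partial>(measure_pmf (poisson_pmf a) \<Otimes>\<^sub>M Jumps))"
    unfolding compound_def by (subst nn_integral_distr) auto
  also have "\<dots> = (\<integral>\<^sup>+k. \<integral>\<^sup>+b. u (\<Sum>i<k. b i) \<partial>Jumps \<partial>measure_pmf (poisson_pmf a))"
    by (subst seq.P.nn_integral_fst[symmetric]) auto
  finally show ?thesis .
qed

lemma AE_Jumps_nonneg: "AE b in Jumps. \<forall>i. 0 \<le> b i"
  unfolding AE_all_countable by (intro allI seq.AE_component D_nonneg) auto

lemma AE_compound_nonneg: "AE s in compound a. 0 \<le> s"
proof -
  interpret pair_prob_space "measure_pmf (poisson_pmf a)" Jumps by unfold_locales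
  have "AE z in measure_pmf (poisson_pmf a) \<Otimes>\<^sub>M Jumps. 0 \<le> (case z of (k, b) \<Rightarrow> \<Sum>i<k. b i)"
  proof (rule AE_pair_measure)
    show "AE k in measure_pmf (poisson_pmf a). AE b in Jumps. 0 \<le> (case (k, b) of (k, b) \<Rightarrow> \<Sum>i<k. b i)"
      by (intro AE_I2 eventually_mono[OF AE_Jumps_nonneg]) (auto intro: sum_nonneg)
  qed measurable
  then show ?thesis unfolding compound_def by (subst AE_distr_iff) auto
qed

lemma nn_integral_coord:
  assumes [measurable]: "u \<in> borel_measurable borel"
  shows "(\<integral>\<^sup>+b. u (b i) \<partial>Jumps) = (\<integral>\<^sup>+x. u x \<partial>D)"
proof -
  have "(\<integral>\<^sup>+x. u x \<partial>D) = (\<integral>\<^sup>+x. u x \<partial>distr Jumps D (\<lambda>b. b i))"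
    by (subst seq.PiM_component) auto
  also have "\<dots> = (\<integral>\<^sup>+b. u (b i) \<partial>Jumps)" by (subst nn_integral_distr) auto
  finally show ?thesis ..
qed

lemma integral_coord:
  fixes u :: "real \<Rightarrow> real"
  assumes [measurable]: "u \<in> borel_measurable borel"
  shows "(\<integral>b. u (b i) \<partial>Jumps) = (\<integral>x. u x \<partial>D)"
proof -
  have "(\<integral>x. u x \<partial>D) = (\<integral>x. u x \<partial>distr Jumps D (\<lambda>b. b i))"
    by (subst seq.PiM_component) auto
  also have "\<dots> = (\<integral>b. u (b i) \<partial>Jumps)" by (subst integral_distr) auto
  finally show ?thesis ..
qed

lemma \<beta>_nonneg: "0 \<le> \<beta>"
  unfolding \<beta>_def by (intro integral_nonneg_AE D_nonneg)

lemma nn_integral_D: "(\<integral>\<^sup>+x. ennreal x \<partial>D) = ennreal \<beta>"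
  unfolding \<beta>_def by (intro nn_integral_eq_integral D_integrable D_nonneg)

lemma nn_integral_compound_id:
  assumes "0 < a"
  shows "(\<integral>\<^sup>+s. ennreal s \<partial>compound a) = ennreal (a * \<beta>)"
proof -
  have "(\<integral>\<^sup>+b. ennreal (\<Sum>i<k. b i) \<partial>Jumps) = ennreal (real k) * ennreal \<beta>" for k
  proof -
    have "(\<integral>\<^sup>+b. ennreal (\<Sum>i<k. b i) \<partial>Jumps) = (\<integral>\<^sup>+b. (\<Sum>i<k. ennreal (b i)) \<partial>Jumps)"
      using AE_Jumps_nonneg by (intro nn_integral_cong_AE) (auto elim!: eventually_mono simp: sum_ennreal)
    also have "\<dots> = (\<Sum>i<k. \<integral>\<^sup>+b. ennreal (b i) \<partial>Jumps)" by (intro nn_integral_sum) auto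
    also have "\<dots> = ennreal (real k) * ennreal \<beta>"
      by (simp add: nn_integral_coord[of "\<lambda>x. ennreal x"] nn_integral_D ennreal_of_nat_eq_real_of_nat)
    finally show ?thesis .
  qed
  then have "(\<integral>\<^sup>+s. ennreal s \<partial>compound a)
      = (\<integral>\<^sup>+k. ennreal (real k) * ennreal \<beta> \<partial>measure_pmf (poisson_pmf a))"
    by (subst nn_integral_compound) auto
  also have "\<dots> = ennreal a * ennreal \<beta>"
    using assms by (subst nn_integral_multc) (auto simp: poisson_mean)
  finally show ?thesis using assms \<beta>_nonneg by (simp add: ennreal_mult)
qed

lemma compound_integrable:
  assumes "0 < a"
  shows "integrable (compound a) (\<lambda>s. s)"
  using nn_integral_compound_id[OF assms] AE_compound_nonneg
  by (intro integrableI_nonneg) auto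

lemma integral_compound_id:
  assumes "0 < a"
  shows "(\<integral>s. s \<partial>compound a) = a * \<beta>"
  using assms \<beta>_nonneg nn_integral_compound_id[OF assms]
  by (subst integral_eq_nn_integral) (auto simp: AE_compound_nonneg)

lemma integral_compound_bounded:
  fixes u :: "real \<Rightarrow> real"
  assumes a: "0 < a" and [measurable]: "u \<in> borel_measurable borel" and u: "\<And>s. \<bar>u s\<bar> \<le> 1"
  shows "\<bar>(\<integral>s. u s \<partial>compound a) - ((1 - a) * u 0 + a * (\<integral>b. u b \<partial>D))\<bar> \<le> 2 * a\<^sup>2"
proof -
  interpret pair_prob_space "measure_pmf (poisson_pmf a)" Jumps by unfold_locales
  define \<phi> where "\<phi> k = (\<integral>b. u (\<Sum>i<k. b i) \<partial>Jumps)" for k :: nat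
  have int: "integrable Jumps (\<lambda>b. u (\<Sum>i<k. b i))" for k :: nat
    by (intro seq.P.integrable_const_bound[where B = 1] AE_I2) (auto simp: u)
  have "\<bar>\<phi> k\<bar> \<le> 1" for k
  proof -
    have "\<bar>\<phi> k\<bar> \<le> (\<integral>b. \<bar>u (\<Sum>i<k. b i)\<bar> \<partial>Jumps)" unfolding \<phi>_def by (rule integral_abs_bound)
    also have "\<dots> \<le> 1" using u int by (intro seq.P.integral_le_const) auto
    finally show ?thesis .
  qed
  from poisson_bounded_expansion[OF a this]
  have "\<bar>(\<integral>k. \<phi> k \<partial>measure_pmf (poisson_pmf a)) - ((1 - a) * \<phi> 0 + a * \<phi> 1)\<bar> \<le> 2 * a\<^sup>2" .
  moreover have "\<phi> 0 = u 0" by (simp add: \<phi>_def seq.P.prob_space)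
  moreover have "\<phi> 1 = (\<integral>b. u b \<partial>D)" by (simp add: \<phi>_def integral_coord)
  moreover have "(\<integral>s. u s \<partial>compound a) = (\<integral>k. \<phi> k \<partial>measure_pmf (poisson_pmf a))"
  proof -
    have "(\<integral>s. u s \<partial>compound a)
        = (\<integral>z. u (case z of (k, b) \<Rightarrow> \<Sum>i<k. b i) \<partial>(measure_pmf (poisson_pmf a) \<Otimes>\<^sub>M Jumps))"
      unfolding compound_def by (subst integral_distr) auto
    also have "\<dots> = (\<integral>k. \<phi> k \<partial>measure_pmf (poisson_pmf a))"
      unfolding \<phi>_def using u
      by (subst integral_fst'[symmetric]) (auto intro!: P.integrable_const_bound[where B = 1])
    finally show ?thesis .
  qed
  ultimately show ?thesis by simp
qed

end

section \<open>Crossing probabilities of the skeleton walk\<close>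

text \<open>
  The crossing event of the skeleton with mesh \<open>h\<close> is defined by recursion on the steps, shifting both
  sequences, because this matches the decomposition of their law after the first step. In step \<open>k\<close> the
  skeleton descends by \<open>h\<close> and consumes the next \<open>c k\<close> jumps from \<open>b\<close>; being nonpositive ends the walk.
\<close>

primrec hit :: "real \<Rightarrow> real \<Rightarrow> nat \<Rightarrow> real \<Rightarrow> (nat \<Rightarrow> real) \<Rightarrow> (nat \<Rightarrow> nat) \<Rightarrow> bool" where
  "hit h x 0 y b c \<longleftrightarrow> x < y"
| "hit h x (Suc n) y b c \<longleftrightarrow> x < y \<or>
    0 < y \<and> hit h x n (y - h + (\<Sum>i<c 0. b i)) (\<lambda>i. b (i + c 0)) (\<lambda>k. c (Suc k))"

abbreviation real_seqs :: "(nat \<Rightarrow> real) measure" where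
  "real_seqs \<equiv> Pi\<^sub>M UNIV (\<lambda>_. borel)"

abbreviation nat_seqs :: "(nat \<Rightarrow> nat) measure" where
  "nat_seqs \<equiv> Pi\<^sub>M UNIV (\<lambda>_. count_space UNIV)"

lemma measurable_step:
  shows "(\<lambda>(y, b, c). (y - h + (\<Sum>i<c 0. b i), (\<lambda>i. b (i + c 0)), (\<lambda>k. c (Suc k))))
    \<in> measurable (borel \<Otimes>\<^sub>M (real_seqs \<Otimes>\<^sub>M nat_seqs)) (borel \<Otimes>\<^sub>M (real_seqs \<Otimes>\<^sub>M nat_seqs))"
proof -
  let ?N = "borel \<Otimes>\<^sub>M (real_seqs \<Otimes>\<^sub>M nat_seqs)"
  have c: "(\<lambda>w. snd (snd w) k) \<in> measurable ?N (count_space UNIV)" for k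
    by measurable
  have b: "(\<lambda>w. fst (snd w) k) \<in> borel_measurable ?N" for k
    by measurable
  have "(\<lambda>w. \<Sum>i<snd (snd w) 0. fst (snd w) i) \<in> borel_measurable ?N"
    by (rule measurable_compose_countable'[where f = "\<lambda>k w. \<Sum>i<k. fst (snd w) i"
          and g = "\<lambda>w. snd (snd w) 0" and I = UNIV]) (use b c in auto)
  moreover have "(\<lambda>w i. fst (snd w) (i + snd (snd w) 0)) \<in> measurable ?N real_seqs"
  proof (rule measurable_abs_UNIV)
    show "(\<lambda>w. fst (snd w) (i + snd (snd w) 0)) \<in> borel_measurable ?N" for i
      by (rule measurable_compose_countable'[where f = "\<lambda>k w. fst (snd w) (i + k)"
            and g = "\<lambda>w. snd (snd w) 0" and I = UNIV]) (use b c in auto)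
  qed
  moreover have "(\<lambda>w k. snd (snd w) (Suc k)) \<in> measurable ?N nat_seqs"
    by (rule measurable_abs_UNIV) (rule c)
  moreover have "(\<lambda>w. fst w - h) \<in> borel_measurable ?N" by measurable
  ultimately show ?thesis
    unfolding split_beta' by (intro measurable_Pair borel_measurable_add) auto
qed

lemma measurable_hit:
  "(\<lambda>(y, b, c). hit h x n y b c) \<in> measurable (borel \<Otimes>\<^sub>M (real_seqs \<Otimes>\<^sub>M nat_seqs)) (count_space UNIV)"
proof (induction n)
  case 0
  show ?case by simp measurable
next
  case (Suc n)
  have IH: "(\<lambda>(y, b, c). hit h x n (y - h + (\<Sum>i<c 0. b i)) (\<lambda>i. b (i + c 0)) (\<lambda>k. c (Suc k)))
      \<in> measurable (borel \<Otimes>\<^sub>M (real_seqs \<Otimes>\<^sub>M nat_seqs)) (count_space UNIV)"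
    using measurable_compose[OF measurable_step Suc] by (simp add: split_beta')
  show ?case
    unfolding hit.simps split_beta'
    using IH by (intro pred_intros_logic) (auto simp: split_beta')
qed

lemma measurable_hit' [measurable (raw)]:
  assumes "f \<in> borel_measurable N" "g \<in> measurable N real_seqs" "c \<in> measurable N nat_seqs"
  shows "Measurable.pred N (\<lambda>w. hit h x n (f w) (g w) (c w))"
  using measurable_compose[OF measurable_Pair[OF assms(1) measurable_Pair[OF assms(2,3)]] measurable_hit]
  by simp

lemma (in sequence_space) nn_integral_iter:
  assumes [measurable]: "G \<in> borel_measurable S"
  shows "(\<integral>\<^sup>+w. G w \<partial>S) = (\<integral>\<^sup>+s. \<integral>\<^sup>+w. G (case_nat s w) \<partial>S \<partial>M)"
proof -
  have "(\<integral>\<^sup>+w. G w \<partial>S) = (\<integral>\<^sup>+w. G w \<partial>distr (M \<Otimes>\<^sub>M S) S (\<lambda>(s, w). case_nat s w))"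
    by (simp only: PiM_iter)
  also have "\<dots> = (\<integral>\<^sup>+z. G (case z of (s, w) \<Rightarrow> case_nat s w) \<partial>(M \<Otimes>\<^sub>M S))"
    by (subst nn_integral_distr) auto
  also have "\<dots> = (\<integral>\<^sup>+s. \<integral>\<^sup>+w. G (case_nat s w) \<partial>S \<partial>M)"
    by (subst P.nn_integral_fst[symmetric]) auto
  finally show ?thesis .
qed

text \<open>
  An independent identically distributed sequence restarted at a fixed index is a fresh copy,
  independent of the initial segment.
\<close>

lemma (in sequence_space) nn_integral_comb_seq:
  assumes [measurable]: "G \<in> borel_measurable S"
  shows "(\<integral>\<^sup>+w. G w \<partial>S) = (\<integral>\<^sup>+w. \<integral>\<^sup>+w'. G (comb_seq i w w') \<partial>S \<partial>S)"
proof -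
  have "(\<integral>\<^sup>+w. G w \<partial>S) = (\<integral>\<^sup>+w. G w \<partial>distr (S \<Otimes>\<^sub>M S) S (\<lambda>(w, w'). comb_seq i w w'))"
    by (simp only: PiM_comb_seq)
  also have "\<dots> = (\<integral>\<^sup>+z. G (case z of (w, w') \<Rightarrow> comb_seq i w w') \<partial>(S \<Otimes>\<^sub>M S))"
    by (subst nn_integral_distr) auto
  also have "\<dots> = (\<integral>\<^sup>+w. \<integral>\<^sup>+w'. G (comb_seq i w w') \<partial>S \<partial>S)"
    by (subst P.nn_integral_fst[symmetric]) auto
  finally show ?thesis .
qed

context jump_law
begin

lemma sets_Jumps [measurable_cong]: "sets Jumps = sets real_seqs"
  by (intro sets_PiM_cong) auto

lemma sets_Counts [measurable_cong]: "sets (Counts a) = sets nat_seqs"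
  by (intro sets_PiM_cong) auto

text \<open>
  As an \<^typ>\<open>ennreal\<close>-valued function of free arguments the indicator can be integrated over some
  of them.
\<close>

definition hit_indicator :: "real \<Rightarrow> real \<Rightarrow> nat \<Rightarrow> real \<Rightarrow> (nat \<Rightarrow> real) \<Rightarrow> (nat \<Rightarrow> nat) \<Rightarrow> ennreal" where
  "hit_indicator h x n y b c = (if hit h x n y b c then 1 else 0)"

lemma measurable_hit_indicator [measurable (raw)]:
  assumes [measurable]: "f \<in> borel_measurable N" "g \<in> measurable N real_seqs" "c \<in> measurable N nat_seqs"
  shows "(\<lambda>w. hit_indicator h x n (f w) (g w) (c w)) \<in> borel_measurable N"
  unfolding hit_indicator_def by measurable

definition hit_prob :: "real \<Rightarrow> real \<Rightarrow> real \<Rightarrow> nat \<Rightarrow> real \<Rightarrow> ennreal" where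
  "hit_prob a h x n y = (\<integral>\<^sup>+c. \<integral>\<^sup>+b. hit_indicator h x n y b c \<partial>Jumps \<partial>Counts a)"

text \<open>
  The Markov property at the first step. The number \<open>k\<close> of jumps is split off first; once it is
  fixed, the jumps that remain form a fresh sequence, so no random index is involved.
\<close>

lemma hit_prob_Suc:
  assumes y: "0 < y" "y \<le> x"
  shows "hit_prob a h x (Suc n) y = (\<integral>\<^sup>+s. hit_prob a h x n (y - h + s) \<partial>compound a)"
proof -
  interpret counts: sequence_space "measure_pmf (poisson_pmf a)" by unfold_locales
  interpret JC: pair_sigma_finite "Counts a" Jumps by unfold_locales
  let ?next = "\<lambda>c. \<integral>\<^sup>+b. hit_indicator h x n (y - h + (\<Sum>i<c 0. b i)) (\<lambda>i. b (i + c 0)) (\<lambda>k. c (Suc k)) \<partial>Jumps"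
  have step_meas: "(\<lambda>(c, b). hit_indicator h x n (y - h + (\<Sum>i<c 0. b i)) (\<lambda>i. b (i + c 0)) (\<lambda>k. c (Suc k)))
      \<in> borel_measurable (Counts a \<Otimes>\<^sub>M Jumps)"
  proof -
    have "(\<lambda>(c, b). (y, b, c)) \<in> measurable (Counts a \<Otimes>\<^sub>M Jumps) (borel \<Otimes>\<^sub>M (real_seqs \<Otimes>\<^sub>M nat_seqs))"
      by measurable
    from measurable_compose[OF measurable_compose[OF this measurable_step[of h]] measurable_hit[of h x n]]
    show ?thesis unfolding hit_indicator_def by (simp add: split_beta')
  qed
  have "hit_prob a h x (Suc n) y = (\<integral>\<^sup>+c. ?next c \<partial>Counts a)"
    using y by (simp add: hit_prob_def hit_indicator_def)
  also have "\<dots> = (\<integral>\<^sup>+k. \<integral>\<^sup>+c. ?next (case_nat k c) \<partial>Counts a \<partial>measure_pmf (poisson_pmf a))"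
    using step_meas by (intro counts.nn_integral_iter) (auto intro!: seq.P.borel_measurable_nn_integral)
  also have "\<dots> = (\<integral>\<^sup>+k. \<integral>\<^sup>+b. hit_prob a h x n (y - h + (\<Sum>i<k. b i)) \<partial>Jumps \<partial>measure_pmf (poisson_pmf a))"
  proof (rule nn_integral_cong)
    fix k :: nat
    have "(\<integral>\<^sup>+c. ?next (case_nat k c) \<partial>Counts a)
        = (\<integral>\<^sup>+c. \<integral>\<^sup>+b. hit_indicator h x n (y - h + (\<Sum>i<k. b i)) (\<lambda>i. b (i + k)) c \<partial>Jumps \<partial>Counts a)"
      by simp
    also have "\<dots> = (\<integral>\<^sup>+c. \<integral>\<^sup>+b. \<integral>\<^sup>+b'. hit_indicator h x n (y - h + (\<Sum>i<k. b i)) b' c \<partial>Jumps \<partial>Jumps \<partial>Counts a)"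
    proof (rule nn_integral_cong)
      fix c :: "nat \<Rightarrow> nat"
      have c: "c \<in> space nat_seqs" by (simp add: space_PiM)
      have "(\<lambda>b. hit_indicator h x n (y - h + (\<Sum>i<k. b i)) (\<lambda>i. b (i + k)) c) \<in> borel_measurable Jumps"
      proof (rule measurable_hit_indicator)
        show "(\<lambda>b. \<lambda>i. b (i + k)) \<in> measurable Jumps real_seqs"
          by (rule measurable_abs_UNIV) measurable
        show "(\<lambda>b. c) \<in> measurable Jumps nat_seqs" by (rule measurable_const[OF c])
      qed measurable
      from seq.nn_integral_comb_seq[OF this, of k]
      show "(\<integral>\<^sup>+b. hit_indicator h x n (y - h + (\<Sum>i<k. b i)) (\<lambda>i. b (i + k)) c \<partial>Jumps)
          = (\<integral>\<^sup>+b. \<integral>\<^sup>+b'. hit_indicator h x n (y - h + (\<Sum>i<k. b i)) b' c \<partial>Jumps \<partial>Jumps)"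
        by (simp add: comb_seq_less comb_seq_add)
    qed
    also have "\<dots> = (\<integral>\<^sup>+b. \<integral>\<^sup>+c. \<integral>\<^sup>+b'. hit_indicator h x n (y - h + (\<Sum>i<k. b i)) b' c \<partial>Jumps \<partial>Counts a \<partial>Jumps)"
      by (rule JC.Fubini'[symmetric]) measurable
    finally show "(\<integral>\<^sup>+c. ?next (case_nat k c) \<partial>Counts a)
        = (\<integral>\<^sup>+b. hit_prob a h x n (y - h + (\<Sum>i<k. b i)) \<partial>Jumps)"
      unfolding hit_prob_def .
  qed
  also have "\<dots> = (\<integral>\<^sup>+s. hit_prob a h x n (y - h + s) \<partial>compound a)"
    unfolding hit_prob_def by (subst nn_integral_compound) measurable
  finally show ?thesis .
qed

end

lemma ennreal_integral_le_nn_integral: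
  fixes g :: "'b \<Rightarrow> real"
  assumes g: "integrable M g"
  shows "ennreal (\<integral>x. g x \<partial>M) \<le> (\<integral>\<^sup>+x. ennreal (g x) \<partial>M)"
proof -
  have "(\<integral>x. g x \<partial>M) \<le> (\<integral>x. max 0 (g x) \<partial>M)"
    using g by (intro integral_mono) auto
  then have "ennreal (\<integral>x. g x \<partial>M) \<le> ennreal (\<integral>x. max 0 (g x) \<partial>M)" by (rule ennreal_leI)
  also have "\<dots> = (\<integral>\<^sup>+x. ennreal (max 0 (g x)) \<partial>M)"
    using g by (intro nn_integral_eq_integral[symmetric]) auto
  also have "\<dots> = (\<integral>\<^sup>+x. ennreal (g x) \<partial>M)"
    by (intro nn_integral_cong) (auto simp: max_def ennreal_neg)
  finally show ?thesis .
qed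

context jump_law
begin

lemma hit_prob_le_1: "hit_prob a h x n y \<le> 1"
proof -
  interpret counts: sequence_space "measure_pmf (poisson_pmf a)" by unfold_locales
  have "hit_prob a h x n y \<le> (\<integral>\<^sup>+c. \<integral>\<^sup>+b. 1 \<partial>Jumps \<partial>Counts a)"
    unfolding hit_prob_def by (intro nn_integral_mono) (auto simp: hit_indicator_def)
  also have "\<dots> = 1" by (simp add: seq.P.emeasure_space_1 counts.P.emeasure_space_1)
  finally show ?thesis .
qed

lemma hit_prob_above: "x < y \<Longrightarrow> hit_prob a h x n y = 1"
proof -
  assume "x < y"
  interpret counts: sequence_space "measure_pmf (poisson_pmf a)" by unfold_locales
  have "hit h x n y b c" for b c using \<open>x < y\<close> by (cases n) auto
  then show ?thesis
    by (simp add: hit_prob_def hit_indicator_def seq.P.emeasure_space_1 counts.P.emeasure_space_1)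
qed

lemma hit_prob_below:
  assumes "0 \<le> x" "y \<le> 0"
  shows "hit_prob a h x n y = 0"
proof -
  have "\<not> hit h x n y b c" for b c using assms by (cases n) auto
  then show ?thesis by (simp add: hit_prob_def hit_indicator_def)
qed

lemma hit_prob_0: "y \<le> x \<Longrightarrow> hit_prob a h x 0 y = 0"
  by (simp add: hit_prob_def hit_indicator_def)

text \<open>
  The maximum principle: a function that dominates the boundary values and is superharmonic in
  between dominates the crossing probability. One step starting in \<open>(0, x]\<close> ends above \<open>- h\<close>, hence the
  domain. The inequality is preserved from one number of steps to the next, so that no exit time appears.
\<close>

lemma hit_prob_le_supersolution:
  assumes x: "0 \<le> x"
    and [measurable]: "u \<in> borel_measurable borel"
    and int: "\<And>y. 0 < y \<Longrightarrow> y \<le> x \<Longrightarrow> integrable (compound a) (\<lambda>s. u (y - h + s))"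
    and nonneg: "\<And>y. - h < y \<Longrightarrow> 0 \<le> u y"
    and above: "\<And>y. x < y \<Longrightarrow> 1 \<le> u y"
    and super: "\<And>y. 0 < y \<Longrightarrow> y \<le> x \<Longrightarrow> (\<integral>s. u (y - h + s) \<partial>compound a) \<le> u y"
    and "- h < y"
  shows "hit_prob a h x n y \<le> ennreal (u y)"
  using \<open>- h < y\<close>
proof (induction n arbitrary: y)
  case (0 y)
  then show ?case
    using above[of y] hit_prob_le_1[of a h x 0 y] hit_prob_0[of y x a h]
    by (cases "x < y") (auto intro: order.trans)
next
  case (Suc n y)
  consider "x < y" | "y \<le> 0" | "0 < y" "y \<le> x" by linarith
  then show ?case
  proof cases
    case 1
    then show ?thesis using above[OF 1] hit_prob_le_1[of a h x "Suc n" y] by (auto intro: order.trans)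
  next
    case 2
    then show ?thesis using hit_prob_below[OF x 2] by simp
  next
    case 3
    have "hit_prob a h x (Suc n) y = (\<integral>\<^sup>+s. hit_prob a h x n (y - h + s) \<partial>compound a)"
      by (rule hit_prob_Suc[OF 3])
    also have "\<dots> \<le> (\<integral>\<^sup>+s. ennreal (u (y - h + s)) \<partial>compound a)"
      using 3 by (intro nn_integral_mono_AE eventually_mono[OF AE_compound_nonneg] Suc.IH) auto
    also have "\<dots> = ennreal (\<integral>s. u (y - h + s) \<partial>compound a)"
      using 3 by (intro nn_integral_eq_integral int eventually_mono[OF AE_compound_nonneg] nonneg) auto
    also have "\<dots> \<le> ennreal (u y)" by (intro ennreal_leI super 3)
    finally show ?thesis .
  qed
qed

text \<open>
  The lower counterpart needs a family of functions: after \<open>n\<close> steps the walk may still be inside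
  \<open>(0, x]\<close>, and a term that decreases with \<open>n\<close> has to account for this.
\<close>

lemma hit_prob_ge_subsolution:
  assumes x: "0 \<le> x"
    and int: "\<And>n y. 0 < y \<Longrightarrow> y \<le> x \<Longrightarrow> integrable (compound a) (\<lambda>s. l n (y - h + s))"
    and start: "\<And>y. - h < y \<Longrightarrow> y \<le> x \<Longrightarrow> l 0 y \<le> 0"
    and below: "\<And>n y. - h < y \<Longrightarrow> y \<le> 0 \<Longrightarrow> l n y \<le> 0"
    and above: "\<And>n y. x < y \<Longrightarrow> l n y \<le> 1"
    and sub: "\<And>n y. 0 < y \<Longrightarrow> y \<le> x \<Longrightarrow> l (Suc n) y \<le> (\<integral>s. l n (y - h + s) \<partial>compound a)"
    and "- h < y"
  shows "ennreal (l n y) \<le> hit_prob a h x n y"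
  using \<open>- h < y\<close>
proof (induction n arbitrary: y)
  case (0 y)
  then show ?case
    using above[of y 0] start[of y] by (cases "x < y") (auto simp: hit_prob_above ennreal_neg)
next
  case (Suc n y)
  consider "x < y" | "y \<le> 0" | "0 < y" "y \<le> x" by linarith
  then show ?case
  proof cases
    case 1
    then show ?thesis using above[OF 1] by (simp add: hit_prob_above)
  next
    case 2
    then show ?thesis using below[OF Suc.prems 2] by (simp add: ennreal_neg)
  next
    case 3
    have "ennreal (l (Suc n) y) \<le> ennreal (\<integral>s. l n (y - h + s) \<partial>compound a)"
      by (intro ennreal_leI sub 3)
    also have "\<dots> \<le> (\<integral>\<^sup>+s. ennreal (l n (y - h + s)) \<partial>compound a)"
      by (intro ennreal_integral_le_nn_integral int 3)
    also have "\<dots> \<le> (\<integral>\<^sup>+s. hit_prob a h x n (y - h + s) \<partial>compound a)"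
      using 3 by (intro nn_integral_mono_AE eventually_mono[OF AE_compound_nonneg] Suc.IH) auto
    also have "\<dots> = hit_prob a h x (Suc n) y"
      by (rule hit_prob_Suc[OF 3, symmetric])
    finally show ?thesis .
  qed
qed

lemma compound_shift_integrable:
  fixes W :: "real \<Rightarrow> real"
  assumes a: "0 < a" and [measurable]: "W \<in> borel_measurable borel" and W: "\<And>z. \<bar>W z\<bar> \<le> 1"
  shows "integrable (compound a) (\<lambda>s. W (q - s))" "integrable (compound a) (\<lambda>s. q + s)"
proof -
  interpret C: prob_space "compound a" by (rule prob_space_compound)
  show "integrable (compound a) (\<lambda>s. W (q - s))"
    using W by (intro C.integrable_const_bound[where B = 1]) auto
  show "integrable (compound a) (\<lambda>s. q + s)"
    using compound_integrable[OF a] by simp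
qed

lemma integral_compound_affine:
  fixes W :: "real \<Rightarrow> real"
  assumes a: "0 < a" and W: "W \<in> borel_measurable borel" "\<And>z. \<bar>W z\<bar> \<le> 1"
  shows "integrable (compound a) (\<lambda>s. A + B * W (q - s) + E * (r + s))"
    and "(\<integral>s. A + B * W (q - s) + E * (r + s) \<partial>compound a)
      = A + B * (\<integral>s. W (q - s) \<partial>compound a) + E * (r + a * \<beta>)"
proof -
  interpret C: prob_space "compound a" by (rule prob_space_compound)
  note i = compound_shift_integrable[OF a W] compound_integrable[OF a]
  show "integrable (compound a) (\<lambda>s. A + B * W (q - s) + E * (r + s))"
    by (intro Bochner_Integration.integrable_add integrable_mult_right i C.integrable_const)
  have r: "(\<integral>s. r + s \<partial>compound a) = r + a * \<beta>"
    using i(3) by (simp add: integral_compound_id[OF a] C.prob_space)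
  have BW: "integrable (compound a) (\<lambda>s. B * W (q - s))" by (intro integrable_mult_right i)
  have ABW: "integrable (compound a) (\<lambda>s. A + B * W (q - s))"
    by (intro Bochner_Integration.integrable_add BW C.integrable_const)
  have E: "integrable (compound a) (\<lambda>s. E * (r + s))" by (intro integrable_mult_right i)
  show "(\<integral>s. A + B * W (q - s) + E * (r + s) \<partial>compound a)
      = A + B * (\<integral>s. W (q - s) \<partial>compound a) + E * (r + a * \<beta>)"
    unfolding Bochner_Integration.integral_add[OF ABW E]
      Bochner_Integration.integral_add[OF C.integrable_const BW]
    by (simp add: r C.prob_space)
qed

text \<open>
  If \<open>W\<close> solves the scale function equation \<open>W' = drift \<nu> W\<close>, then \<open>W (x - X\<^sub>t)\<close> is a martingale for the
  process \<open>X\<close> that jumps at rate \<open>\<nu>\<close> and descends at unit speed.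
\<close>

definition drift :: "real \<Rightarrow> (real \<Rightarrow> real) \<Rightarrow> real \<Rightarrow> real" where
  "drift \<nu> W z = \<nu> * (W z - (\<integral>b. W (z - b) \<partial>D))"

lemma one_step:
  fixes W :: "real \<Rightarrow> real"
  assumes "0 < \<nu>" "0 < h" and [measurable]: "W \<in> borel_measurable borel" and W: "\<And>z. \<bar>W z\<bar> \<le> 1"
  shows "\<bar>(\<integral>s. W (q - s) \<partial>compound (\<nu> * h)) - (W q - h * drift \<nu> W q)\<bar> \<le> 2 * \<nu>\<^sup>2 * h\<^sup>2"
proof -
  have "\<bar>(\<integral>s. W (q - s) \<partial>compound (\<nu> * h))
      - ((1 - \<nu> * h) * W (q - 0) + (\<nu> * h) * (\<integral>b. W (q - b) \<partial>D))\<bar> \<le> 2 * (\<nu> * h)\<^sup>2"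
    using assms by (intro integral_compound_bounded) auto
  then show ?thesis by (simp add: drift_def algebra_simps power_mult_distrib)
qed

text \<open>
  The superharmonic function is \<open>1 - W (x - y) / W x\<close>, corrected by small multiples of constants and
  of \<open>y + h\<close>. The linear term is a strict supersolution because the walk has negative drift, and it
  absorbs the error of order \<open>h\<^sup>2\<close> of a step. Only one inequality is required of \<open>W\<close>, and it is the
  one that survives if \<open>W\<close> has a derivative with downward jumps, as it has if the jump law has atoms.
\<close>

lemma hit_prob_upper:
  fixes W :: "real \<Rightarrow> real"
  assumes \<nu>: "0 < \<nu>" "\<nu> * \<beta> < 1" and h: "0 < h" and x: "0 \<le> x"
    and W_meas: "W \<in> borel_measurable borel" and W_neg: "\<And>z. z < 0 \<Longrightarrow> W z = 0"
    and W_bounds: "\<And>z. 0 \<le> W z" "\<And>z. W z \<le> 1" and Wx: "0 < W x"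
    and growth: "\<And>z. 0 \<le> z \<Longrightarrow> z \<le> x + h \<Longrightarrow> W z \<le> W x + \<nu> * h"
    and semi: "\<And>z. 0 \<le> z \<Longrightarrow> h * drift \<nu> W (z + h) - \<nu>\<^sup>2 * h\<^sup>2 \<le> W (z + h) - W z"
    and y: "- h < y"
  shows "hit_prob (\<nu> * h) h x n y
    \<le> ennreal (1 - W (x - y) / W x + 3 * \<nu>\<^sup>2 * h / (W x * (1 - \<nu> * \<beta>)) * (y + h) + \<nu> * h / W x)"
proof -
  define c where "c = 3 * \<nu>\<^sup>2 * h / (W x * (1 - \<nu> * \<beta>))"
  define d where "d = \<nu> * h / W x"
  have c: "0 \<le> c" using \<nu> h Wx by (simp add: c_def)
  have d: "0 \<le> d" using \<nu> h Wx by (simp add: d_def)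
  have W1: "\<bar>W z\<bar> \<le> 1" for z using W_bounds[of z] by simp
  have a: "0 < \<nu> * h" using \<nu> h by simp
  have eq: "1 - W (x - (y - h + s)) / W x + c * (y - h + s + h) + d
      = (1 + d) + (- (1 / W x)) * W (x - y + h - s) + c * (y + s)" for y s
    by (simp add: algebra_simps)
  have "hit_prob (\<nu> * h) h x n y \<le> ennreal (1 - W (x - y) / W x + c * (y + h) + d)"
  proof (rule hit_prob_le_supersolution[OF x, where u = "\<lambda>y. 1 - W (x - y) / W x + c * (y + h) + d"])
    show "(\<lambda>y. 1 - W (x - y) / W x + c * (y + h) + d) \<in> borel_measurable borel"
      using W_meas by measurable
  next
    fix y assume "0 < y" "y \<le> x"
    show "integrable (compound (\<nu> * h)) (\<lambda>s. 1 - W (x - (y - h + s)) / W x + c * (y - h + s + h) + d)"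
      unfolding eq by (rule integral_compound_affine(1)[OF a W_meas W1])
  next
    fix y assume y: "- h < y"
    show "0 \<le> 1 - W (x - y) / W x + c * (y + h) + d"
    proof (cases "x < y")
      case True
      then show ?thesis using c d y W_neg[of "x - y"] by simp
    next
      case False
      then have "W (x - y) \<le> W x + \<nu> * h" using growth[of "x - y"] y by simp
      then have "W (x - y) / W x \<le> 1 + d" using Wx by (simp add: d_def field_simps)
      moreover have "0 \<le> c * (y + h)" using c y by simp
      ultimately show ?thesis by linarith
    qed
  next
    fix y assume y: "x < y"
    then show "1 \<le> 1 - W (x - y) / W x + c * (y + h) + d"
      using c d x h W_neg[of "x - y"] by simp
  next
    fix y assume y: "0 < y" "y \<le> x"
    have "W (x - y) - 3 * \<nu>\<^sup>2 * h\<^sup>2 \<le> (\<integral>s. W (x - y + h - s) \<partial>compound (\<nu> * h))"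
      using one_step[OF \<nu>(1) h W_meas W1, of "x - y + h"] semi[of "x - y"] y by (simp add: abs_le_iff)
    then have "(1 / W x) * (W (x - y) - 3 * \<nu>\<^sup>2 * h\<^sup>2)
        \<le> (1 / W x) * (\<integral>s. W (x - y + h - s) \<partial>compound (\<nu> * h))"
      using Wx by (intro mult_left_mono) auto
    moreover have "c * (y + \<nu> * h * \<beta>) = c * (y + h) - 3 * \<nu>\<^sup>2 * h\<^sup>2 / W x"
    proof -
      have "c * (h * (1 - \<nu> * \<beta>)) = 3 * \<nu>\<^sup>2 * h\<^sup>2 / W x"
        using \<nu>(2) by (simp add: c_def power2_eq_square)
      then show ?thesis by (simp add: algebra_simps)
    qed
    ultimately show "(\<integral>s. 1 - W (x - (y - h + s)) / W x + c * (y - h + s + h) + d \<partial>compound (\<nu> * h))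
        \<le> 1 - W (x - y) / W x + c * (y + h) + d"
      unfolding eq integral_compound_affine(2)[OF a W_meas W1]
      by (simp add: algebra_simps diff_divide_distrib)
  qed (rule y)
  then show ?thesis by (simp only: c_def d_def)
qed

text \<open>
  The subharmonic function is \<open>1 - V (x - y) / V x\<close> minus the linear correction. Since \<open>(y + h) / h\<close> is
  at least one on \<open>(0, x]\<close> and shrinks in expectation by the factor \<open>1 - (1 - \<nu> * \<beta>) * h / (x + h)\<close>
  there, its multiple by the corresponding power bounds the probability of remaining in \<open>(0, x]\<close> for
  \<open>n\<close> steps. Here \<open>V\<close> may be positive somewhat below zero: this only lowers the value above \<open>x\<close>.
\<close>

lemma hit_prob_lower:
  fixes V :: "real \<Rightarrow> real"
  assumes \<nu>: "0 < \<nu>" "\<nu> * \<beta> < 1" and h: "0 < h" and x: "0 \<le> x" and K: "0 \<le> K"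
    and V_meas: "V \<in> borel_measurable borel" and V_mono: "mono V"
    and V_bounds: "\<And>z. 0 \<le> V z" "\<And>z. V z \<le> 1" and Vx: "0 < V x"
    and semi: "\<And>z. 0 \<le> z \<Longrightarrow> V (z + h) - V z \<le> h * drift \<nu> V (z + h) + K * h\<^sup>2"
    and y: "- h < y"
  shows "ennreal (1 - V (x - y) / V x - (K + 2 * \<nu>\<^sup>2) * h / (V x * (1 - \<nu> * \<beta>)) * (y + h)
      - (1 - (1 - \<nu> * \<beta>) * h / (x + h)) ^ n * ((y + h) / h))
    \<le> hit_prob (\<nu> * h) h x n y"
proof -
  define c where "c = (K + 2 * \<nu>\<^sup>2) * h / (V x * (1 - \<nu> * \<beta>))"
  define \<theta> where "\<theta> = 1 - (1 - \<nu> * \<beta>) * h / (x + h)"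
  have c: "0 \<le> c" using \<nu> h Vx K by (simp add: c_def)
  have \<theta>: "0 \<le> \<theta>"
  proof -
    have "(1 - \<nu> * \<beta>) * h \<le> 1 * h" using \<nu> h \<beta>_nonneg by (intro mult_right_mono) auto
    then have "(1 - \<nu> * \<beta>) * h \<le> x + h" using x by simp
    then show ?thesis using x h by (simp add: \<theta>_def field_simps)
  qed
  have V1: "\<bar>V z\<bar> \<le> 1" for z using V_bounds[of z] by simp
  have a: "0 < \<nu> * h" using \<nu> h by simp
  have eq: "1 - V (x - (y - h + s)) / V x - c * (y - h + s + h) - t * ((y - h + s + h) / h)
      = 1 + (- (1 / V x)) * V (x - y + h - s) + (- (c + t / h)) * (y + s)" for y s t
    by (simp add: algebra_simps add_divide_distrib)
  have "ennreal (1 - V (x - y) / V x - c * (y + h) - \<theta> ^ n * ((y + h) / h)) \<le> hit_prob (\<nu> * h) h x n y"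
  proof (rule hit_prob_ge_subsolution[OF x,
        where l = "\<lambda>n y. 1 - V (x - y) / V x - c * (y + h) - \<theta> ^ n * ((y + h) / h)"])
    fix n y assume "0 < y" "y \<le> x"
    show "integrable (compound (\<nu> * h)) (\<lambda>s. 1 - V (x - (y - h + s)) / V x - c * (y - h + s + h)
        - \<theta> ^ n * ((y - h + s + h) / h))"
      unfolding eq by (rule integral_compound_affine(1)[OF a V_meas V1])
  next
    fix n y assume y: "- h < y" "y \<le> 0"
    have "V x / V x \<le> V (x - y) / V x" using y Vx by (intro divide_right_mono monoD[OF V_mono]) auto
    then have "1 \<le> V (x - y) / V x" using Vx by simp
    moreover have "0 \<le> c * (y + h)" "0 \<le> \<theta> ^ n * ((y + h) / h)" using c \<theta> y h by auto
    ultimately show "1 - V (x - y) / V x - c * (y + h) - \<theta> ^ n * ((y + h) / h) \<le> 0"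
      by linarith
  next
    fix y assume y: "- h < y" "y \<le> x"
    have nonneg: "0 \<le> c * (y + h)" "0 \<le> (y + h) / h" "0 \<le> V (x - y) / V x"
      using c y h V_bounds Vx by auto
    show "1 - V (x - y) / V x - c * (y + h) - \<theta> ^ 0 * ((y + h) / h) \<le> 0"
    proof (cases "0 \<le> y")
      case True
      then have "1 \<le> (y + h) / h" using h by simp
      then show ?thesis using nonneg unfolding power_0 mult_1 by linarith
    next
      case False
      have "V x / V x \<le> V (x - y) / V x"
        using False Vx by (intro divide_right_mono monoD[OF V_mono]) auto
      then have "1 \<le> V (x - y) / V x" using Vx by simp
      then show ?thesis using nonneg unfolding power_0 mult_1 by linarith
    qed
  next
    fix n y assume y: "x < y"
    have "0 \<le> V (x - y) / V x" "0 \<le> c * (y + h)" "0 \<le> \<theta> ^ n * ((y + h) / h)"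
      using V_bounds Vx c \<theta> y h x by auto
    then show "1 - V (x - y) / V x - c * (y + h) - \<theta> ^ n * ((y + h) / h) \<le> 1" by linarith
  next
    fix n y assume y: "0 < y" "y \<le> x"
    have "(\<integral>s. V (x - y + h - s) \<partial>compound (\<nu> * h)) \<le> V (x - y) + (K + 2 * \<nu>\<^sup>2) * h\<^sup>2"
      using one_step[OF \<nu>(1) h V_meas V1, of "x - y + h"] semi[of "x - y"] y
      by (simp add: abs_le_iff algebra_simps)
    then have "(1 / V x) * (\<integral>s. V (x - y + h - s) \<partial>compound (\<nu> * h))
        \<le> (1 / V x) * (V (x - y) + (K + 2 * \<nu>\<^sup>2) * h\<^sup>2)"
      using Vx by (intro mult_left_mono) auto
    also have "\<dots> = V (x - y) / V x + (1 / V x) * ((K + 2 * \<nu>\<^sup>2) * h\<^sup>2)"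
      by (simp only: distrib_left) simp
    finally have "(1 / V x) * (\<integral>s. V (x - y + h - s) \<partial>compound (\<nu> * h))
        \<le> V (x - y) / V x + (1 / V x) * ((K + 2 * \<nu>\<^sup>2) * h\<^sup>2)" .
    moreover have "c * (y + \<nu> * h * \<beta>) = c * (y + h) - (1 / V x) * ((K + 2 * \<nu>\<^sup>2) * h\<^sup>2)"
    proof -
      have "c * (h * (1 - \<nu> * \<beta>)) = (1 / V x) * ((K + 2 * \<nu>\<^sup>2) * h\<^sup>2)"
        using \<nu>(2) by (simp add: c_def power2_eq_square)
      then show ?thesis by (simp add: algebra_simps)
    qed
    moreover have decay: "\<theta> ^ n * ((y + \<nu> * h * \<beta>) / h) \<le> \<theta> ^ Suc n * ((y + h) / h)"
    proof -
      have "(1 - \<nu> * \<beta>) * h * ((y + h) / (x + h)) \<le> (1 - \<nu> * \<beta>) * h * 1"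
        using y x h \<nu> by (intro mult_left_mono) auto
      then have "y + \<nu> * h * \<beta> \<le> \<theta> * (y + h)" by (simp add: \<theta>_def algebra_simps)
      then have "\<theta> ^ n * ((y + \<nu> * h * \<beta>) / h) \<le> \<theta> ^ n * (\<theta> * (y + h) / h)"
        using h \<theta> by (intro mult_left_mono divide_right_mono) auto
      then show ?thesis by (simp add: mult_ac)
    qed
    have split: "1 + - (1 / V x) * I + - (c + \<theta> ^ n / h) * Y
        = 1 - (1 / V x) * I - c * Y - \<theta> ^ n * (Y / h)" for I Y
      by (simp add: algebra_simps)
    ultimately have "1 - V (x - y) / V x - c * (y + h) - \<theta> ^ Suc n * ((y + h) / h)
      \<le> 1 + - (1 / V x) * (\<integral>s. V (x - y + h - s) \<partial>compound (\<nu> * h))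
        + - (c + \<theta> ^ n / h) * (y + \<nu> * h * \<beta>)"
      unfolding split using decay by linarith
    then show "1 - V (x - y) / V x - c * (y + h) - \<theta> ^ Suc n * ((y + h) / h)
      \<le> (\<integral>s. 1 - V (x - (y - h + s)) / V x - c * (y - h + s + h) - \<theta> ^ n * ((y - h + s + h) / h)
          \<partial>compound (\<nu> * h))"
      unfolding eq integral_compound_affine(2)[OF a V_meas V1] .
  qed (rule y)
  then show ?thesis by (simp only: c_def \<theta>_def)
qed

end

section \<open>From the path of the workload to its skeleton\<close>

definition walk :: "real \<Rightarrow> real \<Rightarrow> (nat \<Rightarrow> real) \<Rightarrow> (nat \<Rightarrow> nat) \<Rightarrow> nat \<Rightarrow> real" where
  "walk h y b c k = y + (\<Sum>i<(\<Sum>j<k. c j). b i) - real k * h"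

lemma sum_lessThan_plus:
  fixes m n :: nat
  shows "(\<Sum>i<m + n. b i) = (\<Sum>i<m. b i) + (\<Sum>i<n. b (i + m) :: real)"
  by (induction n) (auto simp: add_ac)

lemma walk_Suc:
  "walk h y b c (Suc k) = walk h (y - h + (\<Sum>i<c 0. b i)) (\<lambda>i. b (i + c 0)) (\<lambda>k. c (Suc k)) k"
  unfolding walk_def sum.lessThan_Suc_shift comp_def sum_lessThan_plus by (simp add: algebra_simps)

text \<open>
  \<^const>\<open>walk\<close> gives the position of the skeleton in closed form, which the path of the process
  determines directly.
\<close>

lemma hit_iff:
  "hit h x n y b c \<longleftrightarrow> (\<exists>k\<le>n. x < walk h y b c k \<and> (\<forall>j<k. 0 < walk h y b c j))"
proof (induction n arbitrary: y b c)
  case 0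
  then show ?case by (simp add: walk_def)
next
  case (Suc n)
  let ?y = "y - h + (\<Sum>i<c 0. b i)" and ?b = "\<lambda>i. b (i + c 0)" and ?c = "\<lambda>k. c (Suc k)"
  have w0: "walk h y b c 0 = y" by (simp add: walk_def)
  have "(\<exists>k\<le>Suc n. x < walk h y b c k \<and> (\<forall>j<k. 0 < walk h y b c j))
      \<longleftrightarrow> x < y \<or> (\<exists>k\<le>n. x < walk h y b c (Suc k) \<and> (\<forall>j<Suc k. 0 < walk h y b c j))"
  proof (intro iffI)
    assume "\<exists>k\<le>Suc n. x < walk h y b c k \<and> (\<forall>j<k. 0 < walk h y b c j)"
    then obtain k where k: "k \<le> Suc n" "x < walk h y b c k" "\<forall>j<k. 0 < walk h y b c j" by blast
    then show "x < y \<or> (\<exists>k\<le>n. x < walk h y b c (Suc k) \<and> (\<forall>j<Suc k. 0 < walk h y b c j))"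
      by (cases k) (auto simp: w0)
  next
    assume "x < y \<or> (\<exists>k\<le>n. x < walk h y b c (Suc k) \<and> (\<forall>j<Suc k. 0 < walk h y b c j))"
    then show "\<exists>k\<le>Suc n. x < walk h y b c k \<and> (\<forall>j<k. 0 < walk h y b c j)"
    proof
      assume "x < y"
      then show ?thesis by (intro exI[of _ 0]) (simp add: w0)
    next
      assume "\<exists>k\<le>n. x < walk h y b c (Suc k) \<and> (\<forall>j<Suc k. 0 < walk h y b c j)"
      then obtain k where "k \<le> n" "x < walk h y b c (Suc k) \<and> (\<forall>j<Suc k. 0 < walk h y b c j)"
        by blast
      then show ?thesis by (intro exI[of _ "Suc k"]) simp
    qed
  qed
  also have "\<dots> \<longleftrightarrow> hit h x (Suc n) y b c"
    unfolding hit.simps Suc.IH by (auto simp: All_less_Suc2 walk_Suc w0)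
  finally show ?case ..
qed

text \<open>
  The pathwise facts hold for each outcome with a regular path; \<open>X\<close> and \<open>\<tau>\<close> denote its workload and
  hitting time.
\<close>

locale workload_path =
  fixes b :: "nat \<Rightarrow> 'a \<Rightarrow> real" and N :: "real \<Rightarrow> 'a \<Rightarrow> nat" and \<rho> x :: real and \<omega> :: 'a
  assumes b_nonneg: "0 \<le> b i \<omega>"
    and N_0: "N 0 \<omega> = 0"
    and N_mono: "mono_on {0..} (\<lambda>t. N t \<omega>)"
    and N_right_cont: "0 \<le> t \<Longrightarrow> continuous (at_right t) (\<lambda>s. N s \<omega>)"
    and \<rho>_pos: "0 < \<rho>"
    and x_nonneg: "0 \<le> x"
begin

abbreviation X :: "real \<Rightarrow> real" where "X t \<equiv> workload b N \<rho> t \<omega>"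

abbreviation \<tau> :: ereal where "\<tau> \<equiv> hitting_time_zero b N \<rho> \<omega>"

lemma X_0: "0 \<le> X 0"
  by (simp add: workload_def N_0 b_nonneg)

lemma X_decrease_le:
  assumes "0 \<le> s" "s \<le> t"
  shows "X s - (t - s) \<le> X t"
proof -
  have "N (\<rho> * s) \<omega> \<le> N (\<rho> * t) \<omega>"
    using assms \<rho>_pos by (intro mono_onD[OF N_mono]) (auto intro: mult_left_mono)
  then have "(\<Sum>i=1..N (\<rho> * s) \<omega>. b i \<omega>) \<le> (\<Sum>i=1..N (\<rho> * t) \<omega>. b i \<omega>)"
    by (intro sum_mono2) (auto simp: b_nonneg)
  then show ?thesis by (simp add: workload_def)
qed

lemma X_right:
  assumes "0 \<le> t"
  shows "\<exists>d>0. \<forall>s. t \<le> s \<longrightarrow> s < t + d \<longrightarrow> X s = X t - (s - t)"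
proof -
  have "((\<lambda>s. N s \<omega>) \<longlongrightarrow> N (\<rho> * t) \<omega>) (at_right (\<rho> * t))"
    using N_right_cont[of "\<rho> * t"] assms \<rho>_pos by (simp add: continuous_within)
  then have "\<forall>\<^sub>F s in at_right (\<rho> * t). N s \<omega> = N (\<rho> * t) \<omega>"
    by (simp add: tendsto_discrete)
  then obtain u where u: "\<rho> * t < u" "\<And>s. \<rho> * t < s \<Longrightarrow> s < u \<Longrightarrow> N s \<omega> = N (\<rho> * t) \<omega>"
    by (auto simp: eventually_at_right_field)
  show ?thesis
  proof (intro exI[of _ "u / \<rho> - t"] conjI allI impI)
    show "0 < u / \<rho> - t" using u(1) \<rho>_pos by (simp add: field_simps)
    fix s assume s: "t \<le> s" "s < t + (u / \<rho> - t)"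
    have "N (\<rho> * s) \<omega> = N (\<rho> * t) \<omega>"
    proof (cases "s = t")
      case False
      then show ?thesis using s \<rho>_pos by (intro u(2)) (auto simp: field_simps)
    qed simp
    then show "X s = X t - (s - t)" by (simp add: workload_def)
  qed
qed

text \<open>
  The path has no downward jumps: at the infimum of the times at which it is nonpositive it is
  nonpositive by right continuity and cannot be negative, so it is zero there.
\<close>

lemma X_pos_before:
  assumes "0 \<le> s" "ereal s < \<tau>"
  shows "0 < X s"
proof (rule ccontr)
  assume "\<not> 0 < X s"
  define S where "S = {u. 0 \<le> u \<and> u \<le> s \<and> X u \<le> 0}"
  have sS: "s \<in> S" using assms \<open>\<not> 0 < X s\<close> by (simp add: S_def)
  have bdd: "bdd_below S" by (rule bdd_belowI[of _ 0]) (simp add: S_def)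
  define s0 where "s0 = Inf S"
  have s0: "0 \<le> s0" "s0 \<le> s"
    unfolding s0_def using sS bdd by (auto intro!: cInf_greatest cInf_lower simp: S_def)
  have before: "0 < X u" if "0 \<le> u" "u < s0" for u
  proof (rule ccontr)
    assume "\<not> 0 < X u"
    then have "u \<in> S" using that s0 by (simp add: S_def)
    then have "s0 \<le> u" unfolding s0_def by (rule cInf_lower[OF _ bdd])
    then show False using that by simp
  qed
  have le: "X s0 \<le> 0"
  proof (rule ccontr)
    assume pos: "\<not> X s0 \<le> 0"
    obtain d where d: "0 < d" "\<And>s. s0 \<le> s \<Longrightarrow> s < s0 + d \<Longrightarrow> X s = X s0 - (s - s0)"
      using X_right[OF s0(1)] by auto
    define e where "e = min d (X s0)"
    have e: "0 < e" using d(1) pos by (simp add: e_def)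
    have "s0 + e \<le> Inf S"
    proof (rule cInf_greatest)
      fix u assume u: "u \<in> S"
      then have "s0 \<le> u" unfolding s0_def by (rule cInf_lower[OF _ bdd])
      show "s0 + e \<le> u"
      proof (rule ccontr)
        assume "\<not> s0 + e \<le> u"
        then have "X u = X s0 - (u - s0)" using d(2)[of u] \<open>s0 \<le> u\<close> by (simp add: e_def)
        then have "0 < X u" using \<open>\<not> s0 + e \<le> u\<close> by (simp add: e_def)
        then show False using u by (simp add: S_def)
      qed
    qed (use sS in blast)
    then show False using e by (simp add: s0_def)
  qed
  have "X s0 = 0"
  proof (rule ccontr)
    assume "X s0 \<noteq> 0"
    with le have neg: "X s0 < 0" by simp
    then have "0 < s0" using X_0 s0(1) by (cases "s0 = 0") auto
    define u where "u = max 0 (s0 + X s0)"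
    have u: "0 \<le> u" "u < s0" "s0 - u \<le> - X s0" using neg \<open>0 < s0\<close> by (auto simp: u_def)
    have "X u - (s0 - u) \<le> X s0" using u by (intro X_decrease_le) auto
    then show False using before[OF u(1,2)] u(3) by simp
  qed
  then have "\<tau> \<le> ereal s0"
    unfolding hitting_time_zero_def using s0 by (intro INF_lower) auto
  also have "\<dots> \<le> ereal s" using s0 by simp
  finally show False using assms by simp
qed

text \<open>
  The infimum that defines the hitting time is attained, since immediately after \<open>T\<close> the path is a line
  of slope \<open>-1\<close> and can vanish there at most once.
\<close>

lemma X_at_hitting:
  assumes "\<tau> = ereal T"
  shows "0 \<le> T" "X T = 0"
proof -
  have "0 \<le> \<tau>" unfolding hitting_time_zero_def by (intro INF_greatest) auto
  then show T: "0 \<le> T" using assms by simp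
  obtain d where d: "0 < d" "\<And>s. T \<le> s \<Longrightarrow> s < T + d \<Longrightarrow> X s = X T - (s - T)"
    using X_right[OF T] by blast
  have "\<tau> < ereal (T + d)" using assms d(1) by simp
  then obtain z where z: "0 \<le> z" "X z = 0" "z < T + d"
    unfolding hitting_time_zero_def INF_less_iff by auto
  have lb: "T \<le> t" if "0 \<le> t" "X t = 0" for t
  proof -
    have "\<tau> \<le> ereal t" unfolding hitting_time_zero_def using that by (intro INF_lower) auto
    then show ?thesis using assms by simp
  qed
  have "ereal z \<le> \<tau>"
    unfolding hitting_time_zero_def
  proof (rule INF_greatest)
    fix t assume "t \<in> {t. 0 \<le> t \<and> X t = 0}"
    then have t: "0 \<le> t" "X t = 0" by auto
    show "ereal z \<le> ereal t"
      using d(2)[of t] d(2)[of z] lb[OF t] lb[OF z(1,2)] z t by (cases "t < T + d") auto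
  qed
  then have "z \<le> T" using assms by simp
  then have "z = T" using lb[OF z(1,2)] by simp
  then show "X T = 0" using z by simp
qed

definition skeleton_hits :: "real \<Rightarrow> bool" where
  "skeleton_hits h \<longleftrightarrow> (\<exists>k::nat. x < X (real k * h) \<and> (\<forall>j<k. 0 < X (real j * h)))"

lemma grid_point:
  assumes "0 \<le> t" "0 < h"
  obtains k :: nat where "t \<le> real k * h" "real k * h < t + h"
proof -
  define k where "k = nat \<lceil>t / h\<rceil>"
  have "0 \<le> t / h" using assms by simp
  then have "real k = of_int \<lceil>t / h\<rceil>" by (simp add: k_def)
  then have "t / h \<le> real k" "real k < t / h + 1" by linarith+
  then have "t \<le> real k * h" "real k * h < t + h"
    using assms by (simp_all add: pos_divide_le_eq field_simps)
  then show thesis by (rule that)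
qed

lemma cycle_max_gt_iff: "ereal x < cycle_max b N \<rho> \<omega> \<longleftrightarrow> (\<exists>t\<ge>0. ereal t \<le> \<tau> \<and> x < X t)"
  unfolding cycle_max_def less_SUP_iff by auto

text \<open>
  Right continuity keeps the path above \<open>x\<close> for a short time after an exceedance; a fine grid has a
  point there, and at all earlier grid points the path is positive.
\<close>

lemma skeleton_hits_of_cycle_max:
  assumes "ereal x < cycle_max b N \<rho> \<omega>"
  shows "\<forall>\<^sub>F h in at_right 0. skeleton_hits h"
proof -
  obtain t where t: "0 \<le> t" "ereal t \<le> \<tau>" "x < X t"
    using assms unfolding cycle_max_gt_iff by blast
  obtain d where d: "0 < d" "\<And>s. t \<le> s \<Longrightarrow> s < t + d \<Longrightarrow> X s = X t - (s - t)"
    using X_right[OF t(1)] by auto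
  define e where "e = min d (X t - x)"
  have e: "0 < e" using d(1) t(3) by (simp add: e_def)
  have after: "x < X s" if "t \<le> s" "s < t + e" for s
    using d(2)[of s] that by (simp add: e_def)
  have pos: "0 < X s" if "0 \<le> s" "s < t + e" for s
  proof (cases "s < t")
    case True
    then have "ereal s < ereal t" by simp
    also note t(2)
    finally have "ereal s < \<tau>" .
    then show ?thesis using X_pos_before that by blast
  next
    case False
    then show ?thesis using after[of s] that x_nonneg by simp
  qed
  have "skeleton_hits h" if h: "0 < h" "h < e" for h
  proof -
    obtain k :: nat where k: "t \<le> real k * h" "real k * h < t + h"
      by (rule grid_point[OF t(1) h(1)])
    have "0 < X (real j * h)" if "j < k" for j
    proof -
      have "real j * h \<le> real k * h" using that h by (intro mult_right_mono) auto
      then have "real j * h < t + e" using k h by linarith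
      then show ?thesis using h by (intro pos) auto
    qed
    moreover have "x < X (real k * h)" using k h by (intro after) auto
    ultimately show ?thesis unfolding skeleton_hits_def by blast
  qed
  then show ?thesis using e by (auto simp: eventually_at_right_field)
qed

text \<open>
  If the process reaches zero before exceeding \<open>x\<close>, it has no jump for a short time after \<open>\<tau>\<close> and is
  nonpositive there; a fine grid has a point in this interval and so does not miss the end of the cycle.
\<close>

lemma cycle_max_of_skeleton_hits:
  assumes "\<not> ereal x < cycle_max b N \<rho> \<omega>"
  shows "\<forall>\<^sub>F h in at_right 0. \<not> skeleton_hits h"
proof (cases "\<tau> = \<infinity>")
  case True
  then have "\<not> x < X t" if "0 \<le> t" for t
    using assms that unfolding cycle_max_gt_iff by auto
  then have "\<not> skeleton_hits h" if "0 < h" for h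
    using that unfolding skeleton_hits_def by auto
  then show ?thesis by (auto simp: eventually_at_right_field intro: exI[of _ 1])
next
  case False
  have "0 \<le> \<tau>" unfolding hitting_time_zero_def by (intro INF_greatest) auto
  then obtain T where T: "\<tau> = ereal T" using False by (cases \<tau>) auto
  note hit = X_at_hitting[OF T]
  obtain d where d: "0 < d" "\<And>s. T \<le> s \<Longrightarrow> s < T + d \<Longrightarrow> X s = X T - (s - T)"
    using X_right[OF hit(1)] by auto
  have "\<not> skeleton_hits h" if h: "0 < h" "h < d" for h
  proof
    assume "skeleton_hits h"
    then obtain k :: nat where k: "x < X (real k * h)" "\<And>j. j < k \<Longrightarrow> 0 < X (real j * h)"
      unfolding skeleton_hits_def by blast
    have late: "T < real k * h"
    proof (rule ccontr)
      assume "\<not> T < real k * h"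
      then have "ereal (real k * h) \<le> \<tau>" using T by simp
      then show False using assms k(1) h unfolding cycle_max_gt_iff by auto
    qed
    have "T + d \<le> real k * h"
    proof (rule ccontr)
      assume "\<not> T + d \<le> real k * h"
      then have "X (real k * h) = - (real k * h - T)" using d(2)[of "real k * h"] late hit by simp
      then show False using k(1) late x_nonneg by simp
    qed
    moreover obtain j :: nat where j: "T \<le> real j * h" "real j * h < T + h"
      by (rule grid_point[OF hit(1) h(1)])
    ultimately have "real j * h < real k * h" using h by linarith
    then have "j < k" using h by simp
    moreover have "X (real j * h) = - (real j * h - T)" using d(2)[of "real j * h"] j h hit by simp
    ultimately show False using k(2)[of j] j by simp
  qed
  then show ?thesis using d(1) by (auto simp: eventually_at_right_field)
qed

lemma skeleton_hits_iff_hit: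
  assumes "0 < h"
  shows "skeleton_hits h \<longleftrightarrow> (\<exists>n. hit h x n (b 0 \<omega>) (\<lambda>i. b (Suc i) \<omega>)
    (\<lambda>k. N (\<rho> * (real (Suc k) * h)) \<omega> - N (\<rho> * (real k * h)) \<omega>))"
proof -
  let ?c = "\<lambda>k. N (\<rho> * (real (Suc k) * h)) \<omega> - N (\<rho> * (real k * h)) \<omega>"
  have "(\<Sum>j<k. ?c j) = N (\<rho> * (real k * h)) \<omega>" for k
  proof (induction k)
    case (Suc k)
    have "N (\<rho> * (real k * h)) \<omega> \<le> N (\<rho> * (real (Suc k) * h)) \<omega>"
      using assms \<rho>_pos by (intro mono_onD[OF N_mono]) (auto intro!: mult_left_mono mult_right_mono)
    then show ?case using Suc by simp
  qed (simp add: N_0)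
  then have "walk h (b 0 \<omega>) (\<lambda>i. b (Suc i) \<omega>) ?c k = X (real k * h)" for k
    by (simp add: walk_def workload_def sum.atLeast1_atMost_eq)
  then show ?thesis unfolding hit_iff skeleton_hits_def by auto
qed

end

section \<open>The law of the skeleton\<close>

lemma measurable_diff_nat:
  fixes f g :: "'b \<Rightarrow> nat"
  assumes [measurable]: "f \<in> measurable M (count_space UNIV)" "g \<in> measurable M (count_space UNIV)"
  shows "(\<lambda>\<omega>. f \<omega> - g \<omega>) \<in> measurable M (count_space UNIV)"
  by measurable

lemma (in prob_space) indep_vars_nat_initial:
  fixes X :: "nat \<Rightarrow> 'a \<Rightarrow> 'b"
  assumes "\<And>n. indep_vars M' X {..<n}"
  shows "indep_vars M' X UNIV"
proof -
  have "indep_sets (\<lambda>i. {X i -` A \<inter> space M | A. A \<in> sets (M' i)}) J" if "finite J" for J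
  proof -
    obtain n where "J \<subseteq> {..<n}" using \<open>finite J\<close> finite_nat_iff_bounded by blast
    then show ?thesis
      using assms[of n] unfolding indep_vars_def2 by (blast intro: indep_sets_mono_index)
  qed
  moreover have "random_variable (M' i) (X i)" for i
    using assms[of "Suc i"] unfolding indep_vars_def2 by auto
  ultimately show ?thesis
    unfolding indep_vars_def2 by (subst indep_sets_finite_index_sets) auto
qed

locale queue = prob_space M for M :: "'a measure" +
  fixes B :: "'a \<Rightarrow> real" and Bs :: "nat \<Rightarrow> 'a \<Rightarrow> real" and N :: "real \<Rightarrow> 'a \<Rightarrow> nat"
  assumes B_measurable [measurable]: "B \<in> borel_measurable M"
    and Bs_indep: "indep_vars (\<lambda>_. borel) Bs UNIV"
    and Bs_distr: "distr M borel (Bs i) = distr M borel B"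
    and B_nonneg: "\<omega> \<in> space M \<Longrightarrow> 0 \<le> B \<omega>"
    and Bs_nonneg: "\<omega> \<in> space M \<Longrightarrow> 0 \<le> Bs i \<omega>"
    and B_positive: "prob {\<omega> \<in> space M. B \<omega> \<le> 0} = 0"
    and B_integrable: "integrable M B"
    and B_mean_pos: "0 < expectation B"
    and B_square_integrable: "integrable M (\<lambda>\<omega>. (B \<omega>)\<^sup>2)"
    and N_poisson: "poisson_process (1 / expectation B) N"
    and Bs_N_indep: "indep_elements (Pi\<^sub>M UNIV (\<lambda>_::nat. borel)) (\<lambda>\<omega> i. Bs i \<omega>)
        (Pi\<^sub>M {0..} (\<lambda>_::real. count_space UNIV)) (\<lambda>\<omega>. \<lambda>t\<in>{0..}. N t \<omega>)"
begin

sublocale jumps: jump_law "distr M borel B" "expectation B"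
proof -
  interpret D: prob_space "distr M borel B" by (rule prob_space_distr) measurable
  show "jump_law (distr M borel B) (expectation B)"
  proof
    show "AE b in distr M borel B. 0 \<le> b"
      by (subst AE_distr_iff) (auto simp: B_nonneg intro: AE_I2)
    show "integrable (distr M borel B) (\<lambda>b. b)"
      by (subst integrable_distr_eq) (auto simp: B_integrable)
    show "expectation B = (\<integral>b. b \<partial>distr M borel B)"
      by (subst integral_distr) auto
  qed simp
qed

definition counts :: "real \<Rightarrow> 'a \<Rightarrow> nat \<Rightarrow> nat" where
  "counts h \<omega> k = N (real (Suc k) * h) \<omega> - N (real k * h) \<omega>"

lemma N_measurable: "0 \<le> t \<Longrightarrow> N t \<in> measurable M (count_space UNIV)"
  using N_poisson unfolding poisson_process_def by blast

lemma counts_measurable: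
  assumes "0 < h"
  shows "(\<lambda>\<omega>. counts h \<omega> k) \<in> measurable M (count_space UNIV)"
proof -
  have [measurable]: "N (real (Suc k) * h) \<in> measurable M (count_space UNIV)"
    "N (real k * h) \<in> measurable M (count_space UNIV)"
    using assms by (auto intro!: N_measurable)
  show ?thesis unfolding counts_def by measurable
qed

lemma distr_counts:
  assumes h: "0 < h"
  shows "distr M nat_seqs (counts h) = jumps.Counts (1 / expectation B * h)"
proof -
  have "indep_vars (\<lambda>_. count_space UNIV) (\<lambda>k \<omega>. counts h \<omega> k) {..<n}" for n
  proof -
    have "\<forall>(n::nat) ts. 0 \<le> ts 0 \<and> (\<forall>i<n. ts i < ts (Suc i)) \<longrightarrow>
        indep_vars (\<lambda>_. count_space UNIV) (\<lambda>i \<omega>. N (ts (Suc i)) \<omega> - N (ts i) \<omega>) {..<n}"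
      by (rule N_poisson[unfolded poisson_process_def, THEN conjunct2, THEN conjunct2, THEN conjunct2])
    from this[rule_format, of "\<lambda>i. real i * h" n] show ?thesis
      unfolding counts_def using h by simp
  qed
  then have "indep_vars (\<lambda>_. count_space UNIV) (\<lambda>k \<omega>. counts h \<omega> k) UNIV"
    by (rule indep_vars_nat_initial)
  then have "distr M nat_seqs (\<lambda>\<omega>. \<lambda>k\<in>UNIV. counts h \<omega> k)
      = Pi\<^sub>M UNIV (\<lambda>k. distr M (count_space UNIV) (\<lambda>\<omega>. counts h \<omega> k))"
    using counts_measurable[OF h] by (subst (asm) indep_vars_iff_distr_eq_PiM) auto
  moreover have "distr M (count_space UNIV) (\<lambda>\<omega>. counts h \<omega> k)
      = measure_pmf (poisson_pmf (1 / expectation B * h))" for k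
  proof -
    have "0 \<le> real k * h \<and> real k * h < real (Suc k) * h" using h by simp
    then have "distr M (count_space UNIV) (\<lambda>\<omega>. N (real (Suc k) * h) \<omega> - N (real k * h) \<omega>)
        = measure_pmf (poisson_pmf (1 / expectation B * (real (Suc k) * h - real k * h)))"
      by (rule N_poisson[unfolded poisson_process_def, THEN conjunct2, THEN conjunct2, THEN conjunct1,
          rule_format])
    moreover have "real (Suc k) * h - real k * h = h" by (simp add: algebra_simps)
    ultimately show ?thesis unfolding counts_def by (simp only:)
  qed
  ultimately show ?thesis by (simp add: restrict_def)
qed

lemma Bs_measurable: "(\<lambda>\<omega> i. Bs i \<omega>) \<in> measurable M real_seqs"
  using Bs_N_indep unfolding indep_elements_def by blast

lemma distr_Bs: "distr M real_seqs (\<lambda>\<omega> i. Bs i \<omega>) = jumps.Jumps"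
proof -
  have "Bs i \<in> borel_measurable M" for i
    using Bs_indep unfolding indep_vars_def2 by auto
  then have "distr M real_seqs (\<lambda>\<omega>. \<lambda>i\<in>UNIV. Bs i \<omega>) = Pi\<^sub>M UNIV (\<lambda>i. distr M borel (Bs i))"
    using Bs_indep by (subst (asm) indep_vars_iff_distr_eq_PiM) auto
  then show ?thesis by (simp add: Bs_distr restrict_def)
qed

lemma counts_seq_measurable:
  assumes "0 < h"
  shows "counts h \<in> measurable M nat_seqs"
proof -
  have "(\<lambda>\<omega> k. counts h \<omega> k) \<in> measurable M nat_seqs"
    by (intro measurable_abs_UNIV counts_measurable assms)
  then show ?thesis by simp
qed

text \<open>
  Rectangles generate the product \<open>\<sigma>\<close>-algebra, and the counts are a measurable function of the path of
  \<open>N\<close>, so the assumed independence of the generated \<open>\<sigma>\<close>-algebras determines the joint law.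
\<close>

lemma distr_joint:
  assumes h: "0 < h"
  shows "distr M (real_seqs \<Otimes>\<^sub>M nat_seqs) (\<lambda>\<omega>. (\<lambda>i. Bs i \<omega>, counts h \<omega>))
    = jumps.Jumps \<Otimes>\<^sub>M jumps.Counts (1 / expectation B * h)"
proof (rule sym, rule pair_measure_eqI)
  let ?X = "\<lambda>\<omega> i. Bs i \<omega>" and ?Y = "\<lambda>\<omega>. \<lambda>t\<in>{0..}. N t \<omega>"
  let ?T = "Pi\<^sub>M {0..} (\<lambda>_::real. count_space (UNIV :: nat set))"
  let ?G = "\<lambda>n k. n (real (Suc k) * h) - n (real k * h) :: nat"
  interpret counts: sequence_space "measure_pmf (poisson_pmf (1 / expectation B * h))" by unfold_locales
  show "sigma_finite_measure jumps.Jumps" by unfold_locales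
  show "sigma_finite_measure (jumps.Counts (1 / expectation B * h))" by unfold_locales
  show "sets (jumps.Jumps \<Otimes>\<^sub>M jumps.Counts (1 / expectation B * h))
      = sets (distr M (real_seqs \<Otimes>\<^sub>M nat_seqs) (\<lambda>\<omega>. (\<lambda>i. Bs i \<omega>, counts h \<omega>)))"
    by (simp only: sets_distr) (intro sets_pair_measure_cong jumps.sets_Jumps jumps.sets_Counts)
  have X: "?X \<in> measurable M real_seqs" and Y: "?Y \<in> measurable M ?T"
    and indep: "indep_set (sets (vimage_algebra (space M) ?X real_seqs)) (sets (vimage_algebra (space M) ?Y ?T))"
    using Bs_N_indep unfolding indep_elements_def by auto
  have G: "?G \<in> measurable ?T nat_seqs"
  proof (rule measurable_abs_UNIV)
    fix k
    show "(\<lambda>n. n (real (Suc k) * h) - n (real k * h)) \<in> measurable ?T (count_space UNIV)"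
      using h by (intro measurable_diff_nat measurable_component_singleton) auto
  qed
  have counts_eq: "counts h \<omega> = ?G (?Y \<omega>)" for \<omega>
    using h by (auto simp: counts_def fun_eq_iff)
  fix A C assume "A \<in> sets jumps.Jumps" "C \<in> sets (jumps.Counts (1 / expectation B * h))"
  then have A: "A \<in> sets real_seqs" and C: "C \<in> sets nat_seqs"
    by (auto simp: jumps.sets_Jumps jumps.sets_Counts)
  have evA: "?X -` A \<inter> space M \<in> sets (vimage_algebra (space M) ?X real_seqs)"
    by (rule in_vimage_algebra[OF A])
  have "?G -` C \<inter> space ?T \<in> sets ?T" using G C by (rule measurable_sets)
  from in_vimage_algebra[OF this, of ?Y "space M"]
  have evC: "counts h -` C \<inter> space M \<in> sets (vimage_algebra (space M) ?Y ?T)"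
  proof -
    have "?Y -` (?G -` C \<inter> space ?T) \<inter> space M = counts h -` C \<inter> space M"
      using measurable_space[OF Y] by (auto simp: counts_eq)
    then show ?thesis using in_vimage_algebra[OF \<open>?G -` C \<inter> space ?T \<in> sets ?T\<close>, of ?Y "space M"]
      by (simp only:)
  qed
  have "emeasure jumps.Jumps A * emeasure (jumps.Counts (1 / expectation B * h)) C
      = emeasure M (?X -` A \<inter> space M) * emeasure M (counts h -` C \<inter> space M)"
    unfolding distr_Bs[symmetric] distr_counts[OF h, symmetric]
    using A C X counts_seq_measurable[OF h] by (simp add: emeasure_distr)
  also have "\<dots> = ennreal (prob (?X -` A \<inter> space M) * prob (counts h -` C \<inter> space M))"
    by (simp add: emeasure_eq_measure ennreal_mult)
  also have "\<dots> = ennreal (prob ((?X -` A \<inter> space M) \<inter> (counts h -` C \<inter> space M)))"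
    using indep_setD[OF indep evA evC] by simp
  also have "(?X -` A \<inter> space M) \<inter> (counts h -` C \<inter> space M)
      = (\<lambda>\<omega>. (?X \<omega>, counts h \<omega>)) -` (A \<times> C) \<inter> space M"
    by auto
  also have "ennreal (prob \<dots>)
      = emeasure (distr M (real_seqs \<Otimes>\<^sub>M nat_seqs) (\<lambda>\<omega>. (\<lambda>i. Bs i \<omega>, counts h \<omega>))) (A \<times> C)"
    using A C X counts_seq_measurable[OF h]
    by (subst emeasure_distr) (auto simp: emeasure_eq_measure)
  finally show "emeasure jumps.Jumps A * emeasure (jumps.Counts (1 / expectation B * h)) C
      = emeasure (distr M (real_seqs \<Otimes>\<^sub>M nat_seqs) (\<lambda>\<omega>. (\<lambda>i. Bs i \<omega>, counts h \<omega>))) (A \<times> C)" .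
qed

definition hit_event :: "real \<Rightarrow> real \<Rightarrow> real \<Rightarrow> nat \<Rightarrow> 'a set" where
  "hit_event \<rho> h x n = {\<omega> \<in> space M. hit h x n (Bs 0 \<omega>) (\<lambda>i. Bs (Suc i) \<omega>) (counts (\<rho> * h) \<omega>)}"

lemma hit_event_sets:
  assumes "0 < \<rho>" "0 < h"
  shows "hit_event \<rho> h x n \<in> sets M"
proof -
  have [measurable]: "counts (\<rho> * h) \<in> measurable M nat_seqs"
    using assms by (intro counts_seq_measurable) simp
  have B [measurable]: "Bs i \<in> borel_measurable M" for i
    using Bs_indep unfolding indep_vars_def2 by auto
  have [measurable]: "(\<lambda>\<omega> i. Bs (Suc i) \<omega>) \<in> measurable M real_seqs"
    by (intro measurable_abs_UNIV B)
  show ?thesis unfolding hit_event_def by measurable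
qed

lemma emeasure_hit_event:
  assumes \<rho>: "0 < \<rho>" and h: "0 < h"
  shows "emeasure M (hit_event \<rho> h x n)
    = (\<integral>\<^sup>+b. jumps.hit_prob (\<rho> / expectation B * h) h x n b \<partial>distr M borel B)"
proof -
  define a where "a = \<rho> / expectation B * h"
  have \<rho>h: "0 < \<rho> * h" using \<rho> h by simp
  have a: "1 / expectation B * (\<rho> * h) = a" by (simp add: a_def)
  interpret counts: sequence_space "measure_pmf (poisson_pmf a)" by unfold_locales
  interpret JC: pair_sigma_finite jumps.Jumps "jumps.Counts a" by unfold_locales
  interpret DC: pair_sigma_finite "distr M borel B" "jumps.Counts a" by unfold_locales
  let ?F = "\<lambda>(b, c). jumps.hit_indicator h x n (b 0) (\<lambda>i. b (Suc i)) c"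
  have F: "?F \<in> borel_measurable (real_seqs \<Otimes>\<^sub>M nat_seqs)"
  proof -
    have [measurable]: "(\<lambda>z i. fst z (Suc i)) \<in> measurable (real_seqs \<Otimes>\<^sub>M nat_seqs) real_seqs"
      by (rule measurable_abs_UNIV) measurable
    show ?thesis unfolding split_beta' by measurable
  qed
  have "emeasure M (hit_event \<rho> h x n) = (\<integral>\<^sup>+\<omega>. indicator (hit_event \<rho> h x n) \<omega> \<partial>M)"
    using hit_event_sets[OF \<rho> h] by simp
  also have "\<dots> = (\<integral>\<^sup>+\<omega>. ?F (\<lambda>i. Bs i \<omega>, counts (\<rho> * h) \<omega>) \<partial>M)"
    by (intro nn_integral_cong) (auto simp: hit_event_def jumps.hit_indicator_def)
  also have "\<dots> = (\<integral>\<^sup>+z. ?F z \<partial>distr M (real_seqs \<Otimes>\<^sub>M nat_seqs) (\<lambda>\<omega>. (\<lambda>i. Bs i \<omega>, counts (\<rho> * h) \<omega>)))"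
    using F Bs_measurable counts_seq_measurable[OF \<rho>h] by (subst nn_integral_distr) auto
  also have "\<dots> = (\<integral>\<^sup>+z. ?F z \<partial>(jumps.Jumps \<Otimes>\<^sub>M jumps.Counts a))"
    unfolding distr_joint[OF \<rho>h] a ..
  also have "\<dots> = (\<integral>\<^sup>+c. \<integral>\<^sup>+b. ?F (b, c) \<partial>jumps.Jumps \<partial>jumps.Counts a)"
  proof -
    have "?F \<in> borel_measurable (jumps.Jumps \<Otimes>\<^sub>M jumps.Counts a)"
      using F by (subst measurable_cong_sets[OF sets_pair_measure_cong[OF jumps.sets_Jumps jumps.sets_Counts] refl])
    from JC.nn_integral_snd[OF this] show ?thesis ..
  qed
  also have "\<dots> = (\<integral>\<^sup>+c. \<integral>\<^sup>+y. \<integral>\<^sup>+b. jumps.hit_indicator h x n y b c \<partial>jumps.Jumps \<partial>distr M borel B \<partial>jumps.Counts a)"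
  proof (rule nn_integral_cong)
    fix c :: "nat \<Rightarrow> nat"
    have c: "c \<in> space nat_seqs" by (simp add: space_PiM)
    have "(\<lambda>b. ?F (b, c)) \<in> borel_measurable jumps.Jumps"
    proof -
      have "(\<lambda>b. b 0) \<in> borel_measurable jumps.Jumps" by measurable
      moreover have "(\<lambda>b i. b (Suc i)) \<in> measurable jumps.Jumps real_seqs"
        by (rule measurable_abs_UNIV) measurable
      moreover have "(\<lambda>b. c) \<in> measurable jumps.Jumps nat_seqs" by (rule measurable_const[OF c])
      ultimately show ?thesis unfolding prod.case by (rule jumps.measurable_hit_indicator)
    qed
    from jumps.seq.nn_integral_iter[OF this]
    show "(\<integral>\<^sup>+b. ?F (b, c) \<partial>jumps.Jumps) = (\<integral>\<^sup>+y. \<integral>\<^sup>+b. jumps.hit_indicator h x n y b c \<partial>jumps.Jumps \<partial>distr M borel B)"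
      by simp
  qed
  also have "\<dots> = (\<integral>\<^sup>+y. \<integral>\<^sup>+c. \<integral>\<^sup>+b. jumps.hit_indicator h x n y b c \<partial>jumps.Jumps \<partial>jumps.Counts a \<partial>distr M borel B)"
    by (rule DC.Fubini') measurable
  finally show ?thesis unfolding jumps.hit_prob_def a_def .
qed

lemma hit_event_mono: "m \<le> n \<Longrightarrow> hit_event \<rho> h x m \<subseteq> hit_event \<rho> h x n"
  unfolding hit_event_def hit_iff by auto (meson order.trans)

lemma workload_path_on_space:
  assumes "\<omega> \<in> space M" "0 < \<rho>" "0 \<le> x"
  shows "workload_path Bs N \<rho> x \<omega>"
  using N_poisson assms Bs_nonneg unfolding poisson_process_def workload_path_def by blast

lemma cycle_max_eventually_iff:
  assumes \<omega>: "\<omega> \<in> space M" and \<rho>: "0 < \<rho>" and x: "0 \<le> x"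
  shows "\<forall>\<^sub>F h in at_right 0. \<omega> \<in> (\<Union>n. hit_event \<rho> h x n) \<longleftrightarrow> ereal x < cycle_max Bs N \<rho> \<omega>"
proof -
  interpret workload_path Bs N \<rho> x \<omega> by (rule workload_path_on_space[OF assms])
  have "\<forall>\<^sub>F h in at_right 0. 0 < (h::real)" by (auto simp: eventually_at_right_less)
  moreover have "\<forall>\<^sub>F h in at_right 0. skeleton_hits h \<longleftrightarrow> ereal x < cycle_max Bs N \<rho> \<omega>"
  proof (cases "ereal x < cycle_max Bs N \<rho> \<omega>")
    case True
    from skeleton_hits_of_cycle_max[OF this] show ?thesis by eventually_elim (simp add: True)
  next
    case False
    from cycle_max_of_skeleton_hits[OF this] show ?thesis by eventually_elim (simp add: False)
  qed
  ultimately show ?thesis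
  proof eventually_elim
    case (elim h)
    have "counts (\<rho> * h) \<omega> = (\<lambda>k. N (\<rho> * (real (Suc k) * h)) \<omega> - N (\<rho> * (real k * h)) \<omega>)"
      by (auto simp: counts_def mult_ac)
    then show ?case
      using elim skeleton_hits_iff_hit[of h] \<omega> by (simp add: hit_event_def)
  qed
qed

text \<open>
  The indicator of exceedance is the pointwise limit of the indicators of the skeleton events. This
  also proves that exceedance is an event, although hitting time and supremum range over uncountable
  sets.
\<close>

lemma prob_hits_tendsto:
  assumes \<rho>: "0 < \<rho>" and x: "0 \<le> x"
  shows "(\<lambda>j. prob (\<Union>n. hit_event \<rho> (1 / real (Suc j)) x n))
    \<longlonglongrightarrow> prob {\<omega> \<in> space M. ereal x < cycle_max Bs N \<rho> \<omega>}"
proof -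
  let ?A = "{\<omega> \<in> space M. ereal x < cycle_max Bs N \<rho> \<omega>}"
  let ?E = "\<lambda>j. \<Union>n. hit_event \<rho> (1 / real (Suc j)) x n"
  have E: "?E j \<in> sets M" for j by (intro sets.countable_nat_UN image_subsetI hit_event_sets \<rho>) simp
  have lim: "(\<lambda>j. indicator (?E j) \<omega> :: real) \<longlonglongrightarrow> indicator ?A \<omega>" if \<omega>: "\<omega> \<in> space M" for \<omega>
  proof (rule tendsto_eventually)
    have "filterlim (\<lambda>j. 1 / real (Suc j)) (at_right 0) sequentially"
      by real_asymp
    from eventually_compose_filterlim[OF cycle_max_eventually_iff[OF \<omega> \<rho> x] this]
    show "\<forall>\<^sub>F j in sequentially. indicator (?E j) \<omega> = (indicator ?A \<omega> :: real)"
      by eventually_elim (use \<omega> in \<open>auto simp: indicator_def\<close>)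
  qed
  have A: "?A \<in> sets M"
  proof -
    have "(indicator ?A :: 'a \<Rightarrow> real) \<in> borel_measurable M"
      by (rule borel_measurable_LIMSEQ_real[OF lim]) (use E in measurable)
    from borel_measurable_indicator_iff[THEN iffD1, OF this] show ?thesis by (simp add: Int_def conj_commute cong: conj_cong)
  qed
  have "(\<lambda>j. \<integral>\<omega>. indicator (?E j) \<omega> \<partial>M) \<longlonglongrightarrow> (\<integral>\<omega>. indicator ?A \<omega> \<partial>M :: real)"
  proof (rule integral_dominated_convergence[where w = "\<lambda>_. 1"])
    show "(indicator ?A :: 'a \<Rightarrow> real) \<in> borel_measurable M" using A by simp
    show "(indicator (?E j) :: 'a \<Rightarrow> real) \<in> borel_measurable M" for j using E[of j] by simp
    show "AE \<omega> in M. (\<lambda>j. indicator (?E j) \<omega> :: real) \<longlonglongrightarrow> indicator ?A \<omega>"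
      by (rule AE_I2) (rule lim)
  qed (auto simp: indicator_def)
  then show ?thesis using E A by (simp add: sets.Int_space_eq2)
qed

end

section \<open>The scale function\<close>

context queue
begin

definition tail :: "real \<Rightarrow> real" where
  "tail u = prob {\<omega> \<in> space M. u < B \<omega>}"

text \<open>
  The density of the integrated tail law of the jumps.
\<close>

definition excess :: "real \<Rightarrow> real" where
  "excess u = (if u < 0 then 0 else tail u / expectation B)"

lemma tail_decreasing: "u \<le> v \<Longrightarrow> tail v \<le> tail u"
  unfolding tail_def by (intro finite_measure_mono) auto

lemma tail_bounds: "0 \<le> tail u" "tail u \<le> 1"
  by (auto simp: tail_def)

lemma tail_0: "tail 0 = 1"
proof -
  have "prob (space M - {\<omega> \<in> space M. B \<omega> \<le> 0}) = 1 - prob {\<omega> \<in> space M. B \<omega> \<le> 0}"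
    by (rule prob_compl) measurable
  moreover have "space M - {\<omega> \<in> space M. B \<omega> \<le> 0} = {\<omega> \<in> space M. 0 < B \<omega>}" by auto
  ultimately show ?thesis by (simp add: tail_def B_positive)
qed

lemma tail_measurable [measurable]: "tail \<in> borel_measurable borel"
proof -
  have "mono (\<lambda>u. - tail u)" by (rule monoI) (simp add: tail_decreasing)
  then have "(\<lambda>u. - tail u) \<in> borel_measurable borel" by (rule borel_measurable_mono)
  then show ?thesis by (simp add: borel_measurable_uminus_eq)
qed

lemma excess_measurable [measurable]: "excess \<in> borel_measurable borel"
  unfolding excess_def[abs_def] by measurable

lemma ennreal_tail: "ennreal (tail u) = (\<integral>\<^sup>+\<omega>. indicator {u<..} (B \<omega>) \<partial>M)"
proof -
  have "(\<integral>\<^sup>+\<omega>. indicator {u<..} (B \<omega>) \<partial>M) = (\<integral>\<^sup>+\<omega>. indicator {\<omega> \<in> space M. u < B \<omega>} \<omega> \<partial>M)"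
    by (intro nn_integral_cong) (auto simp: indicator_def)
  also have "\<dots> = emeasure M {\<omega> \<in> space M. u < B \<omega>}" by simp
  finally show ?thesis by (simp add: tail_def emeasure_eq_measure)
qed

text \<open>
  Tonelli for the indicator of \<open>u < B \<omega>\<close>.
\<close>

lemma nn_integral_excess:
  assumes [measurable]: "\<phi> \<in> borel_measurable borel"
  shows "(\<integral>\<^sup>+u. \<phi> u * ennreal (excess u) \<partial>lborel)
    = ennreal (1 / expectation B) * (\<integral>\<^sup>+\<omega>. \<integral>\<^sup>+u. \<phi> u * indicator {0..<B \<omega>} u \<partial>lborel \<partial>M)"
proof -
  interpret L: pair_sigma_finite M lborel by unfold_locales
  have [measurable]: "(\<lambda>(\<omega>, u). \<phi> u * indicator {0..<B \<omega>} u) \<in> borel_measurable (M \<Otimes>\<^sub>M lborel)"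
  proof -
    have "(\<lambda>(\<omega>, u). \<phi> u * indicator {0..<B \<omega>} u) = (\<lambda>(\<omega>, u). \<phi> u * (if 0 \<le> u \<and> u < B \<omega> then 1 else 0))"
      by (auto simp: fun_eq_iff indicator_def)
    then show ?thesis by simp
  qed
  have "(\<integral>\<^sup>+\<omega>. \<integral>\<^sup>+u. \<phi> u * indicator {0..<B \<omega>} u \<partial>lborel \<partial>M)
      = (\<integral>\<^sup>+u. \<integral>\<^sup>+\<omega>. \<phi> u * indicator {0..<B \<omega>} u \<partial>M \<partial>lborel)"
    by (rule L.Fubini'[symmetric]) measurable
  also have "\<dots> = (\<integral>\<^sup>+u. \<phi> u * (indicator {0..} u * ennreal (tail u)) \<partial>lborel)"
  proof (rule nn_integral_cong)
    fix u :: real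
    have "(\<integral>\<^sup>+\<omega>. \<phi> u * indicator {0..<B \<omega>} u \<partial>M)
        = (\<integral>\<^sup>+\<omega>. (\<phi> u * indicator {0..} u) * indicator {u<..} (B \<omega>) \<partial>M)"
      by (intro nn_integral_cong) (auto simp: indicator_def)
    also have "\<dots> = \<phi> u * (indicator {0..} u * ennreal (tail u))"
      by (simp add: nn_integral_cmult ennreal_tail mult.assoc)
    finally show "(\<integral>\<^sup>+\<omega>. \<phi> u * indicator {0..<B \<omega>} u \<partial>M) = \<phi> u * (indicator {0..} u * ennreal (tail u))" .
  qed
  finally have "ennreal (1 / expectation B) * (\<integral>\<^sup>+\<omega>. \<integral>\<^sup>+u. \<phi> u * indicator {0..<B \<omega>} u \<partial>lborel \<partial>M)
      = (\<integral>\<^sup>+u. ennreal (1 / expectation B) * (\<phi> u * (indicator {0..} u * ennreal (tail u))) \<partial>lborel)"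
    by (simp add: nn_integral_cmult)
  also have "\<dots> = (\<integral>\<^sup>+u. \<phi> u * ennreal (excess u) \<partial>lborel)"
  proof (rule nn_integral_cong)
    fix u :: real
    show "ennreal (1 / expectation B) * (\<phi> u * (indicator {0..} u * ennreal (tail u))) = \<phi> u * ennreal (excess u)"
    proof (cases "u < 0")
      case False
      have "ennreal (excess u) = ennreal (1 / expectation B) * ennreal (tail u)"
        using False B_mean_pos tail_bounds[of u] by (simp add: excess_def flip: ennreal_mult)
      then show ?thesis using False by (simp add: mult_ac)
    qed (simp add: excess_def)
  qed
  finally show ?thesis ..
qed

definition mean_excess :: real where
  "mean_excess = (\<integral>\<omega>. (B \<omega>)\<^sup>2 \<partial>M) / (2 * expectation B)"

lemma nn_integral_indicator_id:
  assumes "0 \<le> c"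
  shows "(\<integral>\<^sup>+u. ennreal u * indicator {0..<c} u \<partial>lborel) = ennreal (c\<^sup>2 / 2)"
proof -
  have "(\<integral>\<^sup>+u. ennreal u * indicator {0..<c} u \<partial>lborel) = (\<integral>\<^sup>+u. ennreal u * indicator {0..c} u \<partial>lborel)"
    using AE_lborel_singleton[of c]
    by (intro nn_integral_cong_AE) (auto elim!: eventually_mono simp: indicator_def)
  also have "\<dots> = ennreal (c\<^sup>2 / 2 - 0\<^sup>2 / 2)"
  proof (rule nn_integral_FTC_Icc[where F = "\<lambda>u. u\<^sup>2 / 2"])
    show "((\<lambda>u. u\<^sup>2 / 2) has_real_derivative u) (at u)" for u :: real
      by (auto intro!: derivative_eq_intros)
  qed (use assms in auto)
  finally show ?thesis by simp
qed

sublocale dens: decreasing_density excess mean_excess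
proof
  show "0 \<le> excess x" for x using tail_bounds B_mean_pos by (simp add: excess_def)
  show "excess x = 0" if "x < 0" for x using that by (simp add: excess_def)
  show "excess y \<le> excess x" if "0 \<le> x" "x \<le> y" for x y
    using that tail_decreasing B_mean_pos by (auto simp: excess_def intro!: divide_right_mono)
  have "(\<integral>\<^sup>+u. 1 * ennreal (excess u) \<partial>lborel)
      = ennreal (1 / expectation B) * (\<integral>\<^sup>+\<omega>. \<integral>\<^sup>+u. 1 * indicator {0..<B \<omega>} u \<partial>lborel \<partial>M)"
    by (rule nn_integral_excess) simp
  also have "(\<integral>\<^sup>+\<omega>. \<integral>\<^sup>+u. 1 * indicator {0..<B \<omega>} u \<partial>lborel \<partial>M) = (\<integral>\<^sup>+\<omega>. ennreal (B \<omega>) \<partial>M)"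
    by (intro nn_integral_cong) (simp add: B_nonneg)
  also have "\<dots> = ennreal (expectation B)"
    by (intro nn_integral_eq_integral B_integrable AE_I2 B_nonneg)
  finally show "(\<integral>\<^sup>+u. ennreal (excess u) \<partial>lborel) = 1"
    using B_mean_pos by (simp flip: ennreal_mult)
  have "(\<integral>\<^sup>+u. ennreal u * ennreal (excess u) \<partial>lborel)
      = ennreal (1 / expectation B) * (\<integral>\<^sup>+\<omega>. \<integral>\<^sup>+u. ennreal u * indicator {0..<B \<omega>} u \<partial>lborel \<partial>M)"
    by (rule nn_integral_excess) simp
  also have "(\<integral>\<^sup>+\<omega>. \<integral>\<^sup>+u. ennreal u * indicator {0..<B \<omega>} u \<partial>lborel \<partial>M) = (\<integral>\<^sup>+\<omega>. ennreal ((B \<omega>)\<^sup>2 / 2) \<partial>M)"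
    by (intro nn_integral_cong nn_integral_indicator_id B_nonneg)
  also have "\<dots> = ennreal (\<integral>\<omega>. (B \<omega>)\<^sup>2 / 2 \<partial>M)"
    using B_square_integrable by (intro nn_integral_eq_integral) auto
  also have "ennreal (1 / expectation B) * \<dots> = ennreal mean_excess"
    using B_mean_pos by (simp add: mean_excess_def flip: ennreal_mult')
  finally show "(\<integral>\<^sup>+u. ennreal u * ennreal (excess u) \<partial>lborel) = ennreal mean_excess" .
  show "0 \<le> mean_excess" using B_mean_pos by (simp add: mean_excess_def)
qed measurable

end

locale stable_queue = queue +
  fixes \<rho> :: real
  assumes \<rho>_pos: "0 < \<rho>" and \<rho>_less_1: "\<rho> < 1"
begin

definition rate :: real where "rate = \<rho> / expectation B"

abbreviation w :: "real \<Rightarrow> real" where "w \<equiv> dens.w \<rho>"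

text \<open>
  The Pollaczek--Khinchine distribution function: an atom \<open>1 - \<rho>\<close> at zero and the density \<open>w\<close> on the
  positive half-line. Up to a factor it is the scale function of the workload process.
\<close>

definition W :: "real \<Rightarrow> real" where
  "W z = (if z < 0 then 0 else (1 - \<rho>) + (\<integral>u. w u * indicator {..z} u \<partial>lborel))"

lemma measure_D_UNIV: "measure (distr M borel B) UNIV = 1"
  using jumps.prob_space by simp

lemma rate_pos: "0 < rate"
  using \<rho>_pos B_mean_pos by (simp add: rate_def)

lemma rate_times_mean: "rate * expectation B = \<rho>"
  using B_mean_pos by (simp add: rate_def)

lemma \<rho>_excess_0: "\<rho> * excess 0 = rate"
  by (simp add: excess_def tail_0 rate_def)

lemma w_le_rate: "w z \<le> rate"
  using dens.w_le[OF \<rho>_pos \<rho>_less_1] by (simp add: \<rho>_excess_0)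

lemma w_integrable: "integrable lborel w"
  using dens.nn_integral_w[OF \<rho>_pos \<rho>_less_1] dens.w_nonneg
  by (intro integrableI_nonneg) auto

lemma integral_w: "(\<integral>u. w u \<partial>lborel) = \<rho>"
  using dens.nn_integral_w[OF \<rho>_pos \<rho>_less_1] dens.w_nonneg \<rho>_pos
  by (subst integral_eq_nn_integral) auto

lemma w_indicator_integrable: "A \<in> sets borel \<Longrightarrow> integrable lborel (\<lambda>u. w u * indicator A u)"
  using integrable_mult_indicator[of A lborel w] w_integrable by (simp add: mult.commute)

lemma W_diff:
  assumes "0 \<le> z" "z \<le> z'"
  shows "W z' - W z = (\<integral>u. w u * indicator {z<..z'} u \<partial>lborel)"
proof -
  have "(\<integral>u. w u * indicator {..z'} u \<partial>lborel)
      = (\<integral>u. w u * indicator {..z} u + w u * indicator {z<..z'} u \<partial>lborel)"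
    using assms by (intro Bochner_Integration.integral_cong) (auto simp: indicator_def)
  also have "\<dots> = (\<integral>u. w u * indicator {..z} u \<partial>lborel) + (\<integral>u. w u * indicator {z<..z'} u \<partial>lborel)"
    by (intro Bochner_Integration.integral_add w_indicator_integrable) auto
  finally show ?thesis using assms by (simp add: W_def)
qed

lemma W_ge:
  assumes "0 \<le> z"
  shows "1 - \<rho> \<le> W z"
  using assms dens.w_nonneg by (simp add: W_def integral_nonneg_AE)

lemma W_mono: "mono W"
proof (rule monoI)
  fix y z :: real assume "y \<le> z"
  show "W y \<le> W z"
  proof (cases "0 \<le> y")
    case True
    then have "W z - W y = (\<integral>u. w u * indicator {y<..z} u \<partial>lborel)" using \<open>y \<le> z\<close> by (rule W_diff)
    also have "\<dots> \<ge> 0" using dens.w_nonneg by (intro integral_nonneg_AE) auto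
    finally show ?thesis by simp
  next
    case False
    then show ?thesis using W_ge[of z] \<rho>_less_1 by (cases "0 \<le> z") (auto simp: W_def)
  qed
qed

lemma W_measurable [measurable]: "W \<in> borel_measurable borel"
  by (rule borel_measurable_mono[OF W_mono])

lemma W_neg: "z < 0 \<Longrightarrow> W z = 0"
  by (simp add: W_def)

lemma W_pos: "0 \<le> z \<Longrightarrow> 0 < W z"
  using W_ge[of z] \<rho>_less_1 by simp

lemma W_bounds: "0 \<le> W z" "W z \<le> 1"
proof -
  show "0 \<le> W z" using W_pos[of z] by (cases "0 \<le> z") (auto simp: W_def)
  have "(\<integral>u. w u * indicator {..z} u \<partial>lborel) \<le> (\<integral>u. w u \<partial>lborel)"
    using dens.w_nonneg by (intro integral_mono w_integrable w_indicator_integrable) (auto simp: indicator_def)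
  then show "W z \<le> 1" using \<rho>_less_1 by (simp add: W_def integral_w)
qed

lemma W_growth:
  assumes "0 \<le> z" "z \<le> z'"
  shows "W z' \<le> W z + rate * (z' - z)"
proof -
  have "W z' - W z \<le> (\<integral>u. rate * indicator {z<..z'} u \<partial>lborel)"
    unfolding W_diff[OF assms]
  proof (rule integral_mono)
    show "integrable lborel (\<lambda>u. w u * indicator {z<..z'} u)"
      by (rule w_indicator_integrable) simp
    show "w u * indicator {z<..z'} u \<le> rate * indicator {z<..z'} u" for u
      by (intro mult_right_mono w_le_rate) auto
    show "integrable lborel (\<lambda>u. rate * indicator {z<..z'} u)"
      using assms by (intro integrable_mult_right integrable_real_indicator) auto
  qed
  then show ?thesis using assms by simp
qed

text \<open>
  In \<open>w_renewal\<close> the first term decreases. In the convolution, replacing \<open>v\<close> by \<open>z\<close> decreases the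
  integrand except for \<open>u\<close> in \<open>(v, z]\<close>, where it is at most \<open>excess 0 * rate\<close>. Thus \<open>w\<close> has no upward
  jumps, although it has downward ones at the atoms of \<open>B\<close>.
\<close>

lemma w_almost_decreasing:
  assumes "0 \<le> v" "v \<le> z"
  shows "w z \<le> w v + rate\<^sup>2 * (z - v)"
proof -
  note \<rho> = \<rho>_pos \<rho>_less_1
  let ?I = "\<lambda>y. \<integral>\<^sup>+u. ennreal (excess (y - u)) * ennreal (w u) \<partial>lborel"
  have "?I z \<le> (\<integral>\<^sup>+u. ennreal (excess (v - u)) * ennreal (w u)
      + ennreal (excess 0 * rate) * indicator {v<..z} u \<partial>lborel)"
  proof (rule nn_integral_mono)
    fix u
    consider "u < 0" | "0 \<le> u" "u \<le> v" | "v < u" "u \<le> z" | "z < u" by linarith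
    then show "ennreal (excess (z - u)) * ennreal (w u)
      \<le> ennreal (excess (v - u)) * ennreal (w u) + ennreal (excess 0 * rate) * indicator {v<..z} u"
    proof cases
      case 1 then show ?thesis by (simp add: dens.w_neg)
    next
      case 2
      then have "excess (z - u) \<le> excess (v - u)" using assms by (intro dens.f_decreasing) auto
      then show ?thesis using 2 by (auto intro!: mult_right_mono ennreal_leI)
    next
      case 3
      have "excess (z - u) * w u \<le> excess 0 * rate"
        using dens.w_nonneg dens.f_nonneg by (intro mult_mono dens.f_le w_le_rate) auto
      then have "ennreal (excess (z - u)) * ennreal (w u) \<le> ennreal (excess 0 * rate)"
        using dens.f_nonneg dens.w_nonneg by (simp add: ennreal_leI flip: ennreal_mult)
      then show ?thesis using 3 by (simp add: add_increasing)
    next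
      case 4 then show ?thesis by (simp add: excess_def)
    qed
  qed
  also have "\<dots> = ?I v + ennreal (excess 0 * rate) * ennreal (z - v)"
    using assms by (simp add: nn_integral_add nn_integral_cmult)
  finally have I: "?I z \<le> ?I v + ennreal (excess 0 * rate * (z - v))"
    using assms rate_pos dens.f_nonneg[of 0] by (simp add: ennreal_mult)
  have "ennreal (w z) \<le> ennreal (\<rho> * (1 - \<rho>) * excess v) + ennreal \<rho> * (?I v + ennreal (excess 0 * rate * (z - v)))"
    unfolding dens.w_renewal[OF \<rho>, of z]
    using \<rho> assms dens.f_decreasing[of v z] by (intro add_mono ennreal_leI mult_left_mono I) auto
  also have "\<dots> = ennreal (w v) + ennreal (\<rho> * (excess 0 * rate * (z - v)))"
    unfolding dens.w_renewal[OF \<rho>, of v] using \<rho> by (simp add: distrib_left add.assoc flip: ennreal_mult')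
  also have "\<rho> * (excess 0 * rate * (z - v)) = rate\<^sup>2 * (z - v)"
    unfolding power2_eq_square \<rho>_excess_0[symmetric] by (simp only: mult_ac)
  also have "ennreal (w v) + ennreal (rate\<^sup>2 * (z - v)) = ennreal (w v + rate\<^sup>2 * (z - v))"
    using assms dens.w_nonneg by simp
  finally show ?thesis using assms dens.w_nonneg by (subst (asm) ennreal_le_iff) auto
qed

text \<open>
  The scale function equation. The increment \<open>W z - W (z - b)\<close> collects the atom at zero if \<open>b > z\<close> and
  the mass of \<open>w\<close> on \<open>(z - b, z]\<close>; integrating over \<open>b\<close> turns the indicator of \<open>b > z - u\<close> into the tail
  of \<open>B\<close>, and the result is the right-hand side of the renewal equation.
\<close>

lemma drift_W:
  assumes z: "0 \<le> z"
  shows "jumps.drift rate W z = w z"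
proof -
  note \<rho> = \<rho>_pos \<rho>_less_1
  let ?D = "distr M borel B"
  interpret DL: pair_sigma_finite ?D lborel by unfold_locales
  have W1: "integrable ?D (\<lambda>b. W (z - b))"
    using W_bounds by (intro jumps.integrable_const_bound[where B = 1]) auto
  have W_diff_nonneg: "AE b in ?D. 0 \<le> W z - W (z - b)"
    using jumps.D_nonneg by eventually_elim (simp add: monoD[OF W_mono])
  have diff: "ennreal (W z - W (z - b)) = ennreal (1 - \<rho>) * indicator {z<..} b
      + (\<integral>\<^sup>+u. ennreal (w u) * indicator {..z} u * indicator {z - u<..} b \<partial>lborel)" if b: "0 \<le> b" for b
  proof (cases "z < b")
    case True
    have "(\<integral>\<^sup>+u. ennreal (w u) * indicator {..z} u * indicator {z - u<..} b \<partial>lborel)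
        = (\<integral>\<^sup>+u. ennreal (w u * indicator {..z} u) \<partial>lborel)"
      using True by (intro nn_integral_cong) (auto simp: indicator_def dens.w_neg)
    also have "\<dots> = ennreal (\<integral>u. w u * indicator {..z} u \<partial>lborel)"
      using dens.w_nonneg by (intro nn_integral_eq_integral w_indicator_integrable) auto
    finally show ?thesis
      using True z \<rho> dens.w_nonneg by (simp add: W_def integral_nonneg_AE)
  next
    case False
    have "(\<integral>\<^sup>+u. ennreal (w u) * indicator {..z} u * indicator {z - u<..} b \<partial>lborel)
        = (\<integral>\<^sup>+u. ennreal (w u * indicator {z - b<..z} u) \<partial>lborel)"
      by (intro nn_integral_cong) (auto simp: indicator_def)
    also have "\<dots> = ennreal (\<integral>u. w u * indicator {z - b<..z} u \<partial>lborel)"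
      using dens.w_nonneg by (intro nn_integral_eq_integral w_indicator_integrable) auto
    finally show ?thesis using False W_diff[of "z - b" z] b by simp
  qed
  have tail_D: "(\<integral>\<^sup>+b. indicator {v<..} b \<partial>?D) = ennreal (tail v)" for v
    unfolding ennreal_tail by (rule nn_integral_distr) auto
  have meas: "(\<lambda>(b, u). ennreal (w u) * indicator {..z} u * indicator {z - u<..} b)
      \<in> borel_measurable (?D \<Otimes>\<^sub>M lborel)"
  proof -
    have "(\<lambda>(b, u). ennreal (w u) * indicator {..z} u * indicator {z - u<..} b)
        = (\<lambda>(b, u). ennreal (w u) * indicator {..z} u * (if z - u < b then 1 else 0))"
      by (auto simp: fun_eq_iff indicator_def)
    then show ?thesis by simp
  qed
  have "ennreal (\<integral>b. W z - W (z - b) \<partial>?D) = (\<integral>\<^sup>+b. ennreal (W z - W (z - b)) \<partial>?D)"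
    using W1 by (intro nn_integral_eq_integral[symmetric] W_diff_nonneg Bochner_Integration.integrable_diff) auto
  also have "\<dots> = (\<integral>\<^sup>+b. ennreal (1 - \<rho>) * indicator {z<..} b
      + (\<integral>\<^sup>+u. ennreal (w u) * indicator {..z} u * indicator {z - u<..} b \<partial>lborel) \<partial>?D)"
    using jumps.D_nonneg diff by (intro nn_integral_cong_AE) (auto elim!: eventually_mono)
  also have "\<dots> = ennreal (1 - \<rho>) * ennreal (tail z)
      + (\<integral>\<^sup>+b. \<integral>\<^sup>+u. ennreal (w u) * indicator {..z} u * indicator {z - u<..} b \<partial>lborel \<partial>?D)"
    using lborel.borel_measurable_nn_integral[OF meas]
    by (subst nn_integral_add) (auto simp: nn_integral_cmult tail_D)
  also have "(\<integral>\<^sup>+b. \<integral>\<^sup>+u. ennreal (w u) * indicator {..z} u * indicator {z - u<..} b \<partial>lborel \<partial>?D)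
      = (\<integral>\<^sup>+u. \<integral>\<^sup>+b. ennreal (w u) * indicator {..z} u * indicator {z - u<..} b \<partial>?D \<partial>lborel)"
    by (rule DL.Fubini'[symmetric]) (rule meas)
  also have "\<dots> = (\<integral>\<^sup>+u. ennreal (expectation B) * (ennreal (excess (z - u)) * ennreal (w u)) \<partial>lborel)"
  proof (rule nn_integral_cong)
    fix u
    have "(\<integral>\<^sup>+b. ennreal (w u) * indicator {..z} u * indicator {z - u<..} b \<partial>?D)
        = ennreal (w u) * indicator {..z} u * ennreal (tail (z - u))"
      by (simp add: nn_integral_cmult tail_D)
    also have "\<dots> = ennreal (expectation B) * (ennreal (excess (z - u)) * ennreal (w u))"
    proof (cases "u \<le> z")
      case True
      then have "ennreal (expectation B) * ennreal (excess (z - u)) = ennreal (tail (z - u))"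
        using B_mean_pos True by (simp add: excess_def flip: ennreal_mult')
      then show ?thesis unfolding mult.assoc[symmetric] using True by (simp add: mult.commute)
    qed (simp add: excess_def)
    finally show "(\<integral>\<^sup>+b. ennreal (w u) * indicator {..z} u * indicator {z - u<..} b \<partial>?D)
        = ennreal (expectation B) * (ennreal (excess (z - u)) * ennreal (w u))" .
  qed
  also have "\<dots> = ennreal (expectation B) * (\<integral>\<^sup>+u. ennreal (excess (z - u)) * ennreal (w u) \<partial>lborel)"
  proof (rule nn_integral_cmult)
    have "(\<lambda>u. excess (z - u)) \<in> borel_measurable borel"
      by (rule measurable_compose[OF _ excess_measurable]) simp
    then show "(\<lambda>u. ennreal (excess (z - u)) * ennreal (w u)) \<in> borel_measurable lborel" by simp
  qed
  finally have eq: "ennreal (\<integral>b. W z - W (z - b) \<partial>?D) = ennreal (1 - \<rho>) * ennreal (tail z)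
      + ennreal (expectation B) * (\<integral>\<^sup>+u. ennreal (excess (z - u)) * ennreal (w u) \<partial>lborel)" .
  have "ennreal (rate * (\<integral>b. W z - W (z - b) \<partial>?D)) = ennreal rate * (ennreal (1 - \<rho>) * ennreal (tail z)
      + ennreal (expectation B) * (\<integral>\<^sup>+u. ennreal (excess (z - u)) * ennreal (w u) \<partial>lborel))"
    using rate_pos by (simp add: ennreal_mult' eq)
  also have "\<dots> = ennreal rate * (ennreal (1 - \<rho>) * ennreal (tail z))
      + (ennreal rate * ennreal (expectation B)) * (\<integral>\<^sup>+u. ennreal (excess (z - u)) * ennreal (w u) \<partial>lborel)"
    by (simp only: distrib_left mult.assoc)
  also have "\<dots> = ennreal (w z)"
  proof -
    have "ennreal rate * ennreal (expectation B) = ennreal \<rho>"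
      using rate_pos B_mean_pos by (simp add: rate_times_mean flip: ennreal_mult)
    moreover have "ennreal rate * (ennreal (1 - \<rho>) * ennreal (tail z)) = ennreal (\<rho> * (1 - \<rho>) * excess z)"
      using rate_pos \<rho> tail_bounds[of z] z
      by (simp add: rate_def excess_def mult_ac flip: ennreal_mult)
    ultimately show ?thesis unfolding dens.w_renewal[OF \<rho>, of z] by (simp only:)
  qed
  finally have "rate * (\<integral>b. W z - W (z - b) \<partial>?D) = w z"
    using rate_pos dens.w_nonneg integral_nonneg_AE[OF W_diff_nonneg] by (subst (asm) ennreal_inj) auto
  then show ?thesis
    using W1 by (simp add: jumps.drift_def measure_D_UNIV)
qed

end

section \<open>The exact law of the cycle maximum\<close>

context stable_queue
begin

text \<open>
  The uniform law on \<open>[0, \<delta>]\<close>.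
\<close>

definition avg :: "real \<Rightarrow> real measure" where
  "avg \<delta> = density lborel (\<lambda>s. ennreal (indicator {0..\<delta>} s / \<delta>))"

text \<open>
  Averaging over a short interval to the right keeps the scale function equation on the nonnegative half-line
  and makes the derivative Lipschitz continuous, also if \<open>B\<close> has atoms. This yields the inequality of
  \<open>hit_prob_lower\<close> that \<open>W\<close> itself may violate.
\<close>

definition V :: "real \<Rightarrow> real \<Rightarrow> real" where
  "V \<delta> z = (\<integral>s. W (z + s) \<partial>avg \<delta>)"

lemma sets_avg [simp, measurable_cong]: "sets (avg \<delta>) = sets borel"
  by (simp add: avg_def)

lemma measurable_avg [simp]: "measurable (avg \<delta>) A = measurable borel A"
  by (intro measurable_cong_sets) auto

lemma integral_avg:
  assumes "0 < \<delta>" and [measurable]: "g \<in> borel_measurable borel"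
  shows "(\<integral>s. g s \<partial>avg \<delta>) = (\<integral>s. indicator {0..\<delta>} s * g s \<partial>lborel) / \<delta>"
  unfolding avg_def using assms
  by (subst integral_density) (auto simp: divide_simps simp flip: integral_divide_zero)

lemma prob_space_avg:
  assumes "0 < \<delta>"
  shows "prob_space (avg \<delta>)"
proof
  have "emeasure (avg \<delta>) (space (avg \<delta>)) = (\<integral>\<^sup>+s. ennreal (1 / \<delta>) * indicator {0..\<delta>} s \<partial>lborel)"
    unfolding avg_def using assms
    by (subst emeasure_density) (auto intro!: nn_integral_cong simp: indicator_def)
  also have "\<dots> = 1"
    using assms by (simp add: nn_integral_cmult flip: ennreal_mult)
  finally show "emeasure (avg \<delta>) (space (avg \<delta>)) = 1" .
qed

lemma AE_avg:
  assumes "0 < \<delta>"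
  shows "AE s in avg \<delta>. 0 \<le> s \<and> s \<le> \<delta>"
  unfolding avg_def by (subst AE_density) (auto simp: indicator_def intro!: AE_I2)

lemma integrable_avg:
  fixes g :: "real \<Rightarrow> real"
  assumes "0 < \<delta>" "g \<in> borel_measurable borel" "\<And>s. \<bar>g s\<bar> \<le> C"
  shows "integrable (avg \<delta>) g"
proof -
  interpret U: prob_space "avg \<delta>" by (rule prob_space_avg) fact
  show ?thesis using assms by (intro U.integrable_const_bound[where B = C] AE_I2) auto
qed

lemma W_shift_integrable: "0 < \<delta> \<Longrightarrow> integrable (avg \<delta>) (\<lambda>s. W (z + s))"
  using W_bounds by (intro integrable_avg[where C = 1]) auto

lemma V_bounds:
  assumes \<delta>: "0 < \<delta>"
  shows "W z \<le> V \<delta> z" "V \<delta> z \<le> W (z + \<delta>)"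
proof -
  interpret U: prob_space "avg \<delta>" by (rule prob_space_avg[OF \<delta>])
  have "AE s in avg \<delta>. W z \<le> W (z + s)" "AE s in avg \<delta>. W (z + s) \<le> W (z + \<delta>)"
    by (rule eventually_mono[OF AE_avg[OF \<delta>]]; auto intro: monoD[OF W_mono])+
  then show "W z \<le> V \<delta> z" "V \<delta> z \<le> W (z + \<delta>)"
    unfolding V_def by (auto intro!: U.integral_ge_const U.integral_le_const W_shift_integrable \<delta>)
qed

lemma V_mono: "0 < \<delta> \<Longrightarrow> mono (V \<delta>)"
  unfolding V_def by (intro monoI integral_mono W_shift_integrable) (auto intro: monoD[OF W_mono])

lemma V_measurable: "0 < \<delta> \<Longrightarrow> V \<delta> \<in> borel_measurable borel"
  by (intro borel_measurable_mono V_mono)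

lemma drift_V:
  assumes \<delta>: "0 < \<delta>" and z: "0 \<le> z"
  shows "jumps.drift rate (V \<delta>) z = (W (z + \<delta>) - W z) / \<delta>"
proof -
  let ?D = "distr M borel B"
  interpret U: prob_space "avg \<delta>" by (rule prob_space_avg[OF \<delta>])
  interpret DU: pair_prob_space ?D "avg \<delta>" by unfold_locales
  have sets_D_avg: "sets (?D \<Otimes>\<^sub>M avg \<delta>) = sets (borel \<Otimes>\<^sub>M borel)"
    by (intro sets_pair_measure_cong) auto
  have meas: "(\<lambda>(b, s). W (z - b + s)) \<in> borel_measurable (?D \<Otimes>\<^sub>M avg \<delta>)"
    unfolding measurable_cong_sets[OF sets_D_avg refl] by measurable
  have int: "integrable (?D \<Otimes>\<^sub>M avg \<delta>) (\<lambda>(b, s). W (z - b + s))"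
    by (rule DU.P.integrable_const_bound[where B = 1, OF _ meas]) (auto simp: W_bounds)
  have swap: "(\<integral>b. V \<delta> (z - b) \<partial>?D) = (\<integral>s. \<integral>b. W (z + s - b) \<partial>?D \<partial>avg \<delta>)"
    unfolding V_def using DU.Fubini_integral[OF int] by (simp add: algebra_simps)
  have int2: "integrable (avg \<delta>) (\<lambda>s. \<integral>b. W (z + s - b) \<partial>?D)"
    using DU.integrable_snd[OF int] by (simp add: algebra_simps)
  have "jumps.drift rate (V \<delta>) z = (\<integral>s. jumps.drift rate W (z + s) \<partial>avg \<delta>)"
    unfolding jumps.drift_def swap unfolding V_def
    using int2 W_shift_integrable[OF \<delta>, of z] by simp
  also have "\<dots> = (\<integral>s. w (z + s) \<partial>avg \<delta>)"
  proof (rule integral_cong_AE)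
    show "(\<lambda>s. jumps.drift rate W (z + s)) \<in> borel_measurable (avg \<delta>)"
      unfolding jumps.drift_def using borel_measurable_integrable[OF int2] by simp
    show "AE s in avg \<delta>. jumps.drift rate W (z + s) = w (z + s)"
      using AE_avg[OF \<delta>] by eventually_elim (use z drift_W in auto)
  qed simp
  also have "\<dots> = (\<integral>s. indicator {0..\<delta>} s * w (z + s) \<partial>lborel) / \<delta>"
    by (rule integral_avg[OF \<delta>]) simp
  also have "(\<integral>s. indicator {0..\<delta>} s * w (z + s) \<partial>lborel) = (\<integral>u. w u * indicator {z..z + \<delta>} u \<partial>lborel)"
    by (subst lborel_integral_real_affine[where c = 1 and t = z])
       (auto intro!: Bochner_Integration.integral_cong simp: indicator_def)
  also have "\<dots> = (\<integral>u. w u * indicator {z<..z + \<delta>} u \<partial>lborel)"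
    using AE_lborel_singleton[of z]
    by (intro integral_cong_AE) (auto elim!: eventually_mono simp: indicator_def)
  also have "\<dots> = W (z + \<delta>) - W z"
    using \<delta> z by (intro W_diff[symmetric]) auto
  finally show ?thesis .
qed

text \<open>
  After translation the two averages differ only in windows of length \<open>h\<close> at the two ends of the interval.
\<close>

lemma V_increment:
  assumes \<delta>: "0 < \<delta>" and h: "0 < h" and z: "0 \<le> z"
  shows "V \<delta> (z + h) - V \<delta> z \<le> h * jumps.drift rate (V \<delta>) (z + h) + rate / \<delta> * h\<^sup>2"
proof -
  have int: "integrable lborel (\<lambda>t. indicator A t * W (z + t))"
    if "A \<in> sets borel" "emeasure lborel A < \<infinity>" for A
  proof (rule Bochner_Integration.integrable_bound)
    show "integrable lborel (indicator A :: real \<Rightarrow> real)" using that by simp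
    show "(\<lambda>t. indicator A t * W (z + t)) \<in> borel_measurable lborel" using that by simp
    show "AE t in lborel. norm (indicator A t * W (z + t)) \<le> norm (indicator A t :: real)"
      using W_bounds by (intro AE_I2) (auto simp: indicator_def)
  qed
  have "V \<delta> (z + h) = (\<integral>s. indicator {0..\<delta>} s * W (z + h + s) \<partial>lborel) / \<delta>"
    unfolding V_def by (rule integral_avg[OF \<delta>]) simp
  also have "(\<integral>s. indicator {0..\<delta>} s * W (z + h + s) \<partial>lborel) = (\<integral>t. indicator {h..\<delta> + h} t * W (z + t) \<partial>lborel)"
    by (subst (2) lborel_integral_real_affine[where c = 1 and t = h])
       (auto intro!: Bochner_Integration.integral_cong simp: indicator_def add_ac)
  finally have V1: "\<delta> * V \<delta> (z + h) = (\<integral>t. indicator {h..\<delta> + h} t * W (z + t) \<partial>lborel)"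
    using \<delta> by simp
  have V0: "\<delta> * V \<delta> z = (\<integral>t. indicator {0..\<delta>} t * W (z + t) \<partial>lborel)"
    unfolding V_def using \<delta> by (subst integral_avg[OF \<delta>]) auto
  have "\<delta> * (V \<delta> (z + h) - V \<delta> z)
      = (\<integral>t. indicator {h..\<delta> + h} t * W (z + t) - indicator {0..\<delta>} t * W (z + t) \<partial>lborel)"
    unfolding right_diff_distrib V1 V0 using \<delta> h
    by (intro Bochner_Integration.integral_diff[symmetric] int) auto
  also have "\<dots> \<le> (\<integral>t. W (z + h + \<delta>) * indicator {\<delta><..\<delta> + h} t - W z * indicator {0..<h} t \<partial>lborel)"
  proof (rule integral_mono)
    show "integrable lborel (\<lambda>t. indicator {h..\<delta> + h} t * W (z + t) - indicator {0..\<delta>} t * W (z + t))"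
      using \<delta> h by (intro Bochner_Integration.integrable_diff int) auto
    show "integrable lborel (\<lambda>t. W (z + h + \<delta>) * indicator {\<delta><..\<delta> + h} t - W z * indicator {0..<h} t)"
      using \<delta> h by (intro Bochner_Integration.integrable_diff integrable_mult_right integrable_real_indicator) auto
    fix t :: real
    have up: "W (z + t) \<le> W (z + h + \<delta>)" if "t \<le> \<delta> + h" using that by (intro monoD[OF W_mono]) simp
    have down: "W z \<le> W (z + t)" if "0 \<le> t" using that by (intro monoD[OF W_mono]) simp
    show "indicator {h..\<delta> + h} t * W (z + t) - indicator {0..\<delta>} t * W (z + t)
        \<le> W (z + h + \<delta>) * indicator {\<delta><..\<delta> + h} t - W z * indicator {0..<h} t"
      using up down \<delta> h by (auto simp: indicator_def)
  qed
  also have "\<dots> = h * W (z + h + \<delta>) - h * W z"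
    using \<delta> h by (subst Bochner_Integration.integral_diff) (auto simp: integrable_real_indicator)
  also have "\<dots> \<le> h * (W (z + h + \<delta>) - W (z + h) + rate * h)"
  proof -
    have "h * W (z + h) \<le> h * (W z + rate * h)"
      using W_growth[of z "z + h"] z h by (intro mult_left_mono) auto
    then show ?thesis by (simp add: algebra_simps)
  qed
  finally have "V \<delta> (z + h) - V \<delta> z \<le> h * (W (z + h + \<delta>) - W (z + h) + rate * h) / \<delta>"
    using \<delta> by (simp add: field_simps)
  also have "\<dots> = h * jumps.drift rate (V \<delta>) (z + h) + rate / \<delta> * h\<^sup>2"
  proof -
    have "0 \<le> z + h" using z h by simp
    then show ?thesis
      unfolding drift_V[OF \<delta> \<open>0 \<le> z + h\<close>] using \<delta> by (simp add: field_simps power2_eq_square)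
  qed
  finally show ?thesis .
qed

lemma rate_stable: "rate * expectation B < 1"
  by (simp add: rate_times_mean \<rho>_less_1)

lemma W_D_integrable: "integrable (distr M borel B) (\<lambda>b. W (z - b))"
  using W_bounds by (intro jumps.integrable_const_bound[where B = 1]) auto

lemma hits_prob_le:
  assumes h: "0 < h" and x: "0 \<le> x"
  shows "prob (\<Union>n. hit_event \<rho> h x n) \<le> 1 - (\<integral>b. W (x - b) \<partial>distr M borel B) / W x
    + 3 * rate\<^sup>2 * h / (W x * (1 - rate * expectation B)) * (expectation B + h) + rate * h / W x"
proof -
  let ?D = "distr M borel B"
  define c where "c = 3 * rate\<^sup>2 * h / (W x * (1 - rate * expectation B))"
  define d where "d = rate * h / W x"
  have Wx: "0 < W x" by (rule W_pos[OF x])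
  have c: "0 \<le> c" using h Wx rate_stable by (simp add: c_def)
  have d: "0 \<le> d" using h Wx rate_pos by (simp add: d_def)
  define u where "u b = 1 - W (x - b) / W x + c * (b + h) + d" for b
  have u_int: "integrable ?D u"
    unfolding u_def[abs_def] using W_D_integrable jumps.D_integrable by simp
  have u_nonneg: "0 \<le> u b" if "0 \<le> b" for b
  proof -
    have "W (x - b) / W x \<le> 1" using that Wx by (simp add: monoD[OF W_mono])
    moreover have "0 \<le> c * (b + h)" using c that h by simp
    ultimately show ?thesis unfolding u_def using d by linarith
  qed
  have "prob (hit_event \<rho> h x n) \<le> (\<integral>b. u b \<partial>?D)" for n
  proof -
    have "ennreal (prob (hit_event \<rho> h x n)) = (\<integral>\<^sup>+b. jumps.hit_prob (rate * h) h x n b \<partial>?D)"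
      using emeasure_hit_event[OF \<rho>_pos h, of x n] by (simp add: emeasure_eq_measure rate_def)
    also have "\<dots> \<le> (\<integral>\<^sup>+b. ennreal (u b) \<partial>?D)"
    proof (rule nn_integral_mono_AE)
      show "AE b in ?D. jumps.hit_prob (rate * h) h x n b \<le> ennreal (u b)"
        using jumps.D_nonneg
      proof eventually_elim
        case (elim b)
        show ?case
          unfolding u_def c_def d_def
        proof (rule jumps.hit_prob_upper[OF rate_pos rate_stable h x W_measurable W_neg W_bounds Wx])
          show "W z \<le> W x + rate * h" if "0 \<le> z" "z \<le> x + h" for z
          proof -
            have "W z \<le> W (x + h)" using that by (intro monoD[OF W_mono])
            also have "\<dots> \<le> W x + rate * (x + h - x)" using x h by (intro W_growth) auto
            finally show ?thesis by simp
          qed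
          show "h * jumps.drift rate W (z + h) - rate\<^sup>2 * h\<^sup>2 \<le> W (z + h) - W z" if z: "0 \<le> z" for z
          proof -
            have "(\<integral>v. (w (z + h) - rate\<^sup>2 * h) * indicator {z<..z + h} v \<partial>lborel)
                \<le> (\<integral>v. w v * indicator {z<..z + h} v \<partial>lborel)"
            proof (rule integral_mono)
              show "integrable lborel (\<lambda>v. (w (z + h) - rate\<^sup>2 * h) * indicator {z<..z + h} v)"
                using h by (intro integrable_mult_right integrable_real_indicator) auto
              show "integrable lborel (\<lambda>v. w v * indicator {z<..z + h} v)"
                by (rule w_indicator_integrable) simp
              fix v :: real
              show "(w (z + h) - rate\<^sup>2 * h) * indicator {z<..z + h} v \<le> w v * indicator {z<..z + h} v"
              proof (cases "v \<in> {z<..z + h}")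
                case True
                then have "w (z + h) \<le> w v + rate\<^sup>2 * (z + h - v)"
                  using z by (intro w_almost_decreasing) auto
                also have "rate\<^sup>2 * (z + h - v) \<le> rate\<^sup>2 * h"
                  using True by (intro mult_left_mono) auto
                finally show ?thesis using True by simp
              qed simp
            qed
            then show ?thesis
              using z h W_diff[of z "z + h"] drift_W[of "z + h"]
              by (simp add: algebra_simps power2_eq_square)
          qed
        qed (use elim h in auto)
      qed
    qed
    also have "\<dots> = ennreal (\<integral>b. u b \<partial>?D)"
      using jumps.D_nonneg by (intro nn_integral_eq_integral u_int) (auto elim!: eventually_mono intro: u_nonneg)
    finally show ?thesis
      using jumps.D_nonneg
      by (subst (asm) ennreal_le_iff) (auto intro!: integral_nonneg_AE elim!: eventually_mono intro: u_nonneg)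
  qed
  moreover have "(\<lambda>n. prob (hit_event \<rho> h x n)) \<longlonglongrightarrow> prob (\<Union>n. hit_event \<rho> h x n)"
    by (intro finite_Lim_measure_incseq) (auto simp: incseq_def intro: hit_event_sets[OF \<rho>_pos h] dest: hit_event_mono)
  ultimately have "prob (\<Union>n. hit_event \<rho> h x n) \<le> (\<integral>b. u b \<partial>?D)"
    by (intro LIMSEQ_le_const2) auto
  also have "(\<integral>b. u b \<partial>?D) = 1 - (\<integral>b. W (x - b) \<partial>?D) / W x + c * (expectation B + h) + d"
    unfolding u_def using W_D_integrable[of x] jumps.D_integrable
    by (simp add: measure_D_UNIV jumps.\<beta>_def[symmetric])
  finally show ?thesis unfolding c_def d_def .
qed

lemma V_D_integrable: "0 < \<delta> \<Longrightarrow> integrable (distr M borel B) (\<lambda>b. V \<delta> (z - b))"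
proof -
  assume \<delta>: "0 < \<delta>"
  have [measurable]: "V \<delta> \<in> borel_measurable borel" by (rule V_measurable[OF \<delta>])
  have "\<bar>V \<delta> y\<bar> \<le> 1" for y
    using V_bounds[OF \<delta>, of y] W_bounds[of y] W_bounds[of "y + \<delta>"] by simp
  then show ?thesis by (intro jumps.integrable_const_bound[where B = 1]) auto
qed

lemma hits_prob_ge:
  assumes h: "0 < h" and x: "0 \<le> x" and \<delta>: "0 < \<delta>"
  shows "1 - (\<integral>b. V \<delta> (x - b) \<partial>distr M borel B) / V \<delta> x
    - (rate / \<delta> + 2 * rate\<^sup>2) * h / (V \<delta> x * (1 - rate * expectation B)) * (expectation B + h)
    \<le> prob (\<Union>n. hit_event \<rho> h x n)"
proof -
  let ?D = "distr M borel B"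
  define c where "c = (rate / \<delta> + 2 * rate\<^sup>2) * h / (V \<delta> x * (1 - rate * expectation B))"
  define \<theta> where "\<theta> = 1 - (1 - rate * expectation B) * h / (x + h)"
  have Vx: "0 < V \<delta> x" using V_bounds(1)[OF \<delta>, of x] W_pos[OF x] by simp
  have \<theta>: "0 \<le> \<theta>" "\<theta> < 1"
  proof -
    have "(1 - rate * expectation B) * h \<le> 1 * h"
      using h rate_pos B_mean_pos by (intro mult_right_mono) auto
    then have "(1 - rate * expectation B) * h \<le> x + h" using x by simp
    then show "0 \<le> \<theta>" using x h by (simp add: \<theta>_def)
    have "0 < (1 - rate * expectation B) * h / (x + h)" using x h rate_stable by simp
    then show "\<theta> < 1" by (simp add: \<theta>_def)
  qed
  define l where "l n b = 1 - V \<delta> (x - b) / V \<delta> x - c * (b + h) - \<theta> ^ n * ((b + h) / h)" for n b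
  have l_int: "integrable ?D (l n)" for n
    unfolding l_def[abs_def] using V_D_integrable[OF \<delta>] jumps.D_integrable by simp
  have bound: "(\<integral>b. l n b \<partial>?D) \<le> prob (\<Union>n. hit_event \<rho> h x n)" for n
  proof -
    have "ennreal (\<integral>b. l n b \<partial>?D) \<le> (\<integral>\<^sup>+b. ennreal (l n b) \<partial>?D)"
      by (rule ennreal_integral_le_nn_integral[OF l_int])
    also have "\<dots> \<le> (\<integral>\<^sup>+b. jumps.hit_prob (rate * h) h x n b \<partial>?D)"
    proof (rule nn_integral_mono_AE)
      show "AE b in ?D. ennreal (l n b) \<le> jumps.hit_prob (rate * h) h x n b"
        using jumps.D_nonneg
      proof eventually_elim
        case (elim b)
        show ?case
          unfolding l_def c_def \<theta>_def
        proof (rule jumps.hit_prob_lower[OF rate_pos rate_stable h x _ V_measurable[OF \<delta>] V_mono[OF \<delta>] _ _ Vx])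
          show "0 \<le> rate / \<delta>" using rate_pos \<delta> by simp
          show "0 \<le> V \<delta> z" for z using V_bounds(1)[OF \<delta>, of z] W_bounds(1)[of z] by simp
          show "V \<delta> z \<le> 1" for z using V_bounds(2)[OF \<delta>, of z] W_bounds(2)[of "z + \<delta>"] by simp
        qed (use elim h V_increment[OF \<delta> h] in auto)
      qed
    qed
    also have "\<dots> = ennreal (prob (hit_event \<rho> h x n))"
      using emeasure_hit_event[OF \<rho>_pos h, of x n] by (simp add: emeasure_eq_measure rate_def)
    finally have "(\<integral>b. l n b \<partial>?D) \<le> prob (hit_event \<rho> h x n)"
      by (subst (asm) ennreal_le_iff) auto
    also have "\<dots> \<le> prob (\<Union>n. hit_event \<rho> h x n)"
      by (intro finite_measure_mono sets.countable_nat_UN image_subsetI hit_event_sets \<rho>_pos h) auto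
    finally show ?thesis .
  qed
  have l_integral: "(\<integral>b. l n b \<partial>?D) = 1 - (\<integral>b. V \<delta> (x - b) \<partial>?D) / V \<delta> x - c * (expectation B + h)
      - \<theta> ^ n * ((expectation B + h) / h)" for n
    unfolding l_def using V_D_integrable[OF \<delta>, of x] jumps.D_integrable
    by (simp add: measure_D_UNIV jumps.\<beta>_def[symmetric])
  have lim: "(\<lambda>n. 1 - (\<integral>b. V \<delta> (x - b) \<partial>?D) / V \<delta> x - c * (expectation B + h)
      - \<theta> ^ n * ((expectation B + h) / h))
      \<longlonglongrightarrow> 1 - (\<integral>b. V \<delta> (x - b) \<partial>?D) / V \<delta> x - c * (expectation B + h)
      - 0 * ((expectation B + h) / h)"
    using \<theta> by (intro tendsto_intros LIMSEQ_realpow_zero) auto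
  have "1 - (\<integral>b. V \<delta> (x - b) \<partial>?D) / V \<delta> x - c * (expectation B + h)
      - 0 * ((expectation B + h) / h) \<le> prob (\<Union>n. hit_event \<rho> h x n)"
  proof (rule LIMSEQ_le_const2[OF lim], intro exI allI impI)
    fix n :: nat
    show "1 - (\<integral>b. V \<delta> (x - b) \<partial>?D) / V \<delta> x - c * (expectation B + h) - \<theta> ^ n * ((expectation B + h) / h)
        \<le> prob (\<Union>n. hit_event \<rho> h x n)"
      using bound[of n] unfolding l_integral .
  qed
  then show ?thesis unfolding c_def mult_zero_left diff_zero .
qed

abbreviation cycle_prob :: "real \<Rightarrow> real" where
  "cycle_prob x \<equiv> prob {\<omega> \<in> space M. ereal x < cycle_max Bs N \<rho> \<omega>}"

text \<open>
  The mesh tends to zero first; the averaging parameter \<open>\<delta>\<close> of the lower bound follows, by right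
  continuity of \<open>W\<close>.
\<close>

lemma cycle_prob_eq_integral:
  assumes x: "0 \<le> x"
  shows "cycle_prob x = 1 - (\<integral>b. W (x - b) \<partial>distr M borel B) / W x"
proof (rule antisym)
  let ?D = "distr M borel B" and ?h = "\<lambda>j. 1 / real (Suc j)"
  have h0: "?h \<longlonglongrightarrow> 0" by real_asymp
  have Wx: "0 < W x" by (rule W_pos[OF x])
  have "cycle_prob x \<le> 1 - (\<integral>b. W (x - b) \<partial>?D) / W x
    + 3 * rate\<^sup>2 * 0 / (W x * (1 - rate * expectation B)) * (expectation B + 0) + rate * 0 / W x"
  proof (rule LIMSEQ_le[OF prob_hits_tendsto[OF \<rho>_pos x]])
    show "(\<lambda>j. 1 - (\<integral>b. W (x - b) \<partial>?D) / W x
      + 3 * rate\<^sup>2 * ?h j / (W x * (1 - rate * expectation B)) * (expectation B + ?h j) + rate * ?h j / W x)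
      \<longlonglongrightarrow> 1 - (\<integral>b. W (x - b) \<partial>?D) / W x
      + 3 * rate\<^sup>2 * 0 / (W x * (1 - rate * expectation B)) * (expectation B + 0) + rate * 0 / W x"
      using Wx rate_stable by (intro tendsto_intros h0) auto
  qed (intro exI allI impI hits_prob_le x; simp)
  then show "cycle_prob x \<le> 1 - (\<integral>b. W (x - b) \<partial>?D) / W x" by simp
  have lower: "1 - (\<integral>b. V \<delta> (x - b) \<partial>?D) / V \<delta> x \<le> cycle_prob x" if \<delta>: "0 < \<delta>" for \<delta>
  proof -
    have Vx: "0 < V \<delta> x" using V_bounds(1)[OF \<delta>, of x] Wx by simp
    have "1 - (\<integral>b. V \<delta> (x - b) \<partial>?D) / V \<delta> x
      - (rate / \<delta> + 2 * rate\<^sup>2) * 0 / (V \<delta> x * (1 - rate * expectation B)) * (expectation B + 0)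
      \<le> cycle_prob x"
    proof (rule LIMSEQ_le[OF _ prob_hits_tendsto[OF \<rho>_pos x]])
      show "(\<lambda>j. 1 - (\<integral>b. V \<delta> (x - b) \<partial>?D) / V \<delta> x
        - (rate / \<delta> + 2 * rate\<^sup>2) * ?h j / (V \<delta> x * (1 - rate * expectation B)) * (expectation B + ?h j))
        \<longlonglongrightarrow> 1 - (\<integral>b. V \<delta> (x - b) \<partial>?D) / V \<delta> x
        - (rate / \<delta> + 2 * rate\<^sup>2) * 0 / (V \<delta> x * (1 - rate * expectation B)) * (expectation B + 0)"
        using Vx rate_stable by (intro tendsto_intros h0) auto
    qed (intro exI allI impI hits_prob_ge x \<delta>; simp)
    then show ?thesis by simp
  qed
  have bound: "1 - (\<integral>b. W (x + ?h j - b) \<partial>?D) / W x \<le> cycle_prob x" for j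
  proof -
    have \<delta>: "0 < ?h j" by simp
    have "0 \<le> (\<integral>b. V (?h j) (x - b) \<partial>?D)"
      using V_bounds(1)[OF \<delta>] W_bounds(1) by (intro integral_nonneg_AE AE_I2) (meson order.trans)
    have "(\<integral>b. V (?h j) (x - b) \<partial>?D) \<le> (\<integral>b. W (x + ?h j - b) \<partial>?D)"
      using V_bounds(2)[OF \<delta>, of "x - b" for b]
      by (intro integral_mono V_D_integrable[OF \<delta>] W_D_integrable) (simp add: algebra_simps)
    then have "(\<integral>b. V (?h j) (x - b) \<partial>?D) / V (?h j) x \<le> (\<integral>b. W (x + ?h j - b) \<partial>?D) / W x"
      using V_bounds(1)[OF \<delta>, of x] Wx \<open>0 \<le> (\<integral>b. V (?h j) (x - b) \<partial>?D)\<close> by (intro frac_le) auto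
    then show ?thesis using lower[OF \<delta>] by linarith
  qed
  have lim: "(\<lambda>j. 1 - (\<integral>b. W (x + ?h j - b) \<partial>?D) / W x) \<longlonglongrightarrow> 1 - (\<integral>b. W (x - b) \<partial>?D) / W x"
  proof (intro tendsto_intros)
    have right_cont: "(\<lambda>j. W (y + ?h j)) \<longlonglongrightarrow> W y" for y
    proof (cases "0 \<le> y")
      case True
      have upper: "(\<lambda>j. W y + rate * ?h j) \<longlonglongrightarrow> W y + rate * 0"
        by (intro tendsto_intros h0)
      show ?thesis
      proof (rule tendsto_sandwich[OF _ _ tendsto_const])
        show "\<forall>\<^sub>F j in sequentially. W y \<le> W (y + ?h j)"
          by (intro always_eventually allI monoD[OF W_mono]) simp
        show "\<forall>\<^sub>F j in sequentially. W (y + ?h j) \<le> W y + rate * ?h j"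
          using W_growth[OF True, of "y + ?h j" for j] by (intro always_eventually allI) simp
        show "(\<lambda>j. W y + rate * ?h j) \<longlonglongrightarrow> W y" using upper by simp
      qed
    next
      case False
      have "\<forall>\<^sub>F j in sequentially. ?h j < - y" using False by (intro order_tendstoD(2)[OF h0]) simp
      then have "\<forall>\<^sub>F j in sequentially. W (y + ?h j) = W y"
        by eventually_elim (use False in \<open>simp add: W_neg\<close>)
      then show ?thesis by (rule tendsto_eventually)
    qed
    show "(\<lambda>j. \<integral>b. W (x + ?h j - b) \<partial>?D) \<longlonglongrightarrow> (\<integral>b. W (x - b) \<partial>?D)"
    proof (rule integral_dominated_convergence[where w = "\<lambda>_. 1"])
      show "AE b in ?D. (\<lambda>j. W (x + ?h j - b)) \<longlonglongrightarrow> W (x - b)"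
        using right_cont[of "x - b" for b] by (intro AE_I2) (simp add: algebra_simps)
      show "AE b in ?D. norm (W (x + ?h j - b)) \<le> 1" for j
        using W_bounds by (intro AE_I2) simp
    qed auto
  qed (use Wx in auto)
  show "1 - (\<integral>b. W (x - b) \<partial>?D) / W x \<le> cycle_prob x"
    by (rule LIMSEQ_le_const2[OF lim], intro exI allI impI) (rule bound)
qed

text \<open>
  The gap between \<open>W x\<close> and its average over \<open>x - b\<close> is, by the scale function equation, the
  derivative of \<open>W\<close> divided by the rate.
\<close>

theorem cycle_prob_formula:
  assumes x: "0 \<le> x"
  shows "cycle_prob x = w x / (rate * W x)"
proof -
  have "w x / (rate * W x) = (W x - (\<integral>b. W (x - b) \<partial>distr M borel B)) / W x"
    using rate_pos drift_W[OF x] by (simp add: jumps.drift_def flip: drift_W[OF x])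
  also have "\<dots> = 1 - (\<integral>b. W (x - b) \<partial>distr M borel B) / W x"
    using W_pos[OF x] by (simp add: diff_divide_distrib)
  finally show ?thesis using cycle_prob_eq_integral[OF x] by simp
qed

text \<open>
  Markov's inequality for the geometric sum.
\<close>

lemma W_lower:
  assumes x: "0 < x"
  shows "1 - \<rho> / (1 - \<rho>) * mean_excess / x \<le> W x"
proof -
  note \<rho> = \<rho>_pos \<rho>_less_1
  have "(\<integral>u. w u \<partial>lborel) = (\<integral>u. w u * indicator {..x} u + w u * indicator {x<..} u \<partial>lborel)"
    by (intro Bochner_Integration.integral_cong) (auto simp: indicator_def)
  also have "\<dots> = (\<integral>u. w u * indicator {..x} u \<partial>lborel) + (\<integral>u. w u * indicator {x<..} u \<partial>lborel)"
    by (intro Bochner_Integration.integral_add w_indicator_integrable) auto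
  finally have "1 - W x = (\<integral>u. w u * indicator {x<..} u \<partial>lborel)"
    using x by (simp add: W_def integral_w)
  moreover have "ennreal (\<integral>u. w u * indicator {x<..} u \<partial>lborel) = (\<integral>\<^sup>+u. ennreal (w u * indicator {x<..} u) \<partial>lborel)"
    using dens.w_nonneg by (intro nn_integral_eq_integral[symmetric] w_indicator_integrable) auto
  moreover have "(\<integral>\<^sup>+u. ennreal (w u * indicator {x<..} u) \<partial>lborel)
      \<le> (\<integral>\<^sup>+u. ennreal (1 / x) * (ennreal u * ennreal (w u)) \<partial>lborel)"
  proof (rule nn_integral_mono)
    fix u
    show "ennreal (w u * indicator {x<..} u) \<le> ennreal (1 / x) * (ennreal u * ennreal (w u))"
    proof (cases "x < u")
      case True
      have "w u * 1 \<le> w u * (u / x)"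
        using True x dens.w_nonneg by (intro mult_left_mono) auto
      then have "ennreal (w u) \<le> ennreal (1 / x * (u * w u))" by (intro ennreal_leI) (simp add: mult_ac)
      also have "\<dots> = ennreal (1 / x) * (ennreal u * ennreal (w u))"
        using True x by (subst ennreal_mult', simp, subst ennreal_mult', auto)
      finally show ?thesis using True by simp
    qed simp
  qed
  moreover have "(\<integral>\<^sup>+u. ennreal (1 / x) * (ennreal u * ennreal (w u)) \<partial>lborel)
      = ennreal (\<rho> / (1 - \<rho>) * mean_excess / x)"
    using x dens.first_moment_w[OF \<rho>] by (simp add: nn_integral_cmult mult.commute flip: ennreal_mult')
  ultimately have "ennreal (1 - W x) \<le> ennreal (\<rho> / (1 - \<rho>) * mean_excess / x)" by simp
  moreover have "0 \<le> \<rho> / (1 - \<rho>) * mean_excess / x"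
    using \<rho> x dens.\<mu>_nonneg by simp
  ultimately show ?thesis by (subst (asm) ennreal_le_iff) auto
qed

end

section \<open>Heavy traffic\<close>

lemma (in stable_queue) cycle_prob_ratio:
  assumes x: "0 < x" and "0 < excess x"
  shows "cycle_prob x / (\<rho> / (1 - \<rho>) * tail x) = ((1 - \<rho>) * w x / excess x) / (\<rho>\<^sup>2 * W x)"
proof -
  have "tail x = expectation B * excess x" using x B_mean_pos by (simp add: excess_def)
  then show ?thesis
    using assms \<rho>_pos \<rho>_less_1 B_mean_pos W_pos[of x]
    by (simp add: cycle_prob_formula rate_def field_simps power2_eq_square)
qed

lemma ratio_close_to_1:
  fixes g q e :: real
  assumes g: "\<bar>g - 1\<bar> \<le> e / 4" and q: "1 - e / 4 \<le> q" "q \<le> 1" and e: "0 < e" "e \<le> 1"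
  shows "\<bar>g / q - 1\<bar> \<le> e"
proof -
  have q0: "0 < q" using q e by simp
  have "\<bar>g / q - 1\<bar> = \<bar>g - q\<bar> / q" using q0 by (simp add: abs_div_pos diff_divide_distrib)
  also have "\<dots> \<le> (e / 2) / (1 / 2)"
  proof (rule frac_le)
    show "\<bar>g - q\<bar> \<le> e / 2" "1 / 2 \<le> q" using g q e by linarith+
  qed (use e in auto)
  finally show ?thesis by simp
qed

locale regularly_varying_queue = queue +
  fixes L :: "real \<Rightarrow> real" and \<alpha> :: real
  assumes L_slowly_varying: "slowly_varying L"
    and \<alpha>_gt_2: "2 < \<alpha>"
    and tail_form: "0 < x \<Longrightarrow> tail x = L x * x powr (- \<alpha>)"
begin

text \<open>
  The second moment is at least the square of the positive mean.
\<close>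

lemma mean_excess_pos: "0 < mean_excess"
proof -
  have "0 \<le> variance B" by (rule variance_positive)
  then have "(expectation B)\<^sup>2 \<le> expectation (\<lambda>\<omega>. (B \<omega>)\<^sup>2)"
    by (simp add: variance_eq[OF B_integrable B_square_integrable])
  moreover have "0 < (expectation B)\<^sup>2" using B_mean_pos by simp
  ultimately have "0 < expectation (\<lambda>\<omega>. (B \<omega>)\<^sup>2)" by linarith
  then show ?thesis using B_mean_pos by (simp add: mean_excess_def)
qed

sublocale rv: regularly_varying_density excess mean_excess \<alpha>
proof
  show "excess y \<le> excess x" if "0 \<le> x" "x \<le> y" for x y
    using that by (rule dens.f_decreasing)
  show "0 \<le> excess x" for x by (rule dens.f_nonneg)
  show "((\<lambda>x. excess (a * x) / excess x) \<longlongrightarrow> a powr (- \<alpha>)) at_top" if a: "0 < a" for a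
  proof -
    have "((\<lambda>x. L (a * x) / L x * a powr (- \<alpha>)) \<longlongrightarrow> 1 * a powr (- \<alpha>)) at_top"
      using L_slowly_varying a unfolding slowly_varying_def by (intro tendsto_intros) auto
    moreover have "\<forall>\<^sub>F x in at_top. L (a * x) / L x * a powr (- \<alpha>) = excess (a * x) / excess x"
      using eventually_gt_at_top[of 0]
    proof eventually_elim
      case (elim x)
      have ax: "0 < a * x" using a elim by simp
      have "excess (a * x) / excess x = (L (a * x) * a powr (- \<alpha>)) * x powr (- \<alpha>) / (L x * x powr (- \<alpha>))"
        unfolding excess_def if_not_P[OF less_not_sym[OF ax]] if_not_P[OF less_not_sym[OF elim]]
          tail_form[OF ax] tail_form[OF elim]
        using elim a B_mean_pos by (simp add: powr_mult)
      also have "\<dots> = L (a * x) / L x * a powr (- \<alpha>)" using elim by simp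
      finally show ?case ..
    qed
    ultimately show ?thesis by (simp add: tendsto_cong)
  qed
qed (rule \<alpha>_gt_2 mean_excess_pos)+

text \<open>
  In the quotient \<open>(1 - \<rho>) * w x / excess x\<close> divided by \<open>\<rho>\<^sup>2 * W x\<close> the numerator tends to one by
  \<open>w_asymptotic\<close>, and \<open>W x\<close> by Markov's inequality, because \<open>x\<close> exceeds the mean \<open>\<rho> / (1 - \<rho>) *
  mean_excess\<close> of the geometric sum by a factor of order \<open>ln (1 / (1 - \<rho>))\<close>.
\<close>

theorem cycle_max_uniform:
  assumes "0 < e"
  shows "\<forall>\<^sub>F \<rho> in at_left 1. \<forall>x. mean_excess * (\<alpha> - 1) * (1 / (1 - \<rho>)) * ln (1 / (1 - \<rho>)) \<le> x \<longrightarrow>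
    \<bar>prob {\<omega> \<in> space M. ereal x < cycle_max Bs N \<rho> \<omega>} / (\<rho> / (1 - \<rho>) * tail x) - 1\<bar> \<le> e"
proof -
  define d where "d = min e 1"
  have d: "0 < d" "d \<le> 1" "d \<le> e" using assms by (auto simp: d_def)
  \<comment> \<open>This bound on the logarithm brings the error of Markov's inequality below \<open>d / 8\<close>.\<close>
  define \<Lambda>0 where "\<Lambda>0 = 8 / (d * (\<alpha> - 1))"
  have \<Lambda>0: "0 < \<Lambda>0" using d \<alpha>_gt_2 by (simp add: \<Lambda>0_def)
  have \<kappa>_lim: "filterlim (\<lambda>\<rho>. 1 - \<rho>) (at_right 0) (at_left (1::real))"
    by real_asymp
  have "LIM \<kappa> at_right (0::real). ln (1 / \<kappa>) :> at_top" by real_asymp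
  from filterlim_compose[OF this \<kappa>_lim]
  have "\<forall>\<^sub>F \<rho> in at_left (1::real). \<Lambda>0 \<le> ln (1 / (1 - \<rho>))"
    by (auto simp: filterlim_at_top)
  moreover have "\<forall>\<^sub>F \<rho> in at_left (1::real). 1 - d / 16 < \<rho>"
    using d by (subst eventually_at_left[of 0 1]) (auto intro!: exI[of _ "1 - d / 16"])
  moreover have "0 < d / 4" using d by simp
  note rv.w_asymptotic[OF this]
  ultimately show ?thesis
  proof eventually_elim
    case (elim \<rho>)
    then have \<rho>: "0 < \<rho>" "\<rho> < 1" by auto
    interpret stable_queue M B Bs N \<rho> by unfold_locales (use \<rho> in auto)
    let ?\<Lambda> = "ln (1 / (1 - \<rho>))"
    show ?case
    proof (intro allI impI)
      fix x assume x: "mean_excess * (\<alpha> - 1) * (1 / (1 - \<rho>)) * ?\<Lambda> \<le> x"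
      have "0 < ?\<Lambda>" using elim \<Lambda>0 by linarith
      then have "0 < mean_excess * (\<alpha> - 1) * (1 / (1 - \<rho>)) * ?\<Lambda>"
        using mean_excess_pos \<alpha>_gt_2 \<rho> by (intro mult_pos_pos) auto
      then have x0: "0 < x" using x by linarith
      have fx: "0 < excess x" using rv.T_pos[of x] x0 by simp
      have g: "\<bar>(1 - \<rho>) * w x / excess x - 1\<bar> \<le> d / 4" using elim x by blast
      have "\<rho> / (1 - \<rho>) * mean_excess / x \<le> d / 8"
      proof -
        have "mean_excess * (\<alpha> - 1) * ?\<Lambda> \<le> (1 - \<rho>) * x"
          using x \<rho> by (simp add: field_simps)
        moreover have "mean_excess * (\<alpha> - 1) * \<Lambda>0 \<le> mean_excess * (\<alpha> - 1) * ?\<Lambda>"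
          using elim mean_excess_pos \<alpha>_gt_2 by (intro mult_left_mono) auto
        moreover have "mean_excess * (\<alpha> - 1) * \<Lambda>0 = 8 * mean_excess / d"
          using \<alpha>_gt_2 by (simp add: \<Lambda>0_def)
        ultimately have "8 * mean_excess / d \<le> (1 - \<rho>) * x" by linarith
        then have "mean_excess \<le> d / 8 * ((1 - \<rho>) * x)" using d by (simp add: field_simps)
        then have "mean_excess / ((1 - \<rho>) * x) \<le> d / 8"
          using x0 \<rho> by (subst pos_divide_le_eq) auto
        moreover have "\<rho> / (1 - \<rho>) * mean_excess / x = \<rho> * (mean_excess / ((1 - \<rho>) * x))" by simp
        moreover have "\<rho> * (mean_excess / ((1 - \<rho>) * x)) \<le> 1 * (mean_excess / ((1 - \<rho>) * x))"
          using \<rho> x0 mean_excess_pos by (intro mult_right_mono) auto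
        ultimately show ?thesis by linarith
      qed
      then have W: "1 - d / 8 \<le> W x" using W_lower[OF x0] by linarith
      have \<rho>2: "1 - d / 8 \<le> \<rho>\<^sup>2"
      proof -
        have "0 \<le> (1 - \<rho>)\<^sup>2" by simp
        then have "2 * \<rho> - 1 \<le> \<rho>\<^sup>2" by (simp add: power2_eq_square algebra_simps)
        then show ?thesis using elim by linarith
      qed
      have q: "1 - d / 4 \<le> \<rho>\<^sup>2 * W x" "\<rho>\<^sup>2 * W x \<le> 1"
      proof -
        have "(1 - d / 8) * (1 - d / 8) \<le> \<rho>\<^sup>2 * W x" using W \<rho>2 d by (intro mult_mono) auto
        moreover have "(1 - d / 8) * (1 - d / 8) = 1 - d / 4 + (d / 8)\<^sup>2"
          by (simp add: power2_eq_square algebra_simps)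
        moreover have "0 \<le> (d / 8)\<^sup>2" by simp
        ultimately show "1 - d / 4 \<le> \<rho>\<^sup>2 * W x" by linarith
        have "\<rho>\<^sup>2 * W x \<le> 1 * 1"
          using \<rho> W_bounds[of x] by (intro mult_mono) (auto simp: power_le_one)
        then show "\<rho>\<^sup>2 * W x \<le> 1" by simp
      qed
      show "\<bar>cycle_prob x / (\<rho> / (1 - \<rho>) * tail x) - 1\<bar> \<le> e"
        using ratio_close_to_1[OF g q d(1,2)] d(3) cycle_prob_ratio[OF x0 fx] by simp
    qed
  qed
qed

end

text \<open>
  The supremum is taken in the extended reals, where it exists without a boundedness proof; it is
  nonnegative because the range contains its left end.
\<close>

lemma SUP_tendsto_zero:
  fixes g :: "real \<Rightarrow> real \<Rightarrow> real" and c :: "real \<Rightarrow> real"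
  assumes "\<And>e. 0 < e \<Longrightarrow> \<forall>\<^sub>F r in F. \<forall>x\<ge>c r. \<bar>g r x\<bar> \<le> e"
  shows "((\<lambda>r. SUP x\<in>{c r..}. ereal \<bar>g r x\<bar>) \<longlongrightarrow> 0) F"
proof (rule order_tendstoI)
  fix a :: ereal assume "a < 0"
  have "a < (SUP x\<in>{c r..}. ereal \<bar>g r x\<bar>)" for r
  proof -
    note \<open>a < 0\<close>
    also have "0 \<le> ereal \<bar>g r (c r)\<bar>" by simp
    also have "\<dots> \<le> (SUP x\<in>{c r..}. ereal \<bar>g r x\<bar>)" by (rule SUP_upper) simp
    finally show ?thesis .
  qed
  then show "\<forall>\<^sub>F r in F. a < (SUP x\<in>{c r..}. ereal \<bar>g r x\<bar>)" by simp
next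
  fix a :: ereal assume "0 < a"
  then obtain e where e: "0 < ereal e" "ereal e < a" using ereal_dense2 by blast
  then have "0 < e" by simp
  from assms[OF this] show "\<forall>\<^sub>F r in F. (SUP x\<in>{c r..}. ereal \<bar>g r x\<bar>) < a"
  proof eventually_elim
    case (elim r)
    then have "(SUP x\<in>{c r..}. ereal \<bar>g r x\<bar>) \<le> ereal e" by (intro SUP_least) auto
    then show ?case using e(2) by (rule le_less_trans)
  qed
qed

theorem theorem3p2:
  fixes M :: "'a measure"
    and B :: "'a \<Rightarrow> real"
    and Bs :: "nat \<Rightarrow> 'a \<Rightarrow> real"
    and N :: "real \<Rightarrow> 'a \<Rightarrow> nat"
    and L :: "real \<Rightarrow> real"
    and \<alpha> \<mu> :: real
  assumes "prob_space M"
    and "B \<in> borel_measurable M"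
    and "prob_space.indep_vars M (\<lambda>_. borel) Bs UNIV"
    and "\<And>i. distr M borel (Bs i) = distr M borel B"
    and "\<And>\<omega>. \<omega> \<in> space M \<Longrightarrow> 0 \<le> B \<omega>"
    and "\<And>i \<omega>. \<omega> \<in> space M \<Longrightarrow> 0 \<le> Bs i \<omega>"
    and "measure M {\<omega>\<in>space M. B \<omega> \<le> 0} = 0"
    and "integrable M B"
    and "0 < (LINT \<omega>|M. B \<omega>)"
    and "integrable M (\<lambda>\<omega>. (B \<omega>)\<^sup>2)"
    and "prob_space.poisson_process M (1 / (LINT \<omega>|M. B \<omega>)) N"
    and "prob_space.indep_elements M
           (Pi\<^sub>M UNIV (\<lambda>_::nat. borel)) (\<lambda>\<omega> i. Bs i \<omega>)
           (Pi\<^sub>M {0..} (\<lambda>_::real. count_space UNIV)) (\<lambda>\<omega>. \<lambda>t\<in>{0..}. N t \<omega>)"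
    and "slowly_varying L"
    and "\<alpha> > 2" and "\<alpha> \<noteq> 3"
    and "\<And>x. x > 0 \<Longrightarrow> measure M {\<omega>\<in>space M. B \<omega> > x} = L x * x powr (- \<alpha>)"
    and "\<mu> = (LINT \<omega>|M. (B \<omega>)\<^sup>2) / (2 * (LINT \<omega>|M. B \<omega>))"
  shows
    "(\<forall>k>1.
        ((\<lambda>\<rho>. SUP x\<in>{x_threshold \<mu> \<alpha> k \<rho>..}.
            ereal \<bar>measure M {\<omega>\<in>space M. cycle_max Bs N \<rho> \<omega> > ereal x}
                    / (\<rho> / (1 - \<rho>) * measure M {\<omega>\<in>space M. B \<omega> > x}) - 1\<bar>)
          \<longlongrightarrow> 0) (at_left 1))
     \<and> (filterlim (\<lambda>x. L x / (ln x) powr \<alpha>) at_top at_top \<longrightarrow>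
        ((\<lambda>\<rho>. SUP x\<in>{x_threshold \<mu> \<alpha> 1 \<rho>..}.
            ereal \<bar>measure M {\<omega>\<in>space M. cycle_max Bs N \<rho> \<omega> > ereal x}
                    / (\<rho> / (1 - \<rho>) * measure M {\<omega>\<in>space M. B \<omega> > x}) - 1\<bar>)
          \<longlongrightarrow> 0) (at_left 1))"
proof -
  interpret prob_space M by fact
  interpret queue M B Bs N
    by unfold_locales (use assms in auto)
  interpret regularly_varying_queue M B Bs N L \<alpha>
    by unfold_locales (use assms in \<open>auto simp: tail_def\<close>)
  have \<mu>: "\<mu> = mean_excess" using assms by (simp add: mean_excess_def)
  \<comment> \<open>The threshold increases with \<open>k\<close>, so the range for \<open>k \<ge> 1\<close> is contained in the one for \<open>k = 1\<close>.\<close>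
  have main: "((\<lambda>\<rho>. SUP x\<in>{x_threshold \<mu> \<alpha> k \<rho>..}.
            ereal \<bar>measure M {\<omega>\<in>space M. cycle_max Bs N \<rho> \<omega> > ereal x}
                    / (\<rho> / (1 - \<rho>) * measure M {\<omega>\<in>space M. B \<omega> > x}) - 1\<bar>)
          \<longlongrightarrow> 0) (at_left 1)" if k: "1 \<le> k" for k
  proof (rule SUP_tendsto_zero)
    fix e :: real assume "0 < e"
    have "\<forall>\<^sub>F \<rho> in at_left (1::real). 0 < \<rho> \<and> \<rho> < 1"
      by (subst eventually_at_left[of 0 1]) (auto intro!: exI[of _ 0])
    with cycle_max_uniform[OF \<open>0 < e\<close>]
    show "\<forall>\<^sub>F \<rho> in at_left 1. \<forall>x\<ge>x_threshold \<mu> \<alpha> k \<rho>.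
      \<bar>measure M {\<omega>\<in>space M. cycle_max Bs N \<rho> \<omega> > ereal x}
        / (\<rho> / (1 - \<rho>) * measure M {\<omega>\<in>space M. B \<omega> > x}) - 1\<bar> \<le> e"
    proof eventually_elim
      case (elim \<rho>)
      have "0 \<le> mean_excess * (\<alpha> - 1) * (1 / (1 - \<rho>)) * ln (1 / (1 - \<rho>))"
        using mean_excess_pos \<alpha>_gt_2 elim by (intro mult_nonneg_nonneg) auto
      then have "1 * (mean_excess * (\<alpha> - 1) * (1 / (1 - \<rho>)) * ln (1 / (1 - \<rho>)))
          \<le> k * (mean_excess * (\<alpha> - 1) * (1 / (1 - \<rho>)) * ln (1 / (1 - \<rho>)))"
        using k by (intro mult_right_mono)
      then have "mean_excess * (\<alpha> - 1) * (1 / (1 - \<rho>)) * ln (1 / (1 - \<rho>)) \<le> x_threshold \<mu> \<alpha> k \<rho>"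
        by (simp add: x_threshold_def \<mu> mult.assoc)
      with elim show ?case unfolding tail_def by fastforce
    qed
  qed
  show ?thesis using main by simp
qed

end
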